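(* Let $(\xi_i)_{i\ge 0}$ be independent (not necessarily identically distributed) real random variables with mean $0$ and variance $1$, and assume that they have uniformly bounded $(2+\varepsilon_0)$-moments for some $\varepsilon_0>0$. Let $f_n(x)=\sum_{i=0}^n \xi_i x^i$. Then for any $\varepsilon>0$ there exist positive constants $c$ and $C$ (not depending on $n$) such that for all $n$, $$\mathbb{P}\left(N_n(\mathbb{R})\le \mathbb{E}N_n(\mathbb{R})-\varepsilon\log n\right)\le C n^{-c}.$$ The same holds if $N_n(\mathbb{R})$ is replaced (in both occurrences) by $N_n([0,1])$, $N_n([1,\infty))$, $N_n([-1,0])$, or $N_n((-\infty,-1])$.
   Context: For a set $S\subset\mathbb{R}$, $N_n(S)$ denotes the number of roots of $f_n$ in $S$. The random variables $\xi_i$ have uniformly bounded $(2+\varepsilon_0)$-moments if there is a constant $C_0$ such that $\mathbb{E}|\xi_i|^{2+\varepsilon_0}\le C_0$ for all $i$. *)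

theory Defs
  imports "HOL-Probability.Probability"
begin

definition random_poly :: "(nat \<Rightarrow> 'a \<Rightarrow> real) \<Rightarrow> nat \<Rightarrow> 'a \<Rightarrow> real \<Rightarrow> real" where
  "random_poly \<xi> n \<omega> x = (\<Sum>i\<le>n. \<xi> i \<omega> * x ^ i)"

text \<open>
  Roots are counted as points of the set, without multiplicity. The coefficients may all vanish
  with positive probability; on that event every point is a root, and for infinite \<open>S\<close> the
  convention that an infinite set has cardinality 0 makes \<open>num_roots \<xi> n S \<omega> = 0\<close>.
  Some finite value is needed there, since otherwise the expected number of roots is infinite.
\<close>
definition num_roots :: "(nat \<Rightarrow> 'a \<Rightarrow> real) \<Rightarrow> nat \<Rightarrow> real set \<Rightarrow> 'a \<Rightarrow> nat" where
  "num_roots \<xi> n S \<omega> = card {x \<in> S. random_poly \<xi> n \<omega> x = 0}"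

text \<open>
  Integrability is stated separately because the Bochner integral of a non-integrable function is 0.
\<close>
definition uniformly_bounded_moments ::
    "'a measure \<Rightarrow> (nat \<Rightarrow> 'a \<Rightarrow> real) \<Rightarrow> real \<Rightarrow> bool" where
  "uniformly_bounded_moments M \<xi> p \<longleftrightarrow>
     (\<exists>C\<^sub>0. \<forall>i. integrable M (\<lambda>\<omega>. \<bar>\<xi> i \<omega>\<bar> powr p) \<and>
               prob_space.expectation M (\<lambda>\<omega>. \<bar>\<xi> i \<omega>\<bar> powr p) \<le> C\<^sub>0)"

end

theory Submission
  imports Defs "HOL-Real_Asymp.Real_Asymp"
begin

text \<open>
  The substitutions \<open>x \<mapsto> - x\<close> and \<open>x \<mapsto> 1 / x\<close> turn each of the four pieces of the real line into the unit
  interval, at the price of changing signs of the coefficients or reversing their order; the class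
  \<open>random_coeffs\<close> of coefficient sequences is closed under both. So the matter is to show that the number of
  roots in the unit interval is rarely far below its mean.

  Cut the interval into the windows from \<open>1 - (7/8)^k\<close> to \<open>1 - (7/8)^(k + 1)\<close>. Down to distance \<open>1/n\<close> from the
  endpoint there are of order \<open>log n\<close> of them. In window \<open>k\<close> the polynomial is governed by the coefficients of index
  close to \<open>(8/7)^k\<close>, hence distant windows are almost independent, and a sum of order \<open>log n\<close> almost
  independent bounded variables deviates by \<open>\<epsilon> log n\<close> only with probability \<open>exp (- c log n) = n^(- c)\<close>.
  The bounded variables are obtained as follows: keep only the coefficients of index within \<open>A\<close> scales of the
  window, look at \<open>L + 1\<close> equidistant points, and count the sign changes between values that are at least \<open>\<delta>\<close> in
  absolute value (\<open>near_changes\<close>). Both the actual number of roots and its mean are compared with the sum of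
  these counts.

  Upper bound for the mean (\<open>num_roots_dominated\<close>). Away from an event of small probability a window has at
  most as many roots as counted sign changes (\<open>cell_count_le_near_changes\<close>): two roots between neighbouring
  points, or one double root, would make the value at one of the points of order \<open>1 / L^2\<close>, and with high
  probability none of the values is that small (\<open>small_ball\<close>). The mean could still be carried by the exceptional
  event; this is excluded by the tail bound \<open>C / r^2\<close> for the probability of \<open>r\<close> roots in a window, with
  the same \<open>C\<close> for all windows (\<open>root_event_tail\<close>). Its proof: many roots force all Taylor coefficients at the
  left end of the window to be tiny compared with a norm of the polynomial (\<open>abs_coeff_le_of_roots\<close>). If \<open>r\<close> is
  moderate, the value itself being tiny contradicts the small-ball estimate. That estimate saturates at a power of
  the window length; for larger \<open>r\<close> the first \<open>m\<close> Taylor coefficients are used, which depend on the random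
  coefficients in a triangular way, so that they are all tiny with probability at most \<open>p^m\<close>
  (\<open>prob_triangular_small_le\<close>).

  Lower bound for the number of roots (\<open>near_changes_le_card_roots\<close>). A counted sign change of the truncated
  polynomial is one of the polynomial itself unless a distant block of coefficients contributes too much to
  the window. The influence of a block decays geometrically with the distance, so the number of windows that
  a given block can disturb has an exponential moment; the blocks are independent, and by Markov's inequality fewer
  than \<open>\<epsilon> log n\<close> windows are disturbed outside probability \<open>n^(- c)\<close> (\<open>prob_far_count_large_le\<close>). The
  truncated counts themselves are handled by Hoeffding's inequality in each residue class of windows modulo \<open>2 A\<close>
  (\<open>prob_near_changes_small_le\<close>).
\<close>

section \<open>Polynomials with many roots in a short interval\<close>

text \<open>
  A norm of this kind dominates the values on the disc of radius \<open>s\<close> and changes in a controlled way when a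
  root is divided out, which makes it a substitute for the maximum modulus in Jensen's formula.
\<close>
definition coeff_norm :: "real \<Rightarrow> real poly \<Rightarrow> real" where
  "coeff_norm s p = (\<Sum>i\<le>degree p. \<bar>coeff p i\<bar> * s ^ i)"

lemma coeff_norm_eq:
  assumes "degree p \<le> n"
  shows "coeff_norm s p = (\<Sum>i\<le>n. \<bar>coeff p i\<bar> * s ^ i)"
  unfolding coeff_norm_def
  by (rule sum.mono_neutral_left) (use assms in \<open>auto simp: coeff_eq_0\<close>)

lemma coeff_norm_nonneg: "0 \<le> s \<Longrightarrow> 0 \<le> coeff_norm s p"
  unfolding coeff_norm_def by (intro sum_nonneg) auto

lemma coeff_norm_mono: "0 \<le> s \<Longrightarrow> s \<le> t \<Longrightarrow> coeff_norm s p \<le> coeff_norm t p"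
  unfolding coeff_norm_def by (intro sum_mono mult_left_mono power_mono) auto

lemma abs_coeff_le_coeff_norm:
  assumes "0 \<le> s"
  shows "\<bar>coeff p i\<bar> * s ^ i \<le> coeff_norm s p"
proof (cases "i \<le> degree p")
  case True
  then show ?thesis
    unfolding coeff_norm_def
    by (intro member_le_sum[where f="\<lambda>i. \<bar>coeff p i\<bar> * s ^ i"]) (use assms in auto)
next
  case False
  then show ?thesis
    using coeff_norm_nonneg[OF assms, of p] by (simp add: coeff_eq_0)
qed

lemma abs_poly_le_coeff_norm:
  assumes "\<bar>y\<bar> \<le> s"
  shows "\<bar>poly p y\<bar> \<le> coeff_norm s p"
proof -
  have "\<bar>poly p y\<bar> \<le> (\<Sum>i\<le>degree p. \<bar>coeff p i * y ^ i\<bar>)"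
    unfolding poly_altdef by (rule sum_abs)
  also have "\<dots> \<le> coeff_norm s p"
    unfolding coeff_norm_def
    by (intro sum_mono) (use assms in \<open>auto simp: abs_mult power_abs intro!: mult_left_mono power_mono\<close>)
  finally show ?thesis .
qed

text \<open>
  Multiplication by \<open>y - z\<close> shifts the coefficients, which costs exactly the factor \<open>s\<close>, and perturbs the result by
  \<open>z\<close> times the original.
\<close>
lemma coeff_norm_linear_factor:
  assumes "\<bar>z\<bar> \<le> \<theta>" "0 \<le> s"
  shows "coeff_norm s ([:- z, 1:] * p) \<le> (s + \<theta>) * coeff_norm s p"
    and "(s - \<theta>) * coeff_norm s p \<le> coeff_norm s ([:- z, 1:] * p)"
proof -
  define n where "n = degree p"
  have deg: "degree ([:- z, 1:] * p) \<le> Suc n"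
    using degree_mult_le[of "[:- z, 1:]" p] by (simp add: n_def)
  have shift: "(\<Sum>i\<le>Suc n. \<bar>coeff (pCons 0 p) i\<bar> * s ^ i) = s * coeff_norm s p"
    unfolding sum.atMost_Suc_shift coeff_norm_eq[of p n s, OF eq_refl[OF n_def[symmetric]]]
    by (simp add: sum_distrib_left mult_ac)
  have same: "(\<Sum>i\<le>Suc n. \<theta> * (\<bar>coeff p i\<bar> * s ^ i)) = \<theta> * coeff_norm s p"
    using coeff_norm_eq[of p "Suc n" s] by (simp add: n_def sum_distrib_left del: sum.atMost_Suc)
  have c: "coeff ([:- z, 1:] * p) i = coeff (pCons 0 p) i - z * coeff p i" for i
    by (simp add: coeff_pCons split: nat.split)
  have z: "\<bar>z * coeff p i\<bar> \<le> \<theta> * \<bar>coeff p i\<bar>" for i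
    using assms by (simp add: abs_mult mult_right_mono)
  have "(\<Sum>i\<le>Suc n. \<bar>coeff ([:- z, 1:] * p) i\<bar> * s ^ i)
      \<le> (\<Sum>i\<le>Suc n. \<bar>coeff (pCons 0 p) i\<bar> * s ^ i + \<theta> * (\<bar>coeff p i\<bar> * s ^ i))"
  proof (rule sum_mono)
    fix i
    have "\<bar>coeff ([:- z, 1:] * p) i\<bar> \<le> \<bar>coeff (pCons 0 p) i\<bar> + \<theta> * \<bar>coeff p i\<bar>"
      unfolding c using z[of i] by linarith
    then show "\<bar>coeff ([:- z, 1:] * p) i\<bar> * s ^ i
        \<le> \<bar>coeff (pCons 0 p) i\<bar> * s ^ i + \<theta> * (\<bar>coeff p i\<bar> * s ^ i)"
      using assms(2) mult_right_mono[of _ _ "s ^ i"] by (fastforce simp: algebra_simps)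
  qed
  then show "coeff_norm s ([:- z, 1:] * p) \<le> (s + \<theta>) * coeff_norm s p"
    unfolding sum.distrib shift same coeff_norm_eq[OF deg] by (simp add: algebra_simps)
  have "(\<Sum>i\<le>Suc n. \<bar>coeff (pCons 0 p) i\<bar> * s ^ i)
      \<le> (\<Sum>i\<le>Suc n. \<bar>coeff ([:- z, 1:] * p) i\<bar> * s ^ i + \<theta> * (\<bar>coeff p i\<bar> * s ^ i))"
  proof (rule sum_mono)
    fix i
    have "\<bar>coeff (pCons 0 p) i\<bar> \<le> \<bar>coeff ([:- z, 1:] * p) i\<bar> + \<theta> * \<bar>coeff p i\<bar>"
      unfolding c using z[of i] by linarith
    then show "\<bar>coeff (pCons 0 p) i\<bar> * s ^ i
        \<le> \<bar>coeff ([:- z, 1:] * p) i\<bar> * s ^ i + \<theta> * (\<bar>coeff p i\<bar> * s ^ i)"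
      using assms(2) mult_right_mono[of _ _ "s ^ i"] by (fastforce simp: algebra_simps)
  qed
  then show "(s - \<theta>) * coeff_norm s p \<le> coeff_norm s ([:- z, 1:] * p)"
    unfolding sum.distrib shift same coeff_norm_eq[OF deg] by (simp add: algebra_simps)
qed

text \<open>
  Each root is divided out in the norm of the larger radius \<open>T\<close>, gaining \<open>1 / (T - \<theta>)\<close>, and multiplied back in the
  norm of the smaller radius \<open>s\<close>, costing \<open>s + \<theta>\<close>.
\<close>
lemma coeff_norm_le_of_roots:
  assumes "finite Z" "\<And>z. z \<in> Z \<Longrightarrow> poly p z = 0" "\<And>z. z \<in> Z \<Longrightarrow> \<bar>z\<bar> \<le> \<theta>"
    and "0 \<le> s" "s \<le> T" "\<theta> < T" "0 \<le> \<theta>"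
  shows "coeff_norm s p \<le> ((s + \<theta>) / (T - \<theta>)) ^ card Z * coeff_norm T p"
  using assms(1-3)
proof (induction Z arbitrary: p rule: finite_induct)
  case empty
  then show ?case using coeff_norm_mono[of s T p] assms by simp
next
  case (insert z Z)
  obtain p1 where p: "p = [:- z, 1:] * p1"
    using insert.prems(1)[of z] by (auto simp: poly_eq_0_iff_dvd)
  have "poly p1 y = 0" if "y \<in> Z" for y
    using insert.prems(1)[of y] insert.hyps(2) that by (auto simp: p)
  then have IH: "coeff_norm s p1 \<le> ((s + \<theta>) / (T - \<theta>)) ^ card Z * coeff_norm T p1"
    using insert.prems by (intro insert.IH) auto
  have z: "\<bar>z\<bar> \<le> \<theta>" using insert.prems by auto
  have low: "coeff_norm T p1 \<le> coeff_norm T p / (T - \<theta>)"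
    using coeff_norm_linear_factor(2)[OF z, of T p1] assms by (simp add: p field_simps)
  have "coeff_norm s p \<le> (s + \<theta>) * coeff_norm s p1"
    unfolding p using coeff_norm_linear_factor(1)[OF z assms(4)] .
  also have "\<dots> \<le> (s + \<theta>) * (((s + \<theta>) / (T - \<theta>)) ^ card Z * (coeff_norm T p / (T - \<theta>)))"
    using assms by (intro mult_left_mono order_trans[OF IH] low) auto
  also have "\<dots> = ((s + \<theta>) / (T - \<theta>)) ^ card (insert z Z) * coeff_norm T p"
    using insert.hyps by simp
  finally show ?case .
qed

text \<open>
  For \<open>s = \<theta> = 1/8\<close> and \<open>T = 1/2\<close> a root improves the bound by \<open>(1/8 + 1/8) / (1/2 - 1/8) = 2/3\<close>.
\<close>
lemma abs_coeff_le_of_roots: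
  assumes "finite Z" "\<And>z. z \<in> Z \<Longrightarrow> poly p z = 0" "Z \<subseteq> {0..1/8}"
  shows "\<bar>coeff p j\<bar> \<le> 8 ^ j * (2/3) ^ card Z * coeff_norm (1/2) p"
proof -
  have "\<bar>coeff p j\<bar> * (1/8) ^ j \<le> coeff_norm (1/8) p"
    by (rule abs_coeff_le_coeff_norm) simp
  also have "\<dots> \<le> ((1/8 + 1/8) / (1/2 - 1/8)) ^ card Z * coeff_norm (1/2) p"
    by (rule coeff_norm_le_of_roots) (use assms in auto)
  finally show ?thesis by (simp add: field_simps power_divide)
qed

text \<open>
  Dividing out two roots multiplies the norm by at most \<open>(1/2 - 1/8)^(-2)\<close>, which is less than 8.
\<close>
lemma abs_poly_le_of_two_roots:
  assumes "[:- z1, 1:] * [:- z2, 1:] dvd p"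
    and "0 \<le> u" "u \<le> v" "v \<le> 1/8" "z1 \<in> {u..v}" "z2 \<in> {u..v}"
  shows "\<bar>poly p u\<bar> \<le> 8 * (v - u)\<^sup>2 * coeff_norm (1/2) p"
proof -
  obtain q where q: "p = [:- z1, 1:] * ([:- z2, 1:] * q)"
    using assms(1) by (metis dvdE mult.assoc)
  define N where "N = coeff_norm (1/2)"
  have N0: "N r \<ge> 0" for r unfolding N_def by (rule coeff_norm_nonneg) simp
  have 1: "3/8 * N q \<le> N ([:- z2, 1:] * q)"
    using coeff_norm_linear_factor(2)[of z2 "1/8" "1/2" q] assms by (simp add: N_def)
  have 2: "3/8 * N ([:- z2, 1:] * q) \<le> N p"
    using coeff_norm_linear_factor(2)[of z1 "1/8" "1/2" "[:- z2, 1:] * q"] assms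
    unfolding N_def q by simp
  have Nq: "N q \<le> 8 * N p" using 1 2 N0[of p] by linarith
  have "\<bar>poly p u\<bar> = (\<bar>u - z1\<bar> * \<bar>u - z2\<bar>) * \<bar>poly q u\<bar>"
    unfolding q poly_mult abs_mult by simp
  also have "\<dots> \<le> ((v - u) * (v - u)) * N q"
    unfolding N_def using assms by (intro mult_mono abs_poly_le_coeff_norm) auto
  also have "\<dots> \<le> ((v - u) * (v - u)) * (8 * N p)"
    using Nq assms by (intro mult_left_mono) auto
  finally show ?thesis by (simp add: N_def power2_eq_square algebra_simps)
qed

text \<open>
  The value at \<open>u\<close> is too large for two roots in the interval, a double root included. So after dividing out one
  root the quotient keeps its sign, and the only root is a sign change.
\<close>
lemma at_most_one_root_of_large_value:
  assumes "0 \<le> u" "u < v" "v \<le> 1/8"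
    and "8 * (v - u)\<^sup>2 * coeff_norm (1/2) p < \<bar>poly p u\<bar>" "poly p v \<noteq> 0"
  shows "card {y \<in> {u..v}. poly p y = 0} \<le> (if poly p u * poly p v < 0 then 1 else 0)"
proof (cases "\<exists>z\<in>{u..v}. poly p z = 0")
  case False
  then have "{y \<in> {u..v}. poly p y = 0} = {}" by auto
  then show ?thesis by (simp only: card.empty)
next
  case True
  then obtain z where z: "z \<in> {u..v}" "poly p z = 0" by auto
  obtain q where q: "p = [:- z, 1:] * q"
    using z by (auto simp: poly_eq_0_iff_dvd)
  have qnz: "poly q y \<noteq> 0" if "y \<in> {u..v}" for y
  proof
    assume "poly q y = 0"
    then obtain r where "q = [:- y, 1:] * r" by (auto simp: poly_eq_0_iff_dvd)
    then have "[:- z, 1:] * [:- y, 1:] dvd p"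
      by (metis q dvd_triv_left mult.assoc)
    then show False
      using abs_poly_le_of_two_roots[of z y p u v] assms z that by auto
  qed
  have "{y \<in> {u..v}. poly p y = 0} \<subseteq> {z}" using qnz by (auto simp: q)
  then have c: "card {y \<in> {u..v}. poly p y = 0} \<le> 1"
    using card_mono[of "{z}"] by fastforce
  have "poly q u * poly q v > 0"
  proof (rule ccontr)
    assume "\<not> ?thesis"
    then have "poly q u * poly q v < 0"
      using qnz[of u] qnz[of v] assms by (simp add: not_less less_le)
    then show False
      using poly_IVT[of u v q] qnz assms by force
  qed
  moreover have "0 \<le> 8 * (v - u)\<^sup>2 * coeff_norm (1/2) p"
    by (simp add: coeff_norm_nonneg)
  then have "poly p u \<noteq> 0" using assms(4) by linarith
  then have "z \<noteq> u" "z \<noteq> v" using assms(5) z by auto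
  then have "(u - z) * (v - z) < 0" using z by (intro mult_neg_pos) auto
  ultimately have "((u - z) * (v - z)) * (poly q u * poly q v) < 0"
    using mult_neg_pos by blast
  then have "poly p u * poly p v < 0"
    by (simp add: q algebra_simps)
  with c show ?thesis by simp
qed

section \<open>Small-ball estimates\<close>

lemma (in prob_space) char_weighted_sum:
  fixes X :: "'b \<Rightarrow> 'a \<Rightarrow> real"
  assumes "indep_vars (\<lambda>_. borel) X I"
  shows "char (distr M borel (\<lambda>\<omega>. \<Sum>i\<in>I. a i * X i \<omega>)) t
    = (\<Prod>i\<in>I. char (distr M borel (X i)) (a i * t))"
proof -
  have rv: "random_variable borel (X i)" if "i \<in> I" for i
    using assms that by (auto simp: indep_vars_def)
  have "indep_vars (\<lambda>_. borel) (\<lambda>i \<omega>. a i * X i \<omega>) I"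
    using assms by (rule indep_vars_compose2) auto
  then have "char (distr M borel (\<lambda>\<omega>. \<Sum>i\<in>I. a i * X i \<omega>)) t
    = (\<Prod>i\<in>I. char (distr M borel (\<lambda>\<omega>. a i * X i \<omega>)) t)"
    by (rule char_distr_sum)
  also have "\<dots> = (\<Prod>i\<in>I. char (distr M borel (X i)) (a i * t))"
  proof (rule prod.cong[OF refl])
    fix i assume "i \<in> I"
    note [measurable] = rv[OF this]
    show "char (distr M borel (\<lambda>\<omega>. a i * X i \<omega>)) t = char (distr M borel (X i)) (a i * t)"
      by (simp add: char_def integral_distr mult_ac)
  qed
  finally show ?thesis .
qed

text \<open>
  The Gaussian weight is itself the characteristic function of the standard normal law, so Fubini's theorem turns
  its expectation into an average of the characteristic function of the given law.
\<close>
lemma (in real_distribution) gaussian_smoothing_le_char: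
  assumes "t > 0"
  shows "expectation (\<lambda>x. exp (- ((x / t)\<^sup>2) / 2))
    \<le> (\<integral>g. norm (char M (g / t)) \<partial>std_normal_distribution)"
proof -
  interpret N: real_distribution std_normal_distribution by (rule real_dist_normal_dist)
  interpret P: pair_prob_space M std_normal_distribution by unfold_locales
  have meas: "(\<lambda>(x, g). iexp (x / t * g)) \<in> borel_measurable (M \<Otimes>\<^sub>M std_normal_distribution)"
    by measurable
  have int: "integrable (M \<Otimes>\<^sub>M std_normal_distribution) (\<lambda>(x, g). iexp (x / t * g))"
    by (rule P.P.integrable_const_bound[where B=1]) (use meas in \<open>auto simp del: of_real_mult\<close>)
  define E where "E = expectation (\<lambda>x. exp (- ((x / t)\<^sup>2) / 2))"
  have "0 \<le> E" unfolding E_def by (rule Bochner_Integration.integral_nonneg) simp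
  have "complex_of_real E = (CLINT x|M. complex_of_real (exp (- ((x / t)\<^sup>2) / 2)))"
    unfolding E_def by (rule integral_complex_of_real[symmetric])
  also have "\<dots> = (CLINT x|M. char std_normal_distribution (x / t))"
    by (simp add: char_std_normal_distribution)
  also have "\<dots> = (CLINT x|M. CLINT g|std_normal_distribution. iexp (x / t * g))"
    by (simp add: char_def)
  also have "\<dots> = (CLINT g|std_normal_distribution. CLINT x|M. iexp (x / t * g))"
    by (rule P.Fubini_integral[OF int, symmetric])
  also have "\<dots> = (CLINT g|std_normal_distribution. char M (g / t))"
    by (simp add: char_def mult_ac)
  finally have "E = norm (CLINT g|std_normal_distribution. char M (g / t))"
    using \<open>0 \<le> E\<close> by (metis abs_of_nonneg norm_of_real)
  also have "\<dots> \<le> (\<integral>g. norm (char M (g / t)) \<partial>std_normal_distribution)"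
    by (rule integral_norm_bound)
  finally show ?thesis by (simp add: E_def)
qed

lemma gaussian_exp_square_integral_le:
  assumes "\<sigma> > 0"
  shows "integrable std_normal_distribution (\<lambda>g. exp (- (g\<^sup>2 / (2 * \<sigma>\<^sup>2))))"
    and "(\<integral>g. exp (- (g\<^sup>2 / (2 * \<sigma>\<^sup>2))) \<partial>std_normal_distribution) \<le> \<sigma>"
proof -
  interpret N: real_distribution std_normal_distribution by (rule real_dist_normal_dist)
  show int: "integrable std_normal_distribution (\<lambda>g. exp (- (g\<^sup>2 / (2 * \<sigma>\<^sup>2))))"
    by (rule N.integrable_const_bound[where B=1]) auto
  have int': "integrable lborel (\<lambda>g. std_normal_density g * exp (- (g\<^sup>2 / (2 * \<sigma>\<^sup>2))))"
    using int by (subst (asm) integrable_density) (auto simp: normal_density_nonneg)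
  have "(\<integral>g. exp (- (g\<^sup>2 / (2 * \<sigma>\<^sup>2))) \<partial>std_normal_distribution)
      = (\<integral>g. std_normal_density g * exp (- (g\<^sup>2 / (2 * \<sigma>\<^sup>2))) \<partial>lborel)"
    by (subst integral_density) (auto simp: normal_density_nonneg)
  also have "\<dots> \<le> (\<integral>g. \<sigma> * normal_density 0 \<sigma> g \<partial>lborel)"
  proof (rule integral_mono[OF int'])
    show "integrable lborel (\<lambda>g. \<sigma> * normal_density 0 \<sigma> g)"
      using assms by simp
    fix g
    have "std_normal_density g \<le> 1 / sqrt (2 * pi)"
      unfolding std_normal_density_def by (simp add: divide_right_mono)
    then have "std_normal_density g * exp (- (g\<^sup>2 / (2 * \<sigma>\<^sup>2)))
        \<le> 1 / sqrt (2 * pi) * exp (- (g\<^sup>2 / (2 * \<sigma>\<^sup>2)))"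
      by (intro mult_right_mono) auto
    also have "\<dots> = \<sigma> * normal_density 0 \<sigma> g"
      using assms by (simp add: normal_density_def real_sqrt_mult)
    finally show "std_normal_density g * exp (- (g\<^sup>2 / (2 * \<sigma>\<^sup>2))) \<le> \<sigma> * normal_density 0 \<sigma> g" .
  qed
  also have "\<dots> = \<sigma>" using assms by simp
  finally show "(\<integral>g. exp (- (g\<^sup>2 / (2 * \<sigma>\<^sup>2))) \<partial>std_normal_distribution) \<le> \<sigma>" .
qed

text \<open>
  If \<open>|char u| \<le> exp (- u^2 / 4)\<close> for one \<open>u > 0\<close>, the law gives at most \<open>anti_prob u\<close> to any interval of radius
  \<open>anti_radius u\<close>; on such an interval, centred at \<open>b\<close>, the cosine of \<open>u (x - b)\<close> is at least
  \<open>(1 + exp (- u^2 / 4)) / 2\<close>.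
\<close>
definition anti_radius :: "real \<Rightarrow> real" where
  "anti_radius u = sqrt (1 - exp (- (u\<^sup>2) / 4)) / u"

definition anti_prob :: "real \<Rightarrow> real" where
  "anti_prob u = 2 * (1 + exp (- (u\<^sup>2) / 4)) / (3 + exp (- (u\<^sup>2) / 4))"

lemma anti_radius_pos: "u > 0 \<Longrightarrow> anti_radius u > 0"
  by (simp add: anti_radius_def)

lemma anti_prob_bounds:
  assumes "u > 0"
  shows "0 < anti_prob u" "anti_prob u < 1"
proof -
  have "exp (- (u\<^sup>2) / 4) < 1" using assms by simp
  then show "0 < anti_prob u" "anti_prob u < 1" unfolding anti_prob_def
    by (auto simp: divide_simps add_pos_pos intro!: add_pos_pos)
qed

text \<open>
  The bounded moments enter only through \<open>u\<^sub>0\<close>: near the origin all characteristic functions are dominated by one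
  Gaussian. Constants will depend on \<open>u\<^sub>0\<close> alone, so that the estimates apply with the same constants to the
  reversed coefficient sequences, which are different for every \<open>n\<close>.
\<close>
locale random_coeffs = prob_space M for M :: "'a measure" +
  fixes \<xi> :: "nat \<Rightarrow> 'a \<Rightarrow> real" and u\<^sub>0 :: real
  assumes indep: "indep_vars (\<lambda>_. borel) \<xi> UNIV"
    and integrable_coeff: "\<And>i. integrable M (\<xi> i)"
    and integrable_square: "\<And>i. integrable M (\<lambda>\<omega>. (\<xi> i \<omega>)\<^sup>2)"
    and mean_zero: "\<And>i. expectation (\<xi> i) = 0"
    and second_moment: "\<And>i. expectation (\<lambda>\<omega>. (\<xi> i \<omega>)\<^sup>2) = 1"
    and u\<^sub>0_pos: "u\<^sub>0 > 0"
    and char_bound: "\<And>i u. \<bar>u\<bar> \<le> u\<^sub>0 \<Longrightarrow> norm (char (distr M borel (\<xi> i)) u) \<le> exp (- (u\<^sup>2) / 4)"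
begin

abbreviation sample :: "'a \<Rightarrow> nat \<Rightarrow> real" where
  "sample \<omega> \<equiv> (\<lambda>i. \<xi> i \<omega>)"

lemma rv [measurable]: "random_variable borel (\<xi> i)"
  using integrable_coeff by auto

text \<open>
  Majorize the indicator of \<open>{- t..t}\<close> by a Gaussian of width \<open>t\<close> and pass to the average of the characteristic
  function at \<open>g / t\<close> over a normal variable \<open>g\<close>. For \<open>|g| \<le> u\<^sub>0 t\<close> all factors are in their Gaussian range,
  because the weights are at most 1; other \<open>g\<close> are estimated by \<open>g^2 / (u\<^sub>0 t)^2\<close>. Some loss for small \<open>t\<close> is
  inevitable, since the coefficients may be discrete.
\<close>
lemma small_ball:
  assumes "finite I" "\<And>i. i \<in> I \<Longrightarrow> \<bar>a i\<bar> \<le> 1" "t > 0" "V = (\<Sum>i\<in>I. (a i)\<^sup>2)" "V > 0"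
  shows "prob {\<omega> \<in> space M. \<bar>\<Sum>i\<in>I. a i * \<xi> i \<omega>\<bar> \<le> t} \<le> exp (1/2) * (1 / (u\<^sub>0 * t)\<^sup>2 + sqrt 2 * t / sqrt V)"
proof -
  define X where "X = (\<lambda>\<omega>. \<Sum>i\<in>I. a i * \<xi> i \<omega>)"
  have [measurable]: "random_variable borel X" unfolding X_def by measurable
  define \<mu> where "\<mu> = distr M borel X"
  interpret \<mu>: real_distribution \<mu> unfolding \<mu>_def by simp
  interpret N: real_distribution std_normal_distribution by (rule real_dist_normal_dist)
  define \<sigma> where "\<sigma> = sqrt 2 * t / sqrt V"
  have \<sigma>: "\<sigma> > 0" "2 * \<sigma>\<^sup>2 = 4 * t\<^sup>2 / V"
    using assms by (auto simp: \<sigma>_def power_divide power_mult_distrib)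
  have char: "norm (char \<mu> s) \<le> exp (- (V * s\<^sup>2) / 4)" if "\<bar>s\<bar> \<le> u\<^sub>0" for s
  proof -
    have "norm (char \<mu> s) = (\<Prod>i\<in>I. norm (char (distr M borel (\<xi> i)) (a i * s)))"
      unfolding \<mu>_def X_def
      by (subst char_weighted_sum[OF indep_vars_subset[OF indep]]) (auto simp: prod_norm)
    also have "\<dots> \<le> (\<Prod>i\<in>I. exp (- ((a i * s)\<^sup>2) / 4))"
    proof (intro prod_mono conjI char_bound)
      fix i assume "i \<in> I"
      then have "\<bar>a i\<bar> * \<bar>s\<bar> \<le> 1 * u\<^sub>0"
        using assms(2) that by (intro mult_mono) auto
      then show "\<bar>a i * s\<bar> \<le> u\<^sub>0" by (simp add: abs_mult)
    qed auto
    also have "\<dots> = exp (- (V * s\<^sup>2) / 4)"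
      using assms(1) unfolding assms(4)
      by (simp add: exp_sum[symmetric] sum_distrib_right sum_divide_distrib sum_negf power_mult_distrib)
    finally show ?thesis .
  qed
  have bound: "norm (char \<mu> (g / t)) \<le> g\<^sup>2 / (u\<^sub>0 * t)\<^sup>2 + exp (- (g\<^sup>2 / (2 * \<sigma>\<^sup>2)))" for g
  proof (cases "\<bar>g / t\<bar> \<le> u\<^sub>0")
    case True
    have "exp (- (V * (g / t)\<^sup>2) / 4) = exp (- (g\<^sup>2 / (2 * \<sigma>\<^sup>2)))"
      using assms by (simp add: \<sigma> power_divide mult_ac)
    with char[OF True] show ?thesis by (simp add: add_increasing)
  next
    case False
    then have "u\<^sub>0 * t \<le> \<bar>g\<bar>" using assms(3) by (simp add: field_simps abs_mult)
    then have "(u\<^sub>0 * t)\<^sup>2 \<le> g\<^sup>2"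
      using u\<^sub>0_pos assms(3) by (metis abs_le_square_iff abs_of_pos mult_pos_pos)
    then have "1 \<le> g\<^sup>2 / (u\<^sub>0 * t)\<^sup>2"
      using u\<^sub>0_pos assms(3) by (simp add: field_simps)
    then show ?thesis using \<mu>.cmod_char_le_1[of "g / t"] by (meson add_increasing2 exp_ge_zero order_trans)
  qed
  have "prob {\<omega> \<in> space M. \<bar>X \<omega>\<bar> \<le> t} = expectation (indicator {\<omega> \<in> space M. \<bar>X \<omega>\<bar> \<le> t})"
    by (subst Bochner_Integration.integral_indicator) (auto simp: Int_def intro!: arg_cong[where f=prob])
  also have "\<dots> \<le> expectation (\<lambda>\<omega>. exp (1/2) * exp (- ((X \<omega> / t)\<^sup>2) / 2))"
  proof (rule integral_mono)
    show "integrable M (\<lambda>\<omega>. exp (1/2) * exp (- ((X \<omega> / t)\<^sup>2) / 2))"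
      by (intro integrable_mult_right integrable_const_bound[where B=1]) auto
    fix \<omega> assume "\<omega> \<in> space M"
    have "1 \<le> exp (1/2) * exp (- ((X \<omega> / t)\<^sup>2) / 2)" if "\<bar>X \<omega>\<bar> \<le> t"
    proof -
      have "\<bar>X \<omega> / t\<bar> \<le> 1" using that assms(3) by simp
      then have "(X \<omega> / t)\<^sup>2 \<le> 1" by (simp add: abs_square_le_1)
      then have "exp 0 \<le> exp (1/2 + - ((X \<omega> / t)\<^sup>2) / 2)" by (subst exp_le_cancel_iff) simp
      then show ?thesis by (simp only: exp_add exp_zero)
    qed
    then show "indicator {\<omega> \<in> space M. \<bar>X \<omega>\<bar> \<le> t} \<omega> \<le> exp (1/2) * exp (- ((X \<omega> / t)\<^sup>2) / 2)"
      by (auto simp: indicator_def)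
  qed (intro integrable_real_indicator; simp add: emeasure_eq_measure)
  also have "\<dots> = exp (1/2) * \<mu>.expectation (\<lambda>x. exp (- ((x / t)\<^sup>2) / 2))"
    by (simp add: \<mu>_def integral_distr)
  also have "\<dots> \<le> exp (1/2) * (\<integral>g. norm (char \<mu> (g / t)) \<partial>std_normal_distribution)"
    by (intro mult_left_mono \<mu>.gaussian_smoothing_le_char assms) simp
  also have "(\<integral>g. norm (char \<mu> (g / t)) \<partial>std_normal_distribution)
      \<le> (\<integral>g. g\<^sup>2 / (u\<^sub>0 * t)\<^sup>2 + exp (- (g\<^sup>2 / (2 * \<sigma>\<^sup>2))) \<partial>std_normal_distribution)"
    using integrable_std_normal_distribution_moment[of 2] gaussian_exp_square_integral_le(1)[OF \<sigma>(1)]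
    by (intro integral_mono bound Bochner_Integration.integrable_add integrable_divide N.integrable_const_bound[of "\<lambda>g. norm (char \<mu> (g / t))" 1])
      (auto intro: \<mu>.cmod_char_le_1)
  also have "\<dots> = (\<integral>g. g\<^sup>2 \<partial>std_normal_distribution) / (u\<^sub>0 * t)\<^sup>2
      + (\<integral>g. exp (- (g\<^sup>2 / (2 * \<sigma>\<^sup>2))) \<partial>std_normal_distribution)"
    using integrable_std_normal_distribution_moment[of 2] gaussian_exp_square_integral_le(1)[OF \<sigma>(1)]
    by (subst Bochner_Integration.integral_add) auto
  also have "\<dots> \<le> 1 / (u\<^sub>0 * t)\<^sup>2 + sqrt 2 * t / sqrt V"
    using gaussian_exp_square_integral_le(2)[OF \<sigma>(1)] std_normal_distribution_even_moments(1)[of 1]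
    by (simp add: \<sigma>_def)
  finally show ?thesis by (simp add: X_def)
qed

text \<open>
  For \<open>t = h powr (1/4) / sqrt h\<close> both terms of the preceding bound are at most a multiple of \<open>h powr (1/4)\<close>; balls
  of smaller radius are enlarged to this one.
\<close>
lemma small_ball_scale:
  assumes "finite I" "\<And>i. i \<in> I \<Longrightarrow> \<bar>a i\<bar> \<le> 1" "0 < h" "h \<le> 1" "1 / (8 * h) \<le> (\<Sum>i\<in>I. (a i)\<^sup>2)" "0 < b"
  shows "prob {\<omega> \<in> space M. sqrt h * \<bar>\<Sum>i\<in>I. a i * \<xi> i \<omega>\<bar> \<le> b}
    \<le> exp (1/2) * (4 + 1 / u\<^sub>0\<^sup>2) * (b + h powr (1/4))"
proof -
  \<comment> \<open>\<open>m\<close> is the scale at which the error terms are of the size of the claimed bound.\<close>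
  define V where "V = (\<Sum>i\<in>I. (a i)\<^sup>2)"
  define m where "m = max b (h powr (1/4))"
  define t where "t = m / sqrt h"
  have m: "m > 0" "b \<le> m" "h powr (1/4) \<le> m" "m \<le> b + h powr (1/4)"
    using assms by (auto simp: m_def)
  have t: "t > 0" using m assms by (simp add: t_def)
  have Vh: "1 / (8 * h) \<le> V" using assms by (simp add: V_def)
  then have V: "V > 0" using assms by (smt (verit) divide_pos_pos)
  have "prob {\<omega> \<in> space M. sqrt h * \<bar>\<Sum>i\<in>I. a i * \<xi> i \<omega>\<bar> \<le> b}
    \<le> prob {\<omega> \<in> space M. \<bar>\<Sum>i\<in>I. a i * \<xi> i \<omega>\<bar> \<le> t}"
    using assms m by (intro finite_measure_mono) (auto simp: t_def field_simps)
  also have "\<dots> \<le> exp (1/2) * (1 / (u\<^sub>0 * t)\<^sup>2 + sqrt 2 * t / sqrt V)"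
    by (rule small_ball[OF assms(1,2) t V_def V])
  also have "\<dots> \<le> exp (1/2) * (1 / u\<^sub>0\<^sup>2 * m + 4 * m)"
  proof (intro mult_left_mono add_mono)
    have "(h powr (1/4))^2 = h powr (1/2)"
      using assms by (simp add: powr_powr flip: powr_numeral)
    then have 1: "sqrt h = (h powr (1/4))^2"
      using assms by (simp add: powr_half_sqrt)
    have "h powr (1/4) \<le> 1" using assms by (simp add: powr_le1)
    then have "(h powr (1/4))^4 \<le> (h powr (1/4))^3"
      by (intro power_decreasing) auto
    also have "\<dots> \<le> m ^ 3" using m by (intro power_mono) auto
    finally have "(h powr (1/4)) ^ 4 \<le> m ^ 3" .
    moreover have "(sqrt h)\<^sup>2 = (h powr (1/4)) ^ 4" unfolding 1 by (simp flip: power_mult)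
    moreover have "m ^ 3 = m * m\<^sup>2" by (simp add: numeral_eq_Suc)
    ultimately have "(sqrt h)\<^sup>2 \<le> m * m\<^sup>2" by simp
    then have "h / m\<^sup>2 \<le> m" using m assms by (simp add: field_simps)
    then have "1 / u\<^sub>0\<^sup>2 * (h / m\<^sup>2) \<le> 1 / u\<^sub>0\<^sup>2 * m"
      by (intro mult_left_mono) auto
    then show "1 / (u\<^sub>0 * t)\<^sup>2 \<le> 1 / u\<^sub>0\<^sup>2 * m"
      using assms by (simp add: t_def power_mult_distrib power_divide)
    have "sqrt (1 / (8 * h)) \<le> sqrt V" using Vh by simp
    then have "sqrt 2 * t / sqrt V \<le> sqrt 2 * t / sqrt (1 / (8 * h))"
      using t assms V by (intro divide_left_mono mult_pos_pos) auto
    also have "\<dots> = sqrt (2 * 8) * (t * sqrt h)"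
      by (simp only: real_sqrt_divide real_sqrt_mult real_sqrt_one) (simp add: field_simps)
    also have "sqrt (2 * 8) = (4::real)" by (rule real_sqrt_unique) auto
    also have "4 * (t * sqrt h) = 4 * m" using assms by (simp add: t_def)
    finally show "sqrt 2 * t / sqrt V \<le> 4 * m" .
  qed simp
  also have "\<dots> = exp (1/2) * (4 + 1 / u\<^sub>0\<^sup>2) * m" by (simp add: algebra_simps)
  also have "\<dots> \<le> exp (1/2) * (4 + 1 / u\<^sub>0\<^sup>2) * (b + h powr (1/4))"
    using m by (intro mult_left_mono) auto
  finally show ?thesis .
qed

text \<open>
  A law concentrated near a point has a characteristic function of modulus close to 1 at \<open>u\<^sub>0\<close>.
\<close>
lemma prob_near_point_le:
  "prob {\<omega> \<in> space M. \<bar>\<xi> i \<omega> + a\<bar> \<le> anti_radius u\<^sub>0} \<le> anti_prob u\<^sub>0"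
proof -
  define \<rho> where "\<rho> = exp (- (u\<^sub>0\<^sup>2) / 4)"
  have \<rho>: "0 < \<rho>" "\<rho> < 1" using u\<^sub>0_pos by (auto simp: \<rho>_def)
  define A where "A = {\<omega> \<in> space M. \<bar>\<xi> i \<omega> + a\<bar> \<le> anti_radius u\<^sub>0}"
  have [measurable]: "A \<in> events" unfolding A_def by measurable
  have intA: "integrable M (indicat_real A)"
    by (intro integrable_real_indicator; simp add: emeasure_eq_measure)
  have intc: "integrable M (\<lambda>\<omega>. iexp (u\<^sub>0 * \<xi> i \<omega>))"
    by (rule integrable_const_bound[where B=1]) auto
  have intc': "integrable M (\<lambda>\<omega>. cos (u\<^sub>0 * (\<xi> i \<omega> + a)))"
    by (rule integrable_const_bound[where B=1]) auto
  have "(3 + \<rho>) / 2 * prob A - 1 = expectation (\<lambda>\<omega>. (3 + \<rho>) / 2 * indicat_real A \<omega> - 1)"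
    using intA by (simp add: prob_space)
  also have "\<dots> \<le> expectation (\<lambda>\<omega>. cos (u\<^sub>0 * (\<xi> i \<omega> + a)))"
  proof (rule integral_mono)
    show "integrable M (\<lambda>\<omega>. (3 + \<rho>) / 2 * indicat_real A \<omega> - 1)" using intA by simp
    fix \<omega> assume "\<omega> \<in> space M"
    have "(1 + \<rho>) / 2 \<le> cos (u\<^sub>0 * (\<xi> i \<omega> + a))" if "\<omega> \<in> A"
    proof -
      have "\<bar>u\<^sub>0 * (\<xi> i \<omega> + a)\<bar> \<le> u\<^sub>0 * anti_radius u\<^sub>0"
        using that u\<^sub>0_pos by (auto simp: A_def abs_mult)
      also have "\<dots> = sqrt (1 - \<rho>)" using u\<^sub>0_pos by (simp add: anti_radius_def \<rho>_def)
      finally have "\<bar>u\<^sub>0 * (\<xi> i \<omega> + a)\<bar>\<^sup>2 \<le> (sqrt (1 - \<rho>))\<^sup>2"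
        by (intro power_mono) auto
      then have "(u\<^sub>0 * (\<xi> i \<omega> + a))\<^sup>2 \<le> 1 - \<rho>" using \<rho> by simp
      moreover have "1 - (u\<^sub>0 * (\<xi> i \<omega> + a))\<^sup>2 / 2 \<le> cos (u\<^sub>0 * (\<xi> i \<omega> + a))"
        using cos_double_sin[of "u\<^sub>0 * (\<xi> i \<omega> + a) / 2"] abs_sin_x_le_abs_x[of "u\<^sub>0 * (\<xi> i \<omega> + a) / 2"]
          abs_le_square_iff[of "sin (u\<^sub>0 * (\<xi> i \<omega> + a) / 2)" "u\<^sub>0 * (\<xi> i \<omega> + a) / 2"]
        by (simp add: power_divide)
      ultimately show ?thesis by simp
    qed
    then show "(3 + \<rho>) / 2 * indicat_real A \<omega> - 1 \<le> cos (u\<^sub>0 * (\<xi> i \<omega> + a))"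
      using cos_ge_minus_one[of "u\<^sub>0 * (\<xi> i \<omega> + a)"] by (cases "\<omega> \<in> A") (auto simp: field_simps)
  qed (rule intc')
  also have "\<dots> = Re (CLINT \<omega>|M. iexp (u\<^sub>0 * a) * iexp (u\<^sub>0 * \<xi> i \<omega>))"
  proof -
    have "integrable M (\<lambda>\<omega>. iexp (u\<^sub>0 * a) * iexp (u\<^sub>0 * \<xi> i \<omega>))" using intc by simp
    then have "Re (CLINT \<omega>|M. iexp (u\<^sub>0 * a) * iexp (u\<^sub>0 * \<xi> i \<omega>)) = expectation (\<lambda>\<omega>. Re (iexp (u\<^sub>0 * a) * iexp (u\<^sub>0 * \<xi> i \<omega>)))"
      by (rule integral_Re[symmetric])
    also have "\<dots> = expectation (\<lambda>\<omega>. cos (u\<^sub>0 * (\<xi> i \<omega> + a)))"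
      by (rule Bochner_Integration.integral_cong)
        (auto simp: exp_add[symmetric] distrib_left[symmetric] of_real_mult[symmetric] of_real_add[symmetric] Re_exp add.commute
          simp del: of_real_mult of_real_add)
    finally show ?thesis by simp
  qed
  also have "\<dots> = Re (iexp (u\<^sub>0 * a) * char (distr M borel (\<xi> i)) u\<^sub>0)"
    by (simp add: char_def integral_distr)
  also have "\<dots> \<le> norm (iexp (u\<^sub>0 * a) * char (distr M borel (\<xi> i)) u\<^sub>0)"
    by (rule complex_Re_le_cmod)
  also have "\<dots> = norm (char (distr M borel (\<xi> i)) u\<^sub>0)"
    by (simp add: norm_mult del: of_real_mult)
  also have "\<dots> \<le> \<rho>"
    using char_bound[of u\<^sub>0 i] u\<^sub>0_pos by (simp add: \<rho>_def)
  finally have "(3 + \<rho>) / 2 * prob A \<le> 1 + \<rho>" by simp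
  then show ?thesis
    using \<rho> unfolding A_def[symmetric] anti_prob_def \<rho>_def[symmetric] by (simp add: field_simps)
qed

end

lemma (in prob_space) prob_near_independent_le:
  fixes F :: "'b \<Rightarrow> real" and U :: "'a \<Rightarrow> 'b"
  assumes ind: "indep_var L U N Y"
    and p: "\<And>a. prob {\<omega> \<in> space M. \<bar>F (U \<omega>) + a\<bar> \<le> d} \<le> p"
    and F[measurable]: "F \<in> borel_measurable L" and G[measurable]: "G \<in> borel_measurable N" and Q[measurable]: "Measurable.pred N Q"
  shows "prob {\<omega> \<in> space M. \<bar>F (U \<omega>) + G (Y \<omega>)\<bar> \<le> d \<and> Q (Y \<omega>)} \<le> p * prob {\<omega> \<in> space M. Q (Y \<omega>)}"
proof -
  have [measurable]: "random_variable L U" "random_variable N Y"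
    using indep_var_rv1[OF ind] indep_var_rv2[OF ind] by auto
  have p0: "0 \<le> p" using p[of 0] measure_nonneg order_trans by blast
  interpret X: prob_space "distr M L U" by (rule prob_space_distr) measurable
  interpret Y: prob_space "distr M N Y" by (rule prob_space_distr) measurable
  interpret P: pair_sigma_finite "distr M L U" "distr M N Y" by unfold_locales
  define S where "S = {z \<in> space (L \<Otimes>\<^sub>M N). \<bar>F (fst z) + G (snd z)\<bar> \<le> d \<and> Q (snd z)}"
  have S[measurable]: "S \<in> sets (L \<Otimes>\<^sub>M N)" unfolding S_def by measurable
  have "emeasure M {\<omega> \<in> space M. \<bar>F (U \<omega>) + G (Y \<omega>)\<bar> \<le> d \<and> Q (Y \<omega>)}
      = emeasure (distr M (L \<Otimes>\<^sub>M N) (\<lambda>\<omega>. (U \<omega>, Y \<omega>))) S"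
    by (subst emeasure_distr) (auto simp: S_def space_pair_measure measurable_space[of Y M N] measurable_space[of U M L] intro!: arg_cong[where f="emeasure M"])
  also have "\<dots> = emeasure (distr M L U \<Otimes>\<^sub>M distr M N Y) S"
    using ind unfolding indep_var_distribution_eq by simp
  also have "\<dots> = (\<integral>\<^sup>+y. emeasure (distr M L U) ((\<lambda>x. (x, y)) -` S) \<partial>distr M N Y)"
    by (rule P.emeasure_pair_measure_alt2) simp
  also have "\<dots> \<le> (\<integral>\<^sup>+y. ennreal p * indicator {y \<in> space N. Q y} y \<partial>distr M N Y)"
  proof (rule nn_integral_mono)
    fix y assume "y \<in> space (distr M N Y)"
    then have y: "y \<in> space N" by simp
    show "emeasure (distr M L U) ((\<lambda>x. (x, y)) -` S) \<le> ennreal p * indicator {y \<in> space N. Q y} y"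
    proof (cases "Q y")
      case True
      have "(\<lambda>x. (x, y)) -` S = {x \<in> space L. \<bar>F x + G y\<bar> \<le> d}"
        using y True by (auto simp: S_def space_pair_measure)
      then have "emeasure (distr M L U) ((\<lambda>x. (x, y)) -` S) = emeasure (distr M L U) {x \<in> space L. \<bar>F x + G y\<bar> \<le> d}"
        by simp
      also have "\<dots> = emeasure M {\<omega> \<in> space M. \<bar>F (U \<omega>) + G y\<bar> \<le> d}"
        by (subst emeasure_distr) (auto intro!: arg_cong[where f="emeasure M"] dest: measurable_space[of U M L, rotated])
      also have "\<dots> \<le> ennreal p" using p[of "G y"] by (simp add: emeasure_eq_measure ennreal_leI)
      finally show ?thesis using True y by simp
    next
      case False
      then have "(\<lambda>x. (x, y)) -` S = {}" by (auto simp: S_def)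
      then show ?thesis by simp
    qed
  qed
  also have "\<dots> = ennreal p * emeasure (distr M N Y) {y \<in> space N. Q y}"
    by (rule nn_integral_cmult_indicator) simp
  also have "emeasure (distr M N Y) {y \<in> space N. Q y} = emeasure M {\<omega> \<in> space M. Q (Y \<omega>)}"
    by (subst emeasure_distr) (auto intro!: arg_cong[where f="emeasure M"] dest: measurable_space[of Y M N, rotated])
  finally show ?thesis
    using p0 by (simp add: emeasure_eq_measure ennreal_mult[symmetric])
qed

context random_coeffs
begin

text \<open>
  Reveal the coefficients in the order of decreasing index: once all \<open>\<xi> i\<close> with \<open>i > j\<close> are known, the \<open>j\<close>-th
  condition confines \<open>\<xi> j\<close> to a fixed short interval.
\<close>
lemma prob_triangular_small_le:
  "prob {\<omega> \<in> space M. \<forall>j<m. \<bar>\<xi> j \<omega> + (\<Sum>i\<in>{j<..n}. w j i * \<xi> i \<omega>)\<bar> \<le> anti_radius u\<^sub>0} \<le> anti_prob u\<^sub>0 ^ m"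
proof -
  define B where "B = (\<lambda>j v. \<bar>v j + (\<Sum>i\<in>{j<..n}. w j i * v i)\<bar> \<le> anti_radius u\<^sub>0)"
  have step: "prob {\<omega> \<in> space M. \<forall>j\<in>{s..<s + d}. B j (sample \<omega>)} \<le> anti_prob u\<^sub>0 ^ d" for s d
  proof (induction d arbitrary: s)
    case 0
    then show ?case by simp
  next
    case (Suc d)
    define J where "J = {s<..max n (s + d)}"
    \<comment> \<open>All coefficients revealed before \<open>\<xi> s\<close>.\<close>
    define Y where "Y = (\<lambda>\<omega>. restrict (sample \<omega>) J)"
    define Q where "Q = (\<lambda>v. \<forall>j\<in>{Suc s..<Suc s + d}. B j v)"
    define G where "G = (\<lambda>v. \<Sum>i\<in>{s<..n}. w s i * v i :: real)"
    have comp: "(\<lambda>v. v i) \<in> borel_measurable (PiM J (\<lambda>_. borel :: real measure))" if "i \<in> J" for i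
      using that by (rule measurable_component_singleton)
    have mG: "G \<in> borel_measurable (PiM J (\<lambda>_. borel))"
      unfolding G_def by (intro borel_measurable_sum borel_measurable_times borel_measurable_const comp)
        (auto simp: J_def)
    have mQ: "Measurable.pred (PiM J (\<lambda>_. borel)) Q"
    proof -
      have "Measurable.pred (PiM J (\<lambda>_. borel)) (\<lambda>v. B j v)" if "j \<in> {Suc s..<Suc s + d}" for j
      proof -
        have [measurable]: "(\<lambda>v. v j + (\<Sum>i\<in>{j<..n}. w j i * v i)) \<in> borel_measurable (PiM J (\<lambda>_. borel))"
          by (intro borel_measurable_add borel_measurable_sum borel_measurable_times borel_measurable_const comp)
            (use that in \<open>auto simp: J_def\<close>)
        show ?thesis unfolding B_def by measurable
      qed
      then show ?thesis unfolding Q_def by (intro pred_intros_finite) auto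
    qed
    have ind: "indep_var (PiM {s} (\<lambda>_. borel)) (\<lambda>\<omega>. restrict (sample \<omega>) {s}) (PiM J (\<lambda>_. borel)) Y"
      unfolding Y_def by (rule indep_var_restrict[OF indep]) (auto simp: J_def)
    have mF: "(\<lambda>v. v s) \<in> borel_measurable (PiM {s} (\<lambda>_. borel :: real measure))"
      by (rule measurable_component_singleton) simp
    have QY: "Q (Y \<omega>) \<longleftrightarrow> (\<forall>j\<in>{Suc s..<Suc s + d}. B j (sample \<omega>))" for \<omega>
      unfolding Q_def B_def Y_def
      by (intro ball_cong refl arg_cong[where f="\<lambda>x. x \<le> anti_radius u\<^sub>0"] arg_cong[where f=abs] arg_cong2[where f="(+)"] sum.cong)
        (auto simp: J_def)
    have GY: "G (Y \<omega>) = (\<Sum>i\<in>{s<..n}. w s i * \<xi> i \<omega>)" for \<omega>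
      unfolding G_def Y_def by (rule sum.cong) (auto simp: J_def)
    have "{s..<s + Suc d} = insert s {Suc s..<Suc s + d}" by auto
    then have "{\<omega> \<in> space M. \<forall>j\<in>{s..<s + Suc d}. B j (sample \<omega>)}
        = {\<omega> \<in> space M. \<bar>\<xi> s \<omega> + G (Y \<omega>)\<bar> \<le> anti_radius u\<^sub>0 \<and> Q (Y \<omega>)}"
      unfolding QY GY by (auto simp: B_def)
    also have "prob \<dots> \<le> anti_prob u\<^sub>0 * prob {\<omega> \<in> space M. Q (Y \<omega>)}"
      using prob_near_independent_le[OF ind _ mF mG mQ, of "anti_radius u\<^sub>0" "anti_prob u\<^sub>0"] prob_near_point_le[of s]
      by simp
    also have "\<dots> \<le> anti_prob u\<^sub>0 * anti_prob u\<^sub>0 ^ d"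
      using Suc.IH[of "Suc s"] anti_prob_bounds[OF u\<^sub>0_pos] unfolding QY by (intro mult_left_mono) auto
    finally show ?case by simp
  qed
  from step[of 0 m] show ?thesis by (simp add: B_def Ball_def)
qed

end

section \<open>Local expansions and the tail of the number of roots in a cell\<close>

text \<open>
  The Taylor expansion at \<open>x\<close> of the polynomial with coefficients \<open>a\<close>, in the variable \<open>(t - x) / h\<close>. For \<open>x\<close> at
  distance \<open>h\<close> from 1 the variance of the random polynomial is of order \<open>1 / h\<close>, which explains the factor
  \<open>sqrt h\<close>.
\<close>
definition local_poly :: "(nat \<Rightarrow> real) \<Rightarrow> nat \<Rightarrow> real \<Rightarrow> real \<Rightarrow> real poly" where
  "local_poly a n x h =
    (\<Sum>j\<le>n. monom (sqrt h * h ^ j * (\<Sum>i\<le>n. of_nat (i choose j) * x ^ (i - j) * a i)) j)"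

lemma coeff_local_poly:
  "coeff (local_poly a n x h) j = sqrt h * h ^ j * (\<Sum>i\<le>n. of_nat (i choose j) * x ^ (i - j) * a i)"
proof (cases "j \<le> n")
  case True
  then show ?thesis
    by (simp add: local_poly_def coeff_sum if_distrib cong: if_cong)
next
  case False
  then have "(\<Sum>i\<le>n. of_nat (i choose j) * x ^ (i - j) * a i) = 0"
    by (intro sum.neutral) (auto simp: binomial_eq_0)
  then show ?thesis using False
    by (simp add: local_poly_def coeff_sum)
qed

lemma degree_local_poly: "degree (local_poly a n x h) \<le> n"
  by (rule degree_le) (auto simp: local_poly_def coeff_sum)

lemma poly_local_poly:
  "poly (local_poly a n x h) y = sqrt h * (\<Sum>i\<le>n. a i * (x + h * y) ^ i)"
proof -
  have "(\<Sum>i\<le>n. a i * (x + h * y) ^ i)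
      = (\<Sum>i\<le>n. \<Sum>j\<le>n. a i * (of_nat (i choose j) * (h * y) ^ j * x ^ (i - j)))"
  proof (rule sum.cong[OF refl])
    fix i assume i: "i \<in> {..n}"
    have "(x + h * y) ^ i = (\<Sum>j\<le>i. of_nat (i choose j) * (h * y) ^ j * x ^ (i - j))"
      by (subst add.commute) (rule binomial_ring)
    also have "\<dots> = (\<Sum>j\<le>n. of_nat (i choose j) * (h * y) ^ j * x ^ (i - j))"
      by (rule sum.mono_neutral_left) (use i in \<open>auto simp: binomial_eq_0\<close>)
    finally show "a i * (x + h * y) ^ i
      = (\<Sum>j\<le>n. a i * (of_nat (i choose j) * (h * y) ^ j * x ^ (i - j)))"
      by (simp add: sum_distrib_left)
  qed
  also have "\<dots> = (\<Sum>j\<le>n. \<Sum>i\<le>n. a i * (of_nat (i choose j) * (h * y) ^ j * x ^ (i - j)))"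
    by (rule sum.swap)
  finally show ?thesis
    by (simp add: local_poly_def poly_sum poly_monom sum_distrib_left sum_distrib_right power_mult_distrib mult_ac)
qed

text \<open>
  Base points and scales of the cells. The scale is the distance to 1 until it reaches \<open>1 / n\<close>; there the growth of
  the polynomial stops, and all points closer to 1 share this scale.
\<close>
definition admissible :: "nat \<Rightarrow> real \<Rightarrow> real \<Rightarrow> bool" where
  "admissible n x h \<longleftrightarrow> n \<ge> 1 \<and> 1 / real n \<le> h \<and> h \<le> 1 \<and> 1 - h \<le> x \<and> x \<le> 1 \<and> (x = 1 - h \<or> h = 1 / real n)"

lemma admissibleD:
  assumes "admissible n x h"
  shows "n \<ge> 1" "0 < h" "h \<le> 1" "0 \<le> x" "x \<le> 1" "1 / real n \<le> h" "1 - h \<le> x"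
proof -
  show *: "n \<ge> 1" "h \<le> 1" "0 \<le> x" "x \<le> 1" "1 / real n \<le> h" "1 - h \<le> x"
    using assms by (auto simp: admissible_def)
  then show "0 < h" by (smt (verit) divide_pos_pos of_nat_0_less_iff less_le_trans zero_less_one)
qed

lemma sum_powers_lower_bound:
  assumes "n \<ge> 1" "1 / real n \<le> h" "h \<le> 1" "1 - h \<le> x"
  shows "1 / (8 * h) \<le> (\<Sum>i\<le>n. (x ^ i)\<^sup>2)"
proof -
  have h: "0 < h" using assms by (smt (verit) divide_pos_pos of_nat_0_less_iff less_le_trans zero_less_one)
  define m where "m = nat \<lfloor>1 / (4 * h)\<rfloor>"
  have m: "real m \<le> 1 / (4 * h)" "1 / (4 * h) < real m + 1"
    using h by (auto simp: m_def)
  have "1 / (4 * h) \<le> real n" using assms h by (simp add: field_simps)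
  then have mn: "m \<le> n" using m(1) by linarith
  have half: "1/2 \<le> (x ^ i)\<^sup>2" if "i \<le> m" for i
  proof -
    have "real i \<le> 1 / (4 * h)" using that m(1) by linarith
    then have "real (2 * i) * h \<le> 1/2" using h by (simp add: field_simps)
    then have "1/2 \<le> 1 + real (2 * i) * (- h)" by simp
    also have "\<dots> \<le> (1 + (- h)) ^ (2 * i)" by (rule Bernoulli_inequality) (use assms in simp)
    also have "\<dots> \<le> x ^ (2 * i)" using assms by (intro power_mono) auto
    finally show ?thesis by (simp add: power_mult mult.commute flip: power_mult)
  qed
  have "1 / (8 * h) \<le> (\<Sum>i\<le>m. 1/2)" using m h by (simp add: field_simps)
  also have "\<dots> \<le> (\<Sum>i\<le>m. (x ^ i)\<^sup>2)" using half by (intro sum_mono) auto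
  also have "\<dots> \<le> (\<Sum>i\<le>n. (x ^ i)\<^sup>2)" using mn by (intro sum_mono2) auto
  finally show ?thesis .
qed

text \<open>
  These are partial sums of the series of \<open>(1 - x)^(- j - 1)\<close>.
\<close>
lemma sum_binomial_powers_le:
  assumes "0 \<le> x" "x < (1::real)"
  shows "(\<Sum>i\<le>n. of_nat (i choose j) * x ^ (i - j)) * (1 - x) ^ Suc j \<le> 1"
proof (induction j arbitrary: n)
  case 0
  have "(\<Sum>i\<le>n. x ^ i) * (1 - x) = 1 - x ^ Suc n"
    using assms by (simp add: sum_gp0)
  then show ?case using assms by simp
next
  case (Suc j)
  show ?case
  proof (cases n)
    case 0
    then show ?thesis using assms by (simp add: power_le_one)
  next
    case (Suc m)
    define S where "S = (\<lambda>n j. \<Sum>i\<le>n. of_nat (i choose j) * x ^ (i - j) :: real)"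
    have S0: "0 \<le> S n j" for n j using assms by (auto simp: S_def intro!: sum_nonneg)
    have "S (Suc m) (Suc j) = (\<Sum>i\<le>m. of_nat (i choose j) * x ^ (i - j) + of_nat (i choose Suc j) * x ^ (i - j))"
      unfolding S_def sum.atMost_Suc_shift by (simp add: algebra_simps)
    also have "\<dots> = S m j + x * S m (Suc j)"
    proof -
      have key: "real (i choose Suc j) * x ^ (i - j) = x * (of_nat (i choose Suc j) * x ^ (i - Suc j))" for i
        by (cases "i \<le> j") (auto simp: binomial_eq_0 Suc_diff_le[symmetric] simp flip: power_Suc)
      show ?thesis by (simp only: S_def sum.distrib sum_distrib_left key)
    qed
    finally have "S (Suc m) (Suc j) = S m j + x * S m (Suc j)" .
    moreover have "x * S m (Suc j) \<le> x * S (Suc m) (Suc j)"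
      using assms by (intro mult_left_mono) (auto simp: S_def)
    ultimately have "(1 - x) * S (Suc m) (Suc j) \<le> S m j"
      by (simp add: algebra_simps)
    then have "(1 - x) * S (Suc m) (Suc j) * (1 - x) ^ Suc j \<le> S m j * (1 - x) ^ Suc j"
      using assms by (intro mult_right_mono) auto
    also have "\<dots> \<le> 1" using Suc.IH[of m] by (simp add: S_def)
    finally show ?thesis by (simp add: Suc S_def mult_ac)
  qed
qed

text \<open>
  This is a probability of the binomial distribution.
\<close>
lemma binomial_term_le_one:
  assumes "0 \<le> x" "x \<le> (1::real)"
  shows "of_nat (i choose j) * x ^ (i - j) * (1 - x) ^ j \<le> 1"
proof (cases "j \<le> i")
  case True
  have "of_nat (i choose j) * (1 - x) ^ j * x ^ (i - j) \<le> (\<Sum>k\<le>i. of_nat (i choose k) * (1 - x) ^ k * x ^ (i - k))"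
    by (rule member_le_sum[where f="\<lambda>k. of_nat (i choose k) * (1 - x) ^ k * x ^ (i - k)"]) (use True assms in auto)
  also have "\<dots> = ((1 - x) + x) ^ i" by (rule binomial_ring[symmetric])
  finally show ?thesis by (simp add: mult_ac)
qed (auto simp: binomial_eq_0)

lemma sum_taylor_weights_le:
  assumes "admissible n x h"
  shows "h * (h ^ j)\<^sup>2 * (\<Sum>i\<le>n. (of_nat (i choose j) * x ^ (i - j))\<^sup>2) \<le> 2"
proof -
  note A = admissibleD[OF assms]
  define w where "w = (\<lambda>i. of_nat (i choose j) * x ^ (i - j) :: real)"
  have w0: "0 \<le> w i" for i using A by (simp add: w_def)
  consider "x = 1 - h" | "h = 1 / real n" using assms by (auto simp: admissible_def)
  then show ?thesis
  proof cases
    case 1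
    have "h * (h ^ j)\<^sup>2 * (\<Sum>i\<le>n. (w i)\<^sup>2) = (\<Sum>i\<le>n. (w i * h ^ j) * (w i * h ^ Suc j))"
      by (simp add: sum_distrib_left power2_eq_square mult_ac)
    also have "\<dots> \<le> (\<Sum>i\<le>n. 1 * (w i * h ^ Suc j))"
      using binomial_term_le_one[of x _ j] A 1 w0
      by (intro sum_mono mult_right_mono) (auto simp: w_def)
    also have "\<dots> = (\<Sum>i\<le>n. w i) * h ^ Suc j" by (simp add: sum_distrib_right)
    also have "\<dots> \<le> 1" using sum_binomial_powers_le[of x j n] A 1 by (simp add: w_def)
    finally show ?thesis by (simp add: w_def)
  next
    case 2
    have n: "real n > 0" using A by simp
    have "w i * h ^ j \<le> 1" if "i \<le> n" for i
    proof (cases "j \<le> i")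
      case True
      have "real (i choose j) \<le> real (i ^ j)" using binomial_le_pow[OF True] by (simp only: of_nat_le_iff)
      also have "\<dots> \<le> real n ^ j" using that by (simp add: power_mono)
      finally have "w i \<le> real n ^ j * 1" unfolding w_def using A
        by (intro mult_mono power_le_one) auto
      then have "w i * h ^ j \<le> real n ^ j * h ^ j" using A by (intro mult_right_mono) auto
      also have "\<dots> = 1" using n by (simp add: 2 flip: power_mult_distrib)
      finally show ?thesis .
    qed (simp add: w_def binomial_eq_0)
    then have "(w i * h ^ j)\<^sup>2 \<le> 1" if "i \<le> n" for i
      using that w0[of i] A by (intro power_le_one) auto
    then have "h * (\<Sum>i\<le>n. (w i * h ^ j)\<^sup>2) \<le> h * (\<Sum>i\<le>n. 1)"
      using A by (intro mult_left_mono sum_mono) auto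
    also have "\<dots> \<le> 2" using n A(1) by (simp add: 2 field_simps)
    finally show ?thesis by (simp add: w_def sum_distrib_left power_mult_distrib mult_ac)
  qed
qed

text \<open>
  By \<open>abs_coeff_le_of_roots\<close> this event contains every outcome with \<open>r\<close> or more roots between \<open>x\<close> and \<open>x + h/8\<close>. It
  is an event by construction, so that root counts only need to be bounded pointwise.
\<close>
definition root_event :: "'a measure \<Rightarrow> (nat \<Rightarrow> 'a \<Rightarrow> real) \<Rightarrow> nat \<Rightarrow> real \<Rightarrow> real \<Rightarrow> nat \<Rightarrow> 'a set" where
  "root_event M \<xi> n x h r = {\<omega> \<in> space M. \<forall>j\<le>n. \<bar>coeff (local_poly (\<lambda>i. \<xi> i \<omega>) n x h) j\<bar>
     \<le> 8 ^ j * (2/3) ^ r * coeff_norm (1/2) (local_poly (\<lambda>i. \<xi> i \<omega>) n x h)}"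

context random_coeffs
begin

lemma second_moment_sum:
  assumes "finite I"
  shows "integrable M (\<lambda>\<omega>. (\<Sum>i\<in>I. a i * \<xi> i \<omega>)\<^sup>2)"
    and "expectation (\<lambda>\<omega>. (\<Sum>i\<in>I. a i * \<xi> i \<omega>)\<^sup>2) = (\<Sum>i\<in>I. (a i)\<^sup>2)"
proof -
  have "integrable M (\<lambda>\<omega>. (\<Sum>i\<in>I. a i * \<xi> i \<omega>)\<^sup>2) \<and>
    expectation (\<lambda>\<omega>. (\<Sum>i\<in>I. a i * \<xi> i \<omega>)\<^sup>2) = (\<Sum>i\<in>I. (a i)\<^sup>2)"
    using assms
  proof (induction I rule: finite_induct)
    case empty
    then show ?case by simp
  next
    case (insert k I)
    define X where "X = (\<lambda>\<omega>. a k * \<xi> k \<omega>)"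
    define S where "S = (\<lambda>\<omega>. \<Sum>i\<in>I. a i * \<xi> i \<omega>)"
    have "indep_vars (\<lambda>_. borel) (\<lambda>i \<omega>. a i * \<xi> i \<omega>) UNIV"
      using indep by (rule indep_vars_compose2) auto
    then have ind: "indep_var borel X borel S"
      unfolding X_def S_def
      by (intro indep_vars_sum insert.hyps) (rule indep_vars_subset, auto)
    have iX: "integrable M X" and iS: "integrable M S"
      using integrable_coeff by (auto simp: X_def S_def)
    have iX2: "integrable M (\<lambda>\<omega>. (X \<omega>)\<^sup>2)" "expectation (\<lambda>\<omega>. (X \<omega>)\<^sup>2) = (a k)\<^sup>2"
      using integrable_square second_moment by (auto simp: X_def power_mult_distrib)
    have iS2: "integrable M (\<lambda>\<omega>. (S \<omega>)\<^sup>2)" "expectation (\<lambda>\<omega>. (S \<omega>)\<^sup>2) = (\<Sum>i\<in>I. (a i)\<^sup>2)"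
      using insert.IH by (auto simp: S_def)
    have iXS: "integrable M (\<lambda>\<omega>. X \<omega> * S \<omega>)" by (rule indep_var_integrable[OF ind iX iS])
    have eX: "expectation X = 0" using mean_zero by (simp add: X_def)
    have XS: "expectation (\<lambda>\<omega>. X \<omega> * S \<omega>) = 0"
      by (subst indep_var_lebesgue_integral[OF ind iX iS]) (simp add: eX)
    have sq: "(\<Sum>i\<in>insert k I. a i * \<xi> i \<omega>)\<^sup>2 = (X \<omega>)\<^sup>2 + 2 * (X \<omega> * S \<omega>) + (S \<omega>)\<^sup>2" for \<omega>
      using insert.hyps by (simp add: X_def S_def power2_sum algebra_simps)
    show ?case unfolding sq using iX2 iS2 iXS XS insert.hyps by simp
  qed
  then show "integrable M (\<lambda>\<omega>. (\<Sum>i\<in>I. a i * \<xi> i \<omega>)\<^sup>2)"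
    "expectation (\<lambda>\<omega>. (\<Sum>i\<in>I. a i * \<xi> i \<omega>)\<^sup>2) = (\<Sum>i\<in>I. (a i)\<^sup>2)" by auto
qed

abbreviation local_rpoly :: "nat \<Rightarrow> real \<Rightarrow> real \<Rightarrow> 'a \<Rightarrow> real poly" where
  "local_rpoly n x h \<omega> \<equiv> local_poly (sample \<omega>) n x h"

abbreviation local_norm :: "nat \<Rightarrow> real \<Rightarrow> real \<Rightarrow> 'a \<Rightarrow> real" where
  "local_norm n x h \<omega> \<equiv> coeff_norm (1/2) (local_rpoly n x h \<omega>)"

lemma local_coeff_measurable [measurable]: "(\<lambda>\<omega>. coeff (local_rpoly n x h \<omega>) j) \<in> borel_measurable M"
  unfolding coeff_local_poly by measurable

lemma local_norm_measurable [measurable]: "local_norm n x h \<in> borel_measurable M"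
  unfolding coeff_norm_eq[OF degree_local_poly] by measurable

lemma local_poly_measurable [measurable]: "(\<lambda>\<omega>. poly (local_rpoly n x h \<omega>) y) \<in> borel_measurable M"
  unfolding poly_local_poly by measurable

lemma root_event_measurable [measurable]: "root_event M \<xi> n x h r \<in> events"
  unfolding root_event_def by measurable

lemma local_norm_expectation:
  assumes "admissible n x h"
  shows "integrable M (local_norm n x h)" "expectation (local_norm n x h) \<le> 3"
proof -
  note A = admissibleD[OF assms]
  define b where "b = (\<lambda>j \<omega>. coeff (local_rpoly n x h \<omega>) j)"
  have [measurable]: "b j \<in> borel_measurable M" for j unfolding b_def by measurable
  have b: "b j \<omega> = (\<Sum>i\<le>n. (sqrt h * h ^ j * (of_nat (i choose j) * x ^ (i - j))) * \<xi> i \<omega>)" for j \<omega>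
    by (simp add: b_def coeff_local_poly sum_distrib_left mult_ac)
  have i2: "integrable M (\<lambda>\<omega>. (b j \<omega>)\<^sup>2)" for j
    unfolding b by (rule second_moment_sum) simp
  have e2: "expectation (\<lambda>\<omega>. (b j \<omega>)\<^sup>2) \<le> 2" for j
  proof -
    have "expectation (\<lambda>\<omega>. (b j \<omega>)\<^sup>2) = (\<Sum>i\<le>n. (sqrt h * h ^ j * (of_nat (i choose j) * x ^ (i - j)))\<^sup>2)"
      unfolding b by (rule second_moment_sum) simp
    also have "\<dots> = h * (h ^ j)\<^sup>2 * (\<Sum>i\<le>n. (of_nat (i choose j) * x ^ (i - j))\<^sup>2)"
      using A by (simp add: power_mult_distrib sum_distrib_left mult_ac)
    also have "\<dots> \<le> 2" by (rule sum_taylor_weights_le[OF assms])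
    finally show ?thesis .
  qed
  have le: "\<bar>b j \<omega>\<bar> \<le> (1 + (b j \<omega>)\<^sup>2) / 2" for j \<omega>
    using sum_squares_bound[of 1 "\<bar>b j \<omega>\<bar>"] by simp
  have i1: "integrable M (\<lambda>\<omega>. \<bar>b j \<omega>\<bar>)" for j
    by (rule Bochner_Integration.integrable_bound[of _ "\<lambda>\<omega>. (1 + (b j \<omega>)\<^sup>2) / 2"])
      (use i2 le in \<open>auto intro!: AE_I2\<close>)
  have e1: "expectation (\<lambda>\<omega>. \<bar>b j \<omega>\<bar>) \<le> 3/2" for j
  proof -
    have "expectation (\<lambda>\<omega>. \<bar>b j \<omega>\<bar>) \<le> expectation (\<lambda>\<omega>. (1 + (b j \<omega>)\<^sup>2) / 2)"
      by (rule integral_mono) (use i1 i2 le in auto)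
    also have "\<dots> = (1 + expectation (\<lambda>\<omega>. (b j \<omega>)\<^sup>2)) / 2"
      using i2 by (simp add: prob_space)
    finally show ?thesis using e2[of j] by simp
  qed
  have N: "local_norm n x h \<omega> = (\<Sum>j\<le>n. \<bar>b j \<omega>\<bar> * (1/2) ^ j)" for \<omega>
    unfolding coeff_norm_eq[OF degree_local_poly] b_def ..
  show "integrable M (local_norm n x h)" unfolding N using i1 by simp
  have "expectation (local_norm n x h) = (\<Sum>j\<le>n. expectation (\<lambda>\<omega>. \<bar>b j \<omega>\<bar>) * (1/2) ^ j)"
    unfolding N using i1 by (subst Bochner_Integration.integral_sum) auto
  also have "\<dots> \<le> (\<Sum>j\<le>n. 3/2 * (1/2) ^ j)" using e1 by (intro sum_mono mult_right_mono) auto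
  also have "\<dots> = 3/2 * (\<Sum>j\<le>n. (1/2) ^ j)" by (simp add: sum_distrib_left)
  also have "\<dots> \<le> 3" by (subst sum_gp0) simp
  finally show "expectation (local_norm n x h) \<le> 3" .
qed

lemma local_norm_markov:
  assumes "admissible n x h" "c > 0"
  shows "prob {\<omega> \<in> space M. c \<le> local_norm n x h \<omega>} \<le> 3 / c"
proof -
  have "prob {\<omega> \<in> space M. c \<le> local_norm n x h \<omega>} \<le> expectation (local_norm n x h) / c"
    using local_norm_expectation(1)[OF assms(1)] assms(2)
    by (intro integral_Markov_inequality_measure[where A="{}"]) (auto intro!: AE_I2 coeff_norm_nonneg)
  also have "\<dots> \<le> 3 / c" using local_norm_expectation(2)[OF assms(1)] assms(2) by (intro divide_right_mono) auto
  finally show ?thesis .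
qed

lemma small_ball_local:
  assumes "admissible n x h" "0 \<le> y" "x + h * y \<le> 1" "0 < b"
  shows "prob {\<omega> \<in> space M. \<bar>poly (local_rpoly n x h \<omega>) y\<bar> \<le> b}
    \<le> exp (1/2) * (4 + 1 / u\<^sub>0\<^sup>2) * (b + h powr (1/4))"
proof -
  note A = admissibleD[OF assms(1)]
  define z where "z = x + h * y"
  have hy: "0 \<le> h * y" using A assms by simp
  have z: "0 \<le> z" "z \<le> 1" "1 - h \<le> z" using A assms hy unfolding z_def by linarith+
  have "prob {\<omega> \<in> space M. \<bar>poly (local_rpoly n x h \<omega>) y\<bar> \<le> b}
    = prob {\<omega> \<in> space M. sqrt h * \<bar>\<Sum>i\<in>{..n}. z ^ i * \<xi> i \<omega>\<bar> \<le> b}"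
    using A by (simp add: poly_local_poly abs_mult z_def mult.commute[of "\<xi> _ _"])
  also have "\<dots> \<le> exp (1/2) * (4 + 1 / u\<^sub>0\<^sup>2) * (b + h powr (1/4))"
    by (rule small_ball_scale)
      (use A assms z sum_powers_lower_bound[of n h z] in \<open>auto simp: power_le_one\<close>)
  finally show ?thesis .
qed

lemma prob_root_event_le_small_ball:
  assumes "admissible n x h"
  shows "prob (root_event M \<xi> n x h r)
    \<le> 3 * (4/5) ^ r + exp (1/2) * (4 + 1 / u\<^sub>0\<^sup>2) * ((5/6) ^ r + h powr (1/4))"
proof -
  note A = admissibleD[OF assms]
  \<comment> \<open>The factor \<open>(2/3)^r\<close> is split as \<open>(5/6)^r (4/5)^r\<close>; the second part pays for the size of the norm.\<close>
  have "root_event M \<xi> n x h r \<subseteq> {\<omega> \<in> space M. (5/4) ^ r \<le> local_norm n x h \<omega>}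
      \<union> {\<omega> \<in> space M. \<bar>poly (local_rpoly n x h \<omega>) 0\<bar> \<le> (5/6) ^ r}"
  proof
    fix \<omega> assume \<omega>: "\<omega> \<in> root_event M \<xi> n x h r"
    have "\<bar>poly (local_rpoly n x h \<omega>) 0\<bar> \<le> (5/6) ^ r" if "local_norm n x h \<omega> \<le> (5/4) ^ r"
    proof -
      have "\<bar>coeff (local_rpoly n x h \<omega>) 0\<bar> \<le> (2/3) ^ r * local_norm n x h \<omega>"
        using \<omega> by (auto simp: root_event_def dest: spec[of _ 0])
      also have "\<dots> \<le> (2/3) ^ r * (5/4) ^ r" using that by (intro mult_left_mono) auto
      finally show ?thesis by (simp add: poly_0_coeff_0 flip: power_mult_distrib)
    qed
    then show "\<omega> \<in> {\<omega> \<in> space M. (5/4) ^ r \<le> local_norm n x h \<omega>}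
      \<union> {\<omega> \<in> space M. \<bar>poly (local_rpoly n x h \<omega>) 0\<bar> \<le> (5/6) ^ r}"
      using \<omega> by (cases "local_norm n x h \<omega> \<le> (5/4) ^ r") (auto simp: root_event_def)
  qed
  then have "prob (root_event M \<xi> n x h r) \<le> prob ({\<omega> \<in> space M. (5/4) ^ r \<le> local_norm n x h \<omega>}
      \<union> {\<omega> \<in> space M. \<bar>poly (local_rpoly n x h \<omega>) 0\<bar> \<le> (5/6) ^ r})"
    by (rule finite_measure_mono) measurable
  also have "\<dots> \<le> prob {\<omega> \<in> space M. (5/4) ^ r \<le> local_norm n x h \<omega>}
      + prob {\<omega> \<in> space M. \<bar>poly (local_rpoly n x h \<omega>) 0\<bar> \<le> (5/6) ^ r}"
    by (rule measure_Un_le) measurable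
  also have "\<dots> \<le> 3 / (5/4) ^ r + exp (1/2) * (4 + 1 / u\<^sub>0\<^sup>2) * ((5/6) ^ r + h powr (1/4))"
    by (intro add_mono local_norm_markov small_ball_local assms) (use A in auto)
  finally show ?thesis by (simp add: power_divide)
qed

text \<open>
  On the root event, if the norm is at most \<open>(5/4)^r\<close>, the \<open>j\<close>-th Taylor coefficient of the polynomial is at most
  \<open>(8 / h)^m (5/6)^r\<close> for \<open>j < m\<close>. It is \<open>\<xi> j\<close> plus a combination of coefficients of higher index.
\<close>
lemma prob_root_event_le_triangular:
  assumes "admissible n x h" "m \<le> n" "(8 / h) ^ m * (5/6) ^ r \<le> anti_radius u\<^sub>0"
  shows "prob (root_event M \<xi> n x h r) \<le> 3 * (4/5) ^ r + anti_prob u\<^sub>0 ^ m"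
proof -
  note A = admissibleD[OF assms(1)]
  define D where "D = {\<omega> \<in> space M. \<forall>j<m. \<bar>\<xi> j \<omega> + (\<Sum>i\<in>{j<..n}. (of_nat (i choose j) * x ^ (i - j)) * \<xi> i \<omega>)\<bar> \<le> anti_radius u\<^sub>0}"
  have [measurable]: "D \<in> events" unfolding D_def by measurable
  have "root_event M \<xi> n x h r \<subseteq> {\<omega> \<in> space M. (5/4) ^ r \<le> local_norm n x h \<omega>} \<union> D"
  proof
    fix \<omega> assume \<omega>: "\<omega> \<in> root_event M \<xi> n x h r"
    have "\<omega> \<in> D" if N: "local_norm n x h \<omega> \<le> (5/4) ^ r"
    proof -
      have "\<bar>\<xi> j \<omega> + (\<Sum>i\<in>{j<..n}. (of_nat (i choose j) * x ^ (i - j)) * \<xi> i \<omega>)\<bar> \<le> anti_radius u\<^sub>0"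
        if j: "j < m" for j
      proof -
        define c where "c = (\<Sum>i\<le>n. of_nat (i choose j) * x ^ (i - j) * \<xi> i \<omega>)"
        have split: "{..n} = {..<j} \<union> ({j} \<union> {j<..n})" using j assms(2) by auto
        have "c = (\<Sum>i<j. of_nat (i choose j) * x ^ (i - j) * \<xi> i \<omega>)
            + (\<xi> j \<omega> + (\<Sum>i\<in>{j<..n}. of_nat (i choose j) * x ^ (i - j) * \<xi> i \<omega>))"
          unfolding c_def split by (subst sum.union_disjoint; (subst sum.union_disjoint)?) auto
        also have "(\<Sum>i<j. of_nat (i choose j) * x ^ (i - j) * \<xi> i \<omega>) = 0"
          by (rule sum.neutral) (auto simp: binomial_eq_0)
        finally have c: "c = \<xi> j \<omega> + (\<Sum>i\<in>{j<..n}. of_nat (i choose j) * x ^ (i - j) * \<xi> i \<omega>)" by simp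
        have sq: "h \<le> sqrt h" using A by (smt (verit) real_sqrt_ge_one real_sqrt_le_1_iff real_sqrt_pow2 mult_left_le power2_eq_square real_sqrt_ge_zero)
        have "h ^ m * \<bar>c\<bar> \<le> sqrt h * h ^ j * \<bar>c\<bar>"
        proof (rule mult_right_mono)
          have "h ^ m \<le> h ^ Suc j" using A j by (intro power_decreasing) auto
          also have "\<dots> \<le> sqrt h * h ^ j" using sq A by (simp add: mult_right_mono)
          finally show "h ^ m \<le> sqrt h * h ^ j" .
        qed simp
        also have "\<dots> = \<bar>coeff (local_rpoly n x h \<omega>) j\<bar>"
          using A by (simp add: coeff_local_poly c_def abs_mult)
        also have "\<dots> \<le> 8 ^ j * (2/3) ^ r * local_norm n x h \<omega>"
          using \<omega> j assms(2) by (simp add: root_event_def)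
        also have "\<dots> \<le> 8 ^ m * (2/3) ^ r * (5/4) ^ r"
          using j N by (intro mult_mono[OF mult_right_mono[OF power_increasing]]) (auto intro: coeff_norm_nonneg)
        also have "\<dots> = 8 ^ m * (5/6) ^ r" by (simp flip: power_mult_distrib)
        finally have "\<bar>c\<bar> \<le> (8 / h) ^ m * (5/6) ^ r"
          using A by (simp add: field_simps power_divide)
        with assms(3) show ?thesis by (simp add: c)
      qed
      then show ?thesis using \<omega> by (simp add: D_def root_event_def)
    qed
    then show "\<omega> \<in> {\<omega> \<in> space M. (5/4) ^ r \<le> local_norm n x h \<omega>} \<union> D"
      using \<omega> by (force simp: root_event_def)
  qed
  then have "prob (root_event M \<xi> n x h r) \<le> prob ({\<omega> \<in> space M. (5/4) ^ r \<le> local_norm n x h \<omega>} \<union> D)"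
    by (rule finite_measure_mono) measurable
  also have "\<dots> \<le> prob {\<omega> \<in> space M. (5/4) ^ r \<le> local_norm n x h \<omega>} + prob D"
    by (rule measure_Un_le) measurable
  also have "\<dots> \<le> 3 / (5/4) ^ r + anti_prob u\<^sub>0 ^ m"
    unfolding D_def by (intro add_mono local_norm_markov prob_triangular_small_le assms) auto
  finally show ?thesis by (simp add: power_divide)
qed

end

lemma bounded_of_tendsto_zero:
  fixes f :: "nat \<Rightarrow> real"
  assumes "f \<longlonglongrightarrow> 0"
  shows "\<exists>K>0. \<forall>r. f r \<le> K"
proof -
  have "Bseq f" using assms by (intro convergent_imp_Bseq) (auto simp: convergent_def)
  then obtain K where "K > 0" "\<And>r. norm (f r) \<le> K" by (auto simp: Bseq_def)
  then show ?thesis by (intro exI[of _ K]) (auto intro: order_trans[OF abs_ge_self])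
qed

text \<open>
  If \<open>h \<le> exp (- sqrt r)\<close>, the term \<open>h powr (1/4)\<close> in the small-ball bound is negligible. Otherwise, for large \<open>r\<close>, \<open>8 / h\<close> is so
  small compared with \<open>(6/5)^r\<close> that the triangular bound applies with \<open>m\<close> about \<open>sqrt r / 20\<close>. Either way the
  probability decays faster than any power of \<open>r\<close>.
\<close>
lemma root_event_tail:
  assumes u0: "u\<^sub>0 > 0"
  shows "\<exists>C>0. \<forall>(M :: 'a measure) \<xi> n x h r. random_coeffs M \<xi> u\<^sub>0 \<longrightarrow> admissible n x h \<longrightarrow> 1 \<le> r \<longrightarrow> r \<le> n \<longrightarrow>
    measure M (root_event M \<xi> n x h r) \<le> C / (real r)\<^sup>2"
proof -
  define K1 where "K1 = exp (1/2) * (4 + 1 / u\<^sub>0\<^sup>2)"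
  define \<delta> where "\<delta> = anti_radius u\<^sub>0"
  define p where "p = anti_prob u\<^sub>0"
  have K1: "K1 > 0" unfolding K1_def by (intro mult_pos_pos add_pos_nonneg) auto
  define f1 where "f1 = (\<lambda>r::nat. (real r)\<^sup>2 * (3 * (4/5) ^ r + K1 * ((5/6) ^ r + exp (- sqrt (real r) / 4))))"
  have "(\<lambda>r. (real r)\<^sup>2 * (4/5) ^ r) \<longlonglongrightarrow> 0" "(\<lambda>r. (real r)\<^sup>2 * (5/6) ^ r) \<longlonglongrightarrow> 0"
    "(\<lambda>r. (real r)\<^sup>2 * exp (- sqrt (real r) / 4)) \<longlonglongrightarrow> 0"
    by real_asymp+
  then have "(\<lambda>r. 3 * ((real r)\<^sup>2 * (4/5) ^ r) + K1 * ((real r)\<^sup>2 * (5/6) ^ r + (real r)\<^sup>2 * exp (- sqrt (real r) / 4)))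
      \<longlonglongrightarrow> 3 * 0 + K1 * (0 + 0)"
    by (intro tendsto_intros)
  then have "f1 \<longlonglongrightarrow> 0" by (simp add: f1_def algebra_simps)
  then obtain B1 where B1: "B1 > 0" "\<And>r. f1 r \<le> B1" using bounded_of_tendsto_zero by blast
  define f2 where "f2 = (\<lambda>q r::nat. (real r)\<^sup>2 * (3 * (4/5) ^ r + q powr (sqrt (real r) / 20 - 1)))"
  have f2: "f2 q \<longlonglongrightarrow> 0" if "0 < q" "q < 1" for q
    unfolding f2_def using that by real_asymp
  have \<delta>: "\<delta> > 0" and p: "0 < p" "p < 1"
    using anti_radius_pos[OF u0] anti_prob_bounds[OF u0] by (auto simp: \<delta>_def p_def)
  obtain B2 where B2: "B2 > 0" "\<And>r. f2 p r \<le> B2"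
    using bounded_of_tendsto_zero[OF f2[OF p]] by blast
  have "(\<lambda>r. exp (sqrt (real r) / 20 * (3 + sqrt (real r)) - real r / 6)) \<longlonglongrightarrow> 0"
    by real_asymp
  then have "eventually (\<lambda>r. exp (sqrt (real r) / 20 * (3 + sqrt (real r)) - real r / 6) < \<delta>) sequentially"
    using \<delta> by (rule order_tendstoD)
  then obtain r0 where r0: "\<And>r. r \<ge> r0 \<Longrightarrow> exp (sqrt (real r) / 20 * (3 + sqrt (real r)) - real r / 6) < \<delta>"
    by (auto simp: eventually_sequentially)
  define C where "C = B1 + B2 + (real r0)\<^sup>2"
  have C: "C > 0" "B1 \<le> C" "B2 \<le> C" "(real r0)\<^sup>2 \<le> C"
    using B1 B2 by (auto simp: C_def intro!: add_pos_nonneg)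
  show ?thesis
  proof (intro exI[of _ C] conjI C(1) allI impI)
    fix M :: "'a measure" and \<xi> n x h and r :: nat
    assume "random_coeffs M \<xi> u\<^sub>0" and adm: "admissible n x h" and r: "1 \<le> r" "r \<le> n"
    then interpret random_coeffs M \<xi> u\<^sub>0 by simp
    note A = admissibleD[OF adm]
    have rpos: "(real r)\<^sup>2 > 0" using r by simp
    define Q where "Q = prob (root_event M \<xi> n x h r)"
    have "(real r)\<^sup>2 * Q \<le> C"
    proof (cases "r < r0")
      case True
      have "(real r)\<^sup>2 * Q \<le> (real r0)\<^sup>2 * 1"
        using True by (intro mult_mono power_mono) (auto simp: Q_def)
      then show ?thesis using C by simp
    next
      case False
      show ?thesis
      proof (cases "h \<le> exp (- sqrt (real r))")
        case True
        have "h powr (1/4) \<le> exp (- sqrt (real r)) powr (1/4)"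
          using True A by (intro powr_mono2) auto
        also have "\<dots> = exp (- sqrt (real r) / 4)" by (simp add: powr_def)
        finally have "Q \<le> 3 * (4/5) ^ r + K1 * ((5/6) ^ r + exp (- sqrt (real r) / 4))"
          using prob_root_event_le_small_ball[OF adm, of r] K1
            mult_left_mono[of "(5/6) ^ r + h powr (1/4)" "(5/6) ^ r + exp (- sqrt (real r) / 4)" K1]
          unfolding Q_def K1_def[symmetric] by linarith
        then have "(real r)\<^sup>2 * Q \<le> f1 r" unfolding f1_def by (intro mult_left_mono) auto
        then show ?thesis using B1(2)[of r] C by linarith
      next
        case h: False
        define m where "m = nat \<lfloor>sqrt (real r) / 20\<rfloor>"
        have m: "real m \<le> sqrt (real r) / 20" "sqrt (real r) / 20 - 1 \<le> real m"
          by (auto simp: m_def) linarith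
        have "sqrt (real r) / 20 \<le> real r"
        proof -
          have "sqrt (real r) * 1 \<le> sqrt (real r) * sqrt (real r)"
            using r by (intro mult_left_mono) auto
          then show ?thesis by simp
        qed
        then have mn: "m \<le> n" using m(1) r(2) by linarith
        have "8 / h \<le> exp 3 / exp (- sqrt (real r))"
        proof (rule frac_le)
          have "(2::real) \<le> exp 1" using exp_ge_add_one_self[of 1] by simp
          then have "(2::real) ^ 3 \<le> exp 1 ^ 3" by (intro power_mono) auto
          then show "(8::real) \<le> exp 3" by (simp flip: exp_of_nat_mult)
        qed (use h in auto)
        then have "(8 / h) ^ m \<le> exp (3 + sqrt (real r)) ^ m"
          using A by (intro power_mono) (auto simp: exp_add exp_minus field_simps)
        also have "\<dots> = exp (real m * (3 + sqrt (real r)))" by (simp flip: exp_of_nat_mult)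
        also have "\<dots> \<le> exp (sqrt (real r) / 20 * (3 + sqrt (real r)))"
          using m by (auto intro!: mult_right_mono)
        finally have 1: "(8 / h) ^ m \<le> exp (sqrt (real r) / 20 * (3 + sqrt (real r)))" .
        have "5/6 \<le> exp (- (1/6) :: real)" using exp_ge_add_one_self[of "- (1/6) :: real"] by simp
        then have "(5/6) ^ r \<le> exp (- (1/6) :: real) ^ r" by (intro power_mono) auto
        also have "\<dots> = exp (- (real r / 6))" by (simp flip: exp_of_nat_mult)
        finally have "(8 / h) ^ m * (5/6) ^ r \<le> exp (sqrt (real r) / 20 * (3 + sqrt (real r))) * exp (- (real r / 6))"
          using 1 A by (intro mult_mono) auto
        also have "\<dots> = exp (sqrt (real r) / 20 * (3 + sqrt (real r)) - real r / 6)"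
          by (simp only: exp_add[symmetric] diff_conv_add_uminus)
        also have "\<dots> \<le> \<delta>" using r0[of r] False by simp
        finally have "Q \<le> 3 * (4/5) ^ r + p ^ m"
          unfolding Q_def p_def by (intro prob_root_event_le_triangular adm mn) (simp add: \<delta>_def)
        also have "p ^ m = p powr real m" using p by (simp add: powr_realpow)
        also have "\<dots> \<le> p powr (sqrt (real r) / 20 - 1)" using m p by (intro powr_mono') auto
        finally have "(real r)\<^sup>2 * Q \<le> f2 p r" unfolding f2_def by (intro mult_left_mono) auto
        then show ?thesis using B2(2)[of r] C by linarith
      qed
    qed
    then show "prob (root_event M \<xi> n x h r) \<le> C / (real r)\<^sup>2"
      using rpos by (simp add: Q_def field_simps)
  qed
qed

section \<open>Windows and blocks of coefficients\<close>

text \<open>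
  The ratio \<open>7/8\<close> makes the \<open>k\<close>-th window exactly the part \<open>0 \<le> y \<le> 1/8\<close> of the local expansion at its left end
  with \<open>h = (7/8)^k\<close>. The index \<open>l\<close> runs from 0 to \<open>L\<close>.
\<close>
definition grid_pt :: "nat \<Rightarrow> nat \<Rightarrow> nat \<Rightarrow> real" where
  "grid_pt L k l = 1 - (7/8) ^ k + (7/8) ^ k * (real l / (8 * real L))"

text \<open>
  The number of the block to which the index \<open>i\<close> belongs: \<open>(8/7)^b \<le> i + 1 < (8/7)^(b + 1)\<close>. Block \<open>b\<close> is the one that
  dominates in window \<open>b\<close>.
\<close>
definition index_scale :: "nat \<Rightarrow> nat" where
  "index_scale i = (LEAST b. (7/8 :: real) ^ Suc b < 1 / (real i + 1))"

lemma index_scale_bounds: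
  "(7/8 :: real) ^ Suc (index_scale i) < 1 / (real i + 1)" "1 / (real i + 1) \<le> (7/8 :: real) ^ index_scale i"
proof -
  obtain b where "(7/8 :: real) ^ b < 1 / (real i + 1)"
    using real_arch_pow_inv[of "1 / (real i + 1)" "7/8"] by auto
  moreover have "(7/8 :: real) ^ Suc b \<le> (7/8) ^ b" by (rule power_decreasing) auto
  ultimately have "(7/8 :: real) ^ Suc b < 1 / (real i + 1)" by linarith
  then show "(7/8 :: real) ^ Suc (index_scale i) < 1 / (real i + 1)"
    unfolding index_scale_def by (rule LeastI)
  show "1 / (real i + 1) \<le> (7/8 :: real) ^ index_scale i"
  proof (cases "index_scale i")
    case 0
    then show ?thesis by (simp add: field_simps)
  next
    case (Suc b)
    then have "b < (LEAST b. (7/8 :: real) ^ Suc b < 1 / (real i + 1))" by (simp add: index_scale_def)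
    then have "\<not> (7/8 :: real) ^ Suc b < 1 / (real i + 1)" by (rule not_less_Least)
    then show ?thesis by (simp add: Suc)
  qed
qed

lemma index_scale_mono:
  assumes "i \<le> j"
  shows "index_scale i \<le> index_scale j"
proof (rule ccontr)
  assume "\<not> ?thesis"
  then have "Suc (index_scale j) \<le> index_scale i" by simp
  then have "(7/8 :: real) ^ index_scale i \<le> (7/8) ^ Suc (index_scale j)"
    by (intro power_decreasing) auto
  moreover have "1 / (real j + 1) \<le> 1 / (real i + 1)" using assms by (intro frac_le) auto
  ultimately show False using index_scale_bounds[of i] index_scale_bounds[of j] by linarith
qed

lemma index_scale_le_log:
  assumes "n \<ge> 2"
  shows "real (index_scale n) + 1 \<le> 18 * ln (real n)"
proof -
  have ln2: "ln (real n) \<ge> 1/2"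
  proof -
    have "ln (real n) \<ge> ln 2" using assms by (subst ln_le_cancel_iff) auto
    moreover have "ln (2::real) \<ge> 1/2" using ln_le_minus_one[of "1/2"] by (simp add: ln_div)
    ultimately show ?thesis by simp
  qed
  have "real (index_scale n) * (1/8) \<le> real (index_scale n) * ln (8/7)"
    using ln_le_minus_one[of "7/8"] by (intro mult_left_mono) (auto simp: ln_div)
  also have "\<dots> = ln ((8/7) ^ index_scale n)" by (simp add: ln_realpow)
  also have "\<dots> \<le> ln (real n + 1)"
  proof (subst ln_le_cancel_iff)
    have "real n + 1 > 0" by simp
    then have "1 \<le> (7/8) ^ index_scale n * (real n + 1)"
      using index_scale_bounds(2)[of n] by (simp add: field_simps)
    then have "(8/7) ^ index_scale n * 1 \<le> (8/7) ^ index_scale n * ((7/8) ^ index_scale n * (real n + 1))"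
      by (intro mult_left_mono) auto
    also have "\<dots> = real n + 1" by (simp flip: power_mult_distrib mult.assoc)
    finally show "(8/7) ^ index_scale n \<le> real n + 1" by simp
  qed auto
  also have "\<dots> \<le> ln (real n * real n)"
  proof (subst ln_le_cancel_iff)
    have "real n * 2 \<le> real n * real n" using assms by (intro mult_left_mono) auto
    then show "real n + 1 \<le> real n * real n" using assms by linarith
  qed (use assms in auto)
  also have "\<dots> = 2 * ln (real n)" using assms by (simp add: ln_mult)
  finally show ?thesis using ln2 by simp
qed

definition gap :: "nat \<Rightarrow> nat \<Rightarrow> nat" where
  "gap k b = (k - b) + (b - k)"

lemma grid_pt_bounds:
  assumes "L > 0" "l \<le> L"
  shows "1 - (7/8) ^ k \<le> grid_pt L k l" "grid_pt L k l \<le> 1 - (7/8) ^ Suc k" "0 \<le> grid_pt L k l" "grid_pt L k l \<le> 1"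
proof -
  have f: "0 \<le> real l / (8 * real L)" "real l / (8 * real L) \<le> 1/8" using assms by (auto simp: field_simps)
  have p: "0 < (7/8 :: real) ^ k" "(7/8 :: real) ^ k \<le> 1" by (auto simp: power_le_one)
  show 1: "1 - (7/8) ^ k \<le> grid_pt L k l" unfolding grid_pt_def using f p by simp
  have "(7/8) ^ k * (real l / (8 * real L)) \<le> (7/8) ^ k * (1/8)" using f p by (intro mult_left_mono) auto
  then show 2: "grid_pt L k l \<le> 1 - (7/8) ^ Suc k" unfolding grid_pt_def by simp
  show "0 \<le> grid_pt L k l" "grid_pt L k l \<le> 1" using 1 2 p by auto
qed

lemma grid_pt_strict_mono:
  assumes "L > 0" "l < l'"
  shows "grid_pt L k l < grid_pt L k l'"
  unfolding grid_pt_def using assms by (simp add: field_simps)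

lemma card_index_scale_le:
  "real (card {i. i \<le> n \<and> index_scale i = b}) \<le> (8/7) ^ Suc b"
proof -
  have "{i. i \<le> n \<and> index_scale i = b} \<subseteq> {..<nat \<lfloor>(8/7 :: real) ^ Suc b\<rfloor>}"
  proof
    fix i assume "i \<in> {i. i \<le> n \<and> index_scale i = b}"
    then have "(7/8 :: real) ^ Suc b * (real i + 1) < 1"
      using index_scale_bounds(1)[of i] by (simp add: field_simps)
    then have "(8/7 :: real) ^ Suc b * ((7/8) ^ Suc b * (real i + 1)) < (8/7) ^ Suc b * 1"
      by (intro mult_strict_left_mono) auto
    also have "(8/7 :: real) ^ Suc b * ((7/8) ^ Suc b * (real i + 1)) = real i + 1"
      by (simp only: mult.assoc[symmetric] power_mult_distrib[symmetric]) simp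
    finally have "real i + 1 < (8/7) ^ Suc b" by simp
    then have "int i + 1 \<le> \<lfloor>(8/7 :: real) ^ Suc b\<rfloor>" by (simp add: le_floor_iff)
    then show "i \<in> {..<nat \<lfloor>(8/7 :: real) ^ Suc b\<rfloor>}" by simp
  qed
  then have "card {i. i \<le> n \<and> index_scale i = b} \<le> nat \<lfloor>(8/7 :: real) ^ Suc b\<rfloor>"
    using card_mono[of "{..<nat \<lfloor>(8/7 :: real) ^ Suc b\<rfloor>}"] by fastforce
  then show "real (card {i. i \<le> n \<and> index_scale i = b}) \<le> (8/7) ^ Suc b"
    by (smt (verit) of_nat_floor of_nat_mono zero_le_power divide_nonneg_nonneg)
qed

text \<open>
  Bernoulli's inequality and \<open>(1 - h)^i (1 + h)^i \<le> 1\<close>.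
\<close>
lemma power_one_minus_le:
  assumes "0 \<le> z" "z \<le> 1 - h" "0 \<le> h" "h \<le> (1::real)"
  shows "z ^ i * ((real i + 1) * h) \<le> 1"
proof -
  have "z ^ i * ((real i + 1) * h) \<le> (1 - h) ^ i * (1 + real i * h)"
    using assms by (intro mult_mono power_mono) (auto simp: algebra_simps)
  also have "\<dots> \<le> (1 - h) ^ i * (1 + h) ^ i"
    using assms Bernoulli_inequality[of h i] by (intro mult_left_mono) auto
  also have "\<dots> = (1 - h * h) ^ i" by (simp add: algebra_simps flip: power_mult_distrib)
  also have "\<dots> \<le> 1" using assms by (intro power_le_one) (auto simp: mult_le_one)
  finally show ?thesis .
qed

text \<open>
  Blocks before the \<open>k\<close>-th have few terms compared with \<open>(8/7)^k\<close>; in later blocks the powers of the grid point are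
  damped. Both effects are geometric in the distance of the scales.
\<close>
lemma block_weight_le:
  assumes "L > 0" "l \<le> L"
  shows "(7/8) ^ k * (\<Sum>i | i \<le> n \<and> index_scale i = b. (grid_pt L k l ^ i)\<^sup>2) \<le> 2 * (7/8) ^ gap k b"
proof -
  define S where "S = {i. i \<le> n \<and> index_scale i = b}"
  define z where "z = grid_pt L k l"
  note z = grid_pt_bounds[OF assms, of k, folded z_def]
  have inv: "(8/7 :: real) ^ m = 1 / (7/8) ^ m" for m by (simp add: power_divide)
  show ?thesis
  proof (cases "b \<le> k")
    case True
    have "(\<Sum>i\<in>S. (z ^ i)\<^sup>2) \<le> (\<Sum>i\<in>S. 1)"
      using z by (intro sum_mono power_le_one) auto
    also have "\<dots> \<le> (8/7) ^ Suc b" using card_index_scale_le[of n b] by (simp add: S_def)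
    finally have "(7/8) ^ k * (\<Sum>i\<in>S. (z ^ i)\<^sup>2) \<le> (7/8) ^ k * (8/7) ^ Suc b"
      by (intro mult_left_mono) auto
    also have "(7/8) ^ k * (8/7) ^ Suc b = (8/7) * (7/8 :: real) ^ (k - b)"
    proof -
      have "(7/8 :: real) ^ k = (7/8) ^ b * (7/8) ^ (k - b)" using True by (simp flip: power_add)
      then show ?thesis by (simp add: inv)
    qed
    also have "\<dots> \<le> 2 * (7/8) ^ gap k b" using True by (simp add: gap_def)
    finally show ?thesis by (simp add: S_def z_def)
  next
    case False
    define d where "d = b - k"
    have b: "b = k + d" using False by (simp add: d_def)
    have tb: "(z ^ i)\<^sup>2 \<le> ((8/7) * (7/8) ^ d)\<^sup>2" if "i \<in> S" for i
    proof (rule power_mono)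
      have "1 / (real i + 1) \<le> (7/8) ^ b"
        using index_scale_bounds(2)[of i] that by (simp add: S_def)
      then have "1 \<le> (7/8) ^ b * (real i + 1)" by (simp add: field_simps)
      then have "z ^ i * (7/8) ^ Suc k * 1 \<le> z ^ i * (7/8) ^ Suc k * ((7/8) ^ b * (real i + 1))"
        using z by (intro mult_left_mono) auto
      also have "\<dots> = (z ^ i * ((real i + 1) * (7/8) ^ Suc k)) * (7/8) ^ b" by (simp add: mult_ac)
      also have "\<dots> \<le> 1 * (7/8) ^ b"
        using z by (intro mult_right_mono power_one_minus_le) (auto simp del: power_Suc simp: power_le_one)
      finally have "z ^ i * (7/8) * (7/8) ^ k \<le> (7/8) ^ d * (7/8) ^ k" by (simp add: b power_add mult_ac)
      then show "z ^ i \<le> 8/7 * (7/8) ^ d" by simp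
    qed (use z in auto)
    have "(\<Sum>i\<in>S. (z ^ i)\<^sup>2) \<le> real (card S) * ((8/7) * (7/8) ^ d)\<^sup>2"
      using sum_bounded_above[of S "\<lambda>i. (z ^ i)\<^sup>2", OF tb] by simp
    also have "\<dots> \<le> (8/7) ^ Suc b * ((8/7) * (7/8) ^ d)\<^sup>2"
      using card_index_scale_le[of n b] by (intro mult_right_mono) (auto simp: S_def)
    finally have "(7/8) ^ k * (\<Sum>i\<in>S. (z ^ i)\<^sup>2) \<le> (7/8) ^ k * ((8/7) ^ Suc b * ((8/7) * (7/8) ^ d)\<^sup>2)"
      by (intro mult_left_mono) auto
    also have "\<dots> = (8/7) ^ 3 * (7/8) ^ d"
      by (simp add: inv b power_add power2_eq_square field_simps power3_eq_cube)
    also have "\<dots> \<le> 2 * (7/8) ^ gap k b" using False by (simp add: gap_def d_def power3_eq_cube)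
    finally show ?thesis by (simp add: S_def z_def)
  qed
qed

text \<open>
  The tolerance for the contribution of a block decreases at this rate with the distance. By \<open>decay^4 = 7/8\<close>
  Chebyshev's inequality then still leaves a factor \<open>decay^2\<close> per step.
\<close>
definition decay :: real where "decay = (7/8) powr (1/4)"

lemma decay: "0 < decay" "decay < 1" "decay ^ 4 = 7/8"
proof -
  show "0 < decay" by (simp add: decay_def)
  have "decay ^ 4 = decay powr 4" using \<open>0 < decay\<close> by (simp add: powr_numeral)
  also have "\<dots> = 7/8" by (simp add: decay_def powr_powr)
  finally show d4: "decay ^ 4 = 7/8" .
  show "decay < 1"
  proof (rule ccontr)
    assume "\<not> decay < 1"
    then have "1 \<le> decay ^ 4" by (intro one_le_power) simp
    with d4 show False by simp
  qed
qed

lemma sum_decay_gap_le: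
  assumes "finite S" "0 < s" "s < (1::real)"
  shows "(\<Sum>b\<in>{b \<in> S. A \<le> gap k b}. s ^ gap k b) \<le> 2 * s ^ A / (1 - s)"
proof -
  have geo: "(\<Sum>d\<in>D. s ^ d) \<le> s ^ A / (1 - s)" if D: "finite D" "\<And>d. d \<in> D \<Longrightarrow> A \<le> d" for D
  proof -
    obtain m where m: "D \<subseteq> {..m}" using \<open>finite D\<close> by (meson finite_nat_iff_bounded_le)
    have "s ^ d = s ^ A * s ^ (d - A)" if "d \<in> D" for d
      using D(2)[OF that] power_add[of s A "d - A"] by simp
    then have "(\<Sum>d\<in>D. s ^ d) = s ^ A * (\<Sum>d\<in>D. s ^ (d - A))"
      by (simp add: sum_distrib_left cong: sum.cong)
    also have "(\<Sum>d\<in>D. s ^ (d - A)) = (\<Sum>d\<in>(\<lambda>d. d - A) ` D. s ^ d)"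
      by (subst sum.reindex) (auto simp: inj_on_def dest!: D(2))
    also have "\<dots> \<le> (\<Sum>d\<le>m. s ^ d)" using m assms by (intro sum_mono2) auto
    also have "\<dots> \<le> 1 / (1 - s)" using assms by (subst sum_gp0) (auto simp: divide_right_mono)
    finally show ?thesis using assms by simp
  qed
  define T where "T = {b \<in> S. A \<le> gap k b}"
  have fin: "finite T" using assms by (simp add: T_def)
  have "T = {b \<in> T. b \<le> k} \<union> {b \<in> T. k < b}" by auto
  then have "(\<Sum>b\<in>T. s ^ gap k b) = (\<Sum>b\<in>{b \<in> T. b \<le> k} \<union> {b \<in> T. k < b}. s ^ gap k b)" by simp
  also have "\<dots> = (\<Sum>b\<in>{b \<in> T. b \<le> k}. s ^ gap k b) + (\<Sum>b\<in>{b \<in> T. k < b}. s ^ gap k b)"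
    using fin by (intro sum.union_disjoint) auto
  also have "(\<Sum>b\<in>{b \<in> T. b \<le> k}. s ^ gap k b) = (\<Sum>d\<in>gap k ` {b \<in> T. b \<le> k}. s ^ d)"
    by (subst sum.reindex) (auto simp: inj_on_def gap_def)
  also have "\<dots> \<le> s ^ A / (1 - s)" using assms(1) by (intro geo) (auto simp: T_def)
  also have "(\<Sum>b\<in>{b \<in> T. k < b}. s ^ gap k b) = (\<Sum>d\<in>gap k ` {b \<in> T. k < b}. s ^ d)"
    by (subst sum.reindex) (auto simp: inj_on_def gap_def)
  also have "\<dots> \<le> s ^ A / (1 - s)" using assms(1) by (intro geo) (auto simp: T_def)
  finally show ?thesis by (simp add: T_def)
qed

definition block_part :: "(nat \<Rightarrow> real) \<Rightarrow> nat \<Rightarrow> nat \<Rightarrow> nat \<Rightarrow> nat \<Rightarrow> nat \<Rightarrow> real" where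
  "block_part a n L k l b = sqrt ((7/8) ^ k) * (\<Sum>i | i \<le> n \<and> index_scale i = b. grid_pt L k l ^ i * a i)"

definition near_part :: "(nat \<Rightarrow> real) \<Rightarrow> nat \<Rightarrow> nat \<Rightarrow> nat \<Rightarrow> nat \<Rightarrow> nat \<Rightarrow> real" where
  "near_part a n L A k l = sqrt ((7/8) ^ k) * (\<Sum>i | i \<le> n \<and> gap k (index_scale i) < A. grid_pt L k l ^ i * a i)"

definition far_large :: "(nat \<Rightarrow> real) \<Rightarrow> nat \<Rightarrow> nat \<Rightarrow> real \<Rightarrow> nat \<Rightarrow> nat \<Rightarrow> bool" where
  "far_large a n L w k b \<longleftrightarrow> (\<exists>l\<le>L. w * decay ^ gap k b < \<bar>block_part a n L k l b\<bar>)"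

text \<open>
  Because both values are required to be at least \<open>\<delta>\<close> in modulus, a perturbation by less than \<open>\<delta>\<close> cannot undo a
  counted sign change.
\<close>
definition near_changes :: "(nat \<Rightarrow> real) \<Rightarrow> nat \<Rightarrow> nat \<Rightarrow> nat \<Rightarrow> real \<Rightarrow> nat \<Rightarrow> real" where
  "near_changes a n L A \<delta> k = (\<Sum>l<L. if \<delta> \<le> \<bar>near_part a n L A k l\<bar> \<and> \<delta> \<le> \<bar>near_part a n L A k (Suc l)\<bar>
     \<and> near_part a n L A k l * near_part a n L A k (Suc l) < 0 then 1 else 0)"

text \<open>
  The number of windows in \<open>W\<close> that are disturbed by the distant block \<open>b\<close>.
\<close>
definition far_count :: "(nat \<Rightarrow> real) \<Rightarrow> nat \<Rightarrow> nat \<Rightarrow> nat \<Rightarrow> real \<Rightarrow> nat set \<Rightarrow> nat \<Rightarrow> real" where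
  "far_count a n L A w W b = (\<Sum>k\<in>{k \<in> W. A \<le> gap k b}. if far_large a n L w k b then 1 else 0)"

abbreviation window_poly :: "(nat \<Rightarrow> real) \<Rightarrow> nat \<Rightarrow> nat \<Rightarrow> real poly" where
  "window_poly a n k \<equiv> local_poly a n (1 - (7/8) ^ k) ((7/8) ^ k)"

lemma window_poly_eq:
  "poly (window_poly a n k) (real l / (8 * real L))
    = near_part a n L A k l + (\<Sum>b\<in>{b. b \<le> index_scale n \<and> A \<le> gap k b}. block_part a n L k l b)"
proof -
  define t where "t = (\<lambda>i. grid_pt L k l ^ i * a i)"
  have "poly (window_poly a n k) (real l / (8 * real L)) = sqrt ((7/8) ^ k) * (\<Sum>i\<le>n. t i)"
    by (simp add: poly_local_poly t_def grid_pt_def mult.commute)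
  also have "{..n} = {i. i \<le> n \<and> gap k (index_scale i) < A} \<union> {i. i \<le> n \<and> A \<le> gap k (index_scale i)}" by auto
  also have "(\<Sum>i\<in>\<dots>. t i) = (\<Sum>i | i \<le> n \<and> gap k (index_scale i) < A. t i) + (\<Sum>i | i \<le> n \<and> A \<le> gap k (index_scale i). t i)"
    by (rule sum.union_disjoint) auto
  also have "(\<Sum>i | i \<le> n \<and> A \<le> gap k (index_scale i). t i)
      = (\<Sum>b\<in>{b. b \<le> index_scale n \<and> A \<le> gap k b}. \<Sum>i\<in>{i \<in> {i. i \<le> n \<and> A \<le> gap k (index_scale i)}. index_scale i = b}. t i)"
    by (rule sum.group[symmetric]) (auto simp: index_scale_mono)
  also have "\<dots> = (\<Sum>b\<in>{b. b \<le> index_scale n \<and> A \<le> gap k b}. \<Sum>i | i \<le> n \<and> index_scale i = b. t i)"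
    by (intro sum.cong refl) auto
  finally show ?thesis
    by (simp add: near_part_def block_part_def t_def algebra_simps sum_distrib_left)
qed

lemma near_part_close:
  assumes "0 < w" "l \<le> L" "\<And>b. b \<le> index_scale n \<Longrightarrow> A \<le> gap k b \<Longrightarrow> \<not> far_large a n L w k b"
  shows "\<bar>poly (window_poly a n k) (real l / (8 * real L)) - near_part a n L A k l\<bar> \<le> 2 * w / (1 - decay)"
proof -
  define T where "T = {b. b \<le> index_scale n \<and> A \<le> gap k b}"
  have "\<bar>poly (window_poly a n k) (real l / (8 * real L)) - near_part a n L A k l\<bar> \<le> (\<Sum>b\<in>T. \<bar>block_part a n L k l b\<bar>)"
    unfolding window_poly_eq[of _ _ _ _ _ A] T_def by (simp add: sum_abs)
  also have "\<dots> \<le> (\<Sum>b\<in>T. w * decay ^ gap k b)"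
    using assms by (intro sum_mono) (force simp: T_def far_large_def not_less)
  also have "\<dots> = w * (\<Sum>b\<in>{b \<in> {..index_scale n}. A \<le> gap k b}. decay ^ gap k b)"
    by (simp add: sum_distrib_left T_def)
  also have "\<dots> \<le> w * (2 * decay ^ A / (1 - decay))"
    using assms decay by (intro mult_left_mono sum_decay_gap_le) auto
  also have "\<dots> \<le> w * (2 * 1 / (1 - decay))"
    using assms decay by (intro mult_left_mono divide_right_mono power_le_one) (auto simp: power_le_one)
  finally show ?thesis by (simp add: mult.commute)
qed

section \<open>Concentration of truncated sign changes\<close>

lemma block_part_measurable:
  assumes "\<And>i. i \<le> n \<Longrightarrow> index_scale i = b \<Longrightarrow> (\<lambda>v. a v i) \<in> borel_measurable N"
  shows "(\<lambda>v. block_part (a v) n L k l b) \<in> borel_measurable N"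
  unfolding block_part_def
  by (intro borel_measurable_times borel_measurable_sum borel_measurable_const assms) auto

lemma near_part_measurable:
  assumes "\<And>i. i \<le> n \<Longrightarrow> gap k (index_scale i) < A \<Longrightarrow> (\<lambda>v. a v i) \<in> borel_measurable N"
  shows "(\<lambda>v. near_part (a v) n L A k l) \<in> borel_measurable N"
  unfolding near_part_def
  by (intro borel_measurable_times borel_measurable_sum borel_measurable_const assms) auto

lemma far_large_measurable:
  assumes "\<And>i. i \<le> n \<Longrightarrow> index_scale i = b \<Longrightarrow> (\<lambda>v. a v i) \<in> borel_measurable N"
  shows "Measurable.pred N (\<lambda>v. far_large (a v) n L w k b)"
proof -
  have [measurable]: "(\<lambda>v. block_part (a v) n L k l b) \<in> borel_measurable N" for l
    by (rule block_part_measurable[OF assms])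
  show ?thesis unfolding far_large_def by measurable
qed

lemma far_count_measurable:
  assumes "\<And>i. i \<le> n \<Longrightarrow> index_scale i = b \<Longrightarrow> (\<lambda>v. a v i) \<in> borel_measurable N"
  shows "(\<lambda>v. far_count (a v) n L A w W b) \<in> borel_measurable N"
proof -
  have [measurable]: "Measurable.pred N (\<lambda>v. far_large (a v) n L w k b)" for k
    by (rule far_large_measurable[OF assms])
  show ?thesis unfolding far_count_def by measurable
qed

lemma near_changes_measurable:
  assumes "\<And>i. i \<le> n \<Longrightarrow> gap k (index_scale i) < A \<Longrightarrow> (\<lambda>v. a v i) \<in> borel_measurable N"
  shows "(\<lambda>v. near_changes (a v) n L A \<delta> k) \<in> borel_measurable N"
proof -
  have [measurable]: "(\<lambda>v. near_part (a v) n L A k l) \<in> borel_measurable N" for l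
    by (rule near_part_measurable[OF assms])
  show ?thesis unfolding near_changes_def by measurable
qed

lemma far_count_cong:
  assumes "\<And>i. i \<le> n \<Longrightarrow> index_scale i = b \<Longrightarrow> a i = a' i"
  shows "far_count a n L A w W b = far_count a' n L A w W b"
proof -
  have "block_part a n L k l b = block_part a' n L k l b" for k l
    unfolding block_part_def using assms by (intro arg_cong2[where f="(*)"] sum.cong) auto
  then show ?thesis by (simp add: far_count_def far_large_def)
qed

lemma near_changes_cong:
  assumes "\<And>i. i \<le> n \<Longrightarrow> gap k (index_scale i) < A \<Longrightarrow> a i = a' i"
  shows "near_changes a n L A \<delta> k = near_changes a' n L A \<delta> k"
proof -
  have "near_part a n L A k l = near_part a' n L A k l" for l
    unfolding near_part_def using assms by (intro arg_cong2[where f="(*)"] sum.cong) auto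
  then show ?thesis by (simp add: near_changes_def)
qed

lemma near_changes_bounds: "0 \<le> near_changes a n L A \<delta> k" "near_changes a n L A \<delta> k \<le> real L"
proof -
  show "0 \<le> near_changes a n L A \<delta> k" unfolding near_changes_def by (intro sum_nonneg) auto
  have "near_changes a n L A \<delta> k \<le> (\<Sum>l<L. 1)" unfolding near_changes_def by (intro sum_mono) auto
  then show "near_changes a n L A \<delta> k \<le> real L" by simp
qed

lemma far_count_bounds:
  assumes "finite W"
  shows "0 \<le> far_count a n L A w W b" "far_count a n L A w W b \<le> real (card W)"
proof -
  show "0 \<le> far_count a n L A w W b" unfolding far_count_def by (intro sum_nonneg) auto
  have "far_count a n L A w W b \<le> (\<Sum>k\<in>{k \<in> W. A \<le> gap k b}. 1)" unfolding far_count_def by (intro sum_mono) auto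
  also have "\<dots> \<le> real (card W)" using assms by (simp add: card_mono)
  finally show "far_count a n L A w W b \<le> real (card W)" .
qed

text \<open>
  If \<open>d\<close> is the distance of the farthest disturbed window, at most \<open>2 d\<close> windows are disturbed, and the
  left-hand side is at most \<open>decay^(- d)\<close>, which is one of the summands.
\<close>
lemma exp_far_count_le:
  assumes "finite W" "A \<ge> 1"
  shows "exp (- ln decay / 2 * far_count a n L A w W b)
    \<le> 1 + (\<Sum>k\<in>{k \<in> W. A \<le> gap k b}. inverse (decay ^ gap k b) * (if far_large a n L w k b then 1 else 0))"
proof -
  define T where "T = {k \<in> W. A \<le> gap k b \<and> far_large a n L w k b}"
  have fin: "finite T" using assms by (simp add: T_def)
  have c: "far_count a n L A w W b = real (card T)"
    unfolding far_count_def using assms by (subst sum.inter_filter[symmetric]) (auto simp: T_def intro!: arg_cong[where f=card])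
  show ?thesis
  proof (cases "T = {}")
    case True
    have "0 \<le> (\<Sum>k\<in>{k \<in> W. A \<le> gap k b}. inverse (decay ^ gap k b) * (if far_large a n L w k b then 1 else 0 :: real))"
      using decay by (intro sum_nonneg) auto
    then show ?thesis using True by (simp add: c)
  next
    case False
    define d where "d = Max ((\<lambda>k. gap k b) ` T)"
    have "d \<in> (\<lambda>k. gap k b) ` T" unfolding d_def using False fin by (intro Max_in) auto
    then obtain k where k: "k \<in> T" "gap k b = d" by auto
    have le: "gap j b \<le> d" if "j \<in> T" for j unfolding d_def using that fin by (intro Max_ge) auto
    have "T \<subseteq> {b - d..b + d} - {b}"
      using le assms(2) by (force simp: T_def gap_def)
    then have "card T \<le> card ({b - d..b + d} - {b})" by (intro card_mono) auto
    also have "\<dots> \<le> 2 * d" by (subst card_Diff_subset) auto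
    finally have "real (card T) \<le> 2 * real d" by linarith
    then have "- ln decay / 2 * real (card T) \<le> - ln decay / 2 * (2 * real d)"
      using decay by (intro mult_left_mono) auto
    then have "exp (- ln decay / 2 * real (card T)) \<le> exp (- (real d * ln decay))"
      by (simp add: mult.commute)
    also have "\<dots> = inverse (decay ^ d)" using decay by (simp add: exp_minus exp_of_nat_mult)
    also have "\<dots> = inverse (decay ^ gap k b) * (if far_large a n L w k b then 1 else 0)"
      using k by (simp add: T_def)
    also have "\<dots> \<le> (\<Sum>k\<in>{k \<in> W. A \<le> gap k b}. inverse (decay ^ gap k b) * (if far_large a n L w k b then 1 else 0))"
      using k assms decay by (intro member_le_sum[where f="\<lambda>k. inverse (decay ^ gap k b) * (if far_large a n L w k b then 1 else 0)"]) (auto simp: T_def)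
    finally show ?thesis by (simp add: c)
  qed
qed

lemma gap_commute: "gap k b = gap b k" by (simp add: gap_def)

definition far_rate :: "nat \<Rightarrow> nat \<Rightarrow> real \<Rightarrow> real" where
  "far_rate L A w = 4 * (real L + 1) / w\<^sup>2 * decay ^ A / (1 - decay)"

context random_coeffs
begin

abbreviation far_event :: "nat \<Rightarrow> nat \<Rightarrow> real \<Rightarrow> nat \<Rightarrow> nat \<Rightarrow> 'a set" where
  "far_event n L w k b \<equiv> {\<omega> \<in> space M. far_large (sample \<omega>) n L w k b}"

lemma far_large_event [measurable]: "Measurable.pred M (\<lambda>\<omega>. far_large (sample \<omega>) n L w k b)"
  by (rule far_large_measurable) simp

lemma far_count_rv [measurable]: "(\<lambda>\<omega>. far_count (sample \<omega>) n L A w W b) \<in> borel_measurable M"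
  by (rule far_count_measurable) simp

lemma near_changes_rv [measurable]: "(\<lambda>\<omega>. near_changes (sample \<omega>) n L A \<delta> k) \<in> borel_measurable M"
  by (rule near_changes_measurable) simp

lemma prob_far_large_le:
  assumes "L > 0" "w > 0"
  shows "prob (far_event n L w k b) \<le> 2 * (real L + 1) / w\<^sup>2 * (decay ^ gap k b)\<^sup>2"
proof -
  define c where "c = w * decay ^ gap k b"
  have c: "c > 0" using assms decay by (simp add: c_def)
  have one: "prob {\<omega> \<in> space M. c < \<bar>block_part (sample \<omega>) n L k l b\<bar>} \<le> 2 / w\<^sup>2 * (decay ^ gap k b)\<^sup>2" if l: "l \<le> L" for l
  proof -
    define X where "X = (\<lambda>\<omega>. block_part (sample \<omega>) n L k l b)"
    have X: "X \<omega> = (\<Sum>i | i \<le> n \<and> index_scale i = b. (sqrt ((7/8) ^ k) * grid_pt L k l ^ i) * \<xi> i \<omega>)" for \<omega>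
      by (simp add: X_def block_part_def sum_distrib_left mult_ac)
    have [measurable]: "X \<in> borel_measurable M" unfolding X by measurable
    have iX: "integrable M (\<lambda>\<omega>. (X \<omega>)\<^sup>2)" unfolding X by (rule second_moment_sum) simp
    have "expectation (\<lambda>\<omega>. (X \<omega>)\<^sup>2) = (\<Sum>i | i \<le> n \<and> index_scale i = b. (sqrt ((7/8) ^ k) * grid_pt L k l ^ i)\<^sup>2)"
      unfolding X by (rule second_moment_sum) simp
    also have "\<dots> = (7/8) ^ k * (\<Sum>i | i \<le> n \<and> index_scale i = b. (grid_pt L k l ^ i)\<^sup>2)"
      by (simp add: power_mult_distrib sum_distrib_left)
    also have "\<dots> \<le> 2 * (7/8) ^ gap k b" by (rule block_weight_le[OF assms(1) l])
    finally have e: "expectation (\<lambda>\<omega>. (X \<omega>)\<^sup>2) \<le> 2 * (7/8) ^ gap k b" .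
    have "prob {\<omega> \<in> space M. c < \<bar>X \<omega>\<bar>} \<le> prob {\<omega> \<in> space M. c\<^sup>2 \<le> (X \<omega>)\<^sup>2}"
    proof (intro finite_measure_mono subsetI)
      fix \<omega> assume "\<omega> \<in> {\<omega> \<in> space M. c < \<bar>X \<omega>\<bar>}"
      then show "\<omega> \<in> {\<omega> \<in> space M. c\<^sup>2 \<le> (X \<omega>)\<^sup>2}"
        using c power_mono[of c "\<bar>X \<omega>\<bar>" 2] by auto
    qed measurable
    also have "\<dots> \<le> expectation (\<lambda>\<omega>. (X \<omega>)\<^sup>2) / c\<^sup>2"
      using iX c by (intro integral_Markov_inequality_measure[where A="{}"]) auto
    also have "\<dots> \<le> 2 * (7/8) ^ gap k b / c\<^sup>2" using e by (intro divide_right_mono) auto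
    also have "(7/8 :: real) ^ gap k b = (decay ^ gap k b) ^ 4"
      using decay(3) by (metis power_mult mult.commute)
    also have "2 * (decay ^ gap k b) ^ 4 / c\<^sup>2 = 2 / w\<^sup>2 * (decay ^ gap k b)\<^sup>2"
      using decay assms by (simp add: c_def power_mult_distrib field_simps power4_eq_xxxx power2_eq_square)
    finally show ?thesis by (simp add: X_def)
  qed
  have [measurable]: "(\<lambda>\<omega>. block_part (sample \<omega>) n L k l b) \<in> borel_measurable M" for l
    by (rule block_part_measurable) simp
  have "(far_event n L w k b)
      = (\<Union>l\<in>{..L}. {\<omega> \<in> space M. c < \<bar>block_part (sample \<omega>) n L k l b\<bar>})"
    by (auto simp: far_large_def c_def)
  also have "prob \<dots> \<le> (\<Sum>l\<in>{..L}. prob {\<omega> \<in> space M. c < \<bar>block_part (sample \<omega>) n L k l b\<bar>})"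
    by (rule finite_measure_subadditive_finite) auto
  also have "\<dots> \<le> (\<Sum>l\<in>{..L}. 2 / w\<^sup>2 * (decay ^ gap k b)\<^sup>2)"
    using one by (intro sum_mono) auto
  also have "\<dots> = 2 * (real L + 1) / w\<^sup>2 * (decay ^ gap k b)\<^sup>2" by simp
  finally show ?thesis .
qed

lemma sum_prob_far_large_le:
  assumes "L > 0" "w > 0" "finite W"
  shows "(\<Sum>k\<in>{k \<in> W. A \<le> gap k b}. inverse (decay ^ gap k b) * prob (far_event n L w k b)) \<le> far_rate L A w"
    and "(\<Sum>b\<in>{b \<in> W. A \<le> gap k b}. prob (far_event n L w k b)) \<le> far_rate L A w"
proof -
  have dp: "0 < decay ^ m" "decay ^ m \<le> 1" for m using decay by (auto simp: power_le_one)
  have geo: "(\<Sum>k\<in>{k \<in> W. A \<le> gap b k}. 2 * (real L + 1) / w\<^sup>2 * decay ^ gap b k) \<le> far_rate L A w" for b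
  proof -
    have "(\<Sum>k\<in>{k \<in> W. A \<le> gap b k}. 2 * (real L + 1) / w\<^sup>2 * decay ^ gap b k)
      = 2 * (real L + 1) / w\<^sup>2 * (\<Sum>k\<in>{k \<in> W. A \<le> gap b k}. decay ^ gap b k)"
      by (simp add: sum_distrib_left)
    also have "\<dots> \<le> 2 * (real L + 1) / w\<^sup>2 * (2 * decay ^ A / (1 - decay))"
      using assms decay by (intro mult_left_mono sum_decay_gap_le) auto
    also have "\<dots> = far_rate L A w" by (simp add: far_rate_def field_simps)
    finally show ?thesis .
  qed
  have "(\<Sum>k\<in>{k \<in> W. A \<le> gap k b}. inverse (decay ^ gap k b) * prob (far_event n L w k b))
    \<le> (\<Sum>k\<in>{k \<in> W. A \<le> gap k b}. 2 * (real L + 1) / w\<^sup>2 * decay ^ gap b k)"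
  proof (rule sum_mono)
    fix k
    have "inverse (decay ^ gap k b) * prob (far_event n L w k b)
      \<le> inverse (decay ^ gap k b) * (2 * (real L + 1) / w\<^sup>2 * (decay ^ gap k b)\<^sup>2)"
      using dp[of "gap k b"] by (intro mult_left_mono prob_far_large_le assms) auto
    also have "\<dots> = 2 * (real L + 1) / w\<^sup>2 * decay ^ gap b k"
    proof -
      have "inverse d * (c * d\<^sup>2) = c * d" if "0 < d" for c d :: real
        using that by (simp add: power2_eq_square)
      from this[OF dp(1)] show ?thesis by (simp add: gap_commute[of b k])
    qed
    finally show "inverse (decay ^ gap k b) * prob (far_event n L w k b)
      \<le> 2 * (real L + 1) / w\<^sup>2 * decay ^ gap b k" .
  qed
  also have "\<dots> \<le> far_rate L A w" using geo[of b] by (simp add: gap_commute[of _ b])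
  finally show "(\<Sum>k\<in>{k \<in> W. A \<le> gap k b}. inverse (decay ^ gap k b) * prob (far_event n L w k b)) \<le> far_rate L A w" .
  have "(\<Sum>b\<in>{b \<in> W. A \<le> gap k b}. prob (far_event n L w k b))
    \<le> (\<Sum>b\<in>{b \<in> W. A \<le> gap k b}. 2 * (real L + 1) / w\<^sup>2 * decay ^ gap k b)"
  proof (rule sum_mono)
    fix b
    have "prob (far_event n L w k b)
      \<le> 2 * (real L + 1) / w\<^sup>2 * (decay ^ gap k b)\<^sup>2"
      by (intro prob_far_large_le assms)
    also have "\<dots> \<le> 2 * (real L + 1) / w\<^sup>2 * decay ^ gap k b"
      using dp[of "gap k b"] by (intro mult_left_mono) (auto simp: power2_eq_square mult_left_le)
    finally show "prob (far_event n L w k b) \<le> 2 * (real L + 1) / w\<^sup>2 * decay ^ gap k b" .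
  qed
  also have "\<dots> \<le> far_rate L A w" by (rule geo)
  finally show "(\<Sum>b\<in>{b \<in> W. A \<le> gap k b}. prob (far_event n L w k b)) \<le> far_rate L A w" .
qed

lemma expectation_exp_far_count_le:
  assumes "L > 0" "w > 0" "finite W" "A \<ge> 1"
  shows "integrable M (\<lambda>\<omega>. exp (- ln decay / 2 * far_count (sample \<omega>) n L A w W b))"
    and "expectation (\<lambda>\<omega>. exp (- ln decay / 2 * far_count (sample \<omega>) n L A w W b)) \<le> exp (far_rate L A w)"
proof -
  let ?Z = "\<lambda>\<omega>. exp (- ln decay / 2 * far_count (sample \<omega>) n L A w W b)"
  have lam: "0 < - ln decay / 2" using decay by simp
  show int: "integrable M ?Z"
  proof (rule integrable_const_bound)
    show "AE \<omega> in M. norm (?Z \<omega>) \<le> exp (- ln decay / 2 * real (card W))"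
    proof (rule AE_I2)
      fix \<omega>
      have "- ln decay / 2 * far_count (sample \<omega>) n L A w W b \<le> - ln decay / 2 * real (card W)"
        using lam far_count_bounds(2)[OF assms(3)] by (intro mult_left_mono) auto
      then show "norm (?Z \<omega>) \<le> exp (- ln decay / 2 * real (card W))"
        by (simp only: real_norm_def abs_exp_cancel exp_le_cancel_iff)
    qed
  qed measurable
  define X where "X = (\<lambda>k. (far_event n L w k b))"
  have [measurable]: "X k \<in> events" for k unfolding X_def by measurable
  have iX: "integrable M (indicat_real (X k))" for k
    by (intro integrable_real_indicator; simp add: emeasure_eq_measure)
  have "expectation ?Z
    \<le> expectation (\<lambda>\<omega>. 1 + (\<Sum>k\<in>{k \<in> W. A \<le> gap k b}. inverse (decay ^ gap k b) * indicat_real (X k) \<omega>))"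
  proof (rule integral_mono[OF int])
    show "integrable M (\<lambda>\<omega>. 1 + (\<Sum>k\<in>{k \<in> W. A \<le> gap k b}. inverse (decay ^ gap k b) * indicat_real (X k) \<omega>))"
      using iX by (intro Bochner_Integration.integrable_add Bochner_Integration.integrable_sum integrable_mult_right) auto
    fix \<omega> assume \<omega>: "\<omega> \<in> space M"
    have "(if far_large (sample \<omega>) n L w k b then 1 else 0) = indicat_real (X k) \<omega>" for k
      using \<omega> by (auto simp: X_def)
    then show "?Z \<omega>
      \<le> 1 + (\<Sum>k\<in>{k \<in> W. A \<le> gap k b}. inverse (decay ^ gap k b) * indicat_real (X k) \<omega>)"
      using exp_far_count_le[OF assms(3,4), of "\<lambda>i. \<xi> i \<omega>" n L w b] by simp
  qed
  also have "\<dots> = 1 + (\<Sum>k\<in>{k \<in> W. A \<le> gap k b}. inverse (decay ^ gap k b) * prob (X k))"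
    using iX by (subst Bochner_Integration.integral_add) (auto simp: prob_space)
  also have "\<dots> \<le> 1 + far_rate L A w"
    unfolding X_def by (intro add_left_mono sum_prob_far_large_le assms)
  also have "\<dots> \<le> exp (far_rate L A w)" by (rule exp_ge_add_one_self)
  finally show "expectation ?Z \<le> exp (far_rate L A w)" .
qed

lemma indep_far_count:
  "indep_vars (\<lambda>_. borel) (\<lambda>b \<omega>. far_count (sample \<omega>) n L A w W b) B"
proof -
  define K where "K = (\<lambda>b. {i. i \<le> n \<and> index_scale i = b})"
  have "indep_vars (\<lambda>b. PiM (K b) (\<lambda>_. borel)) (\<lambda>b \<omega>. restrict (sample \<omega>) (K b)) B"
    by (rule indep_vars_restrict[OF indep]) (auto simp: K_def disjoint_family_on_def)
  then have "indep_vars (\<lambda>_. borel) (\<lambda>b \<omega>. far_count (restrict (sample \<omega>) (K b)) n L A w W b) B"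
    by (rule indep_vars_compose2) (auto intro!: far_count_measurable measurable_component_singleton simp: K_def)
  moreover have "far_count (restrict (sample \<omega>) (K b)) n L A w W b = far_count (sample \<omega>) n L A w W b" for b \<omega>
    by (rule far_count_cong) (auto simp: K_def)
  ultimately show ?thesis by simp
qed

text \<open>
  An exponential Markov inequality for the independent counts of the blocks.
\<close>
lemma prob_far_count_large_le:
  assumes "L > 0" "w > 0" "finite W" "A \<ge> 1" "finite B"
  shows "prob {\<omega> \<in> space M. y \<le> (\<Sum>b\<in>B. far_count (sample \<omega>) n L A w W b)}
    \<le> exp (ln decay / 2 * y + far_rate L A w * real (card B))"
proof -
  define lam where "lam = - ln decay / 2"
  have lam0: "0 < lam" using decay by (simp add: lam_def)
  define Z where "Z = (\<lambda>b \<omega>. exp (lam * far_count (sample \<omega>) n L A w W b))"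
  have iZ: "integrable M (Z b)" and eZ: "expectation (Z b) \<le> exp (far_rate L A w)" for b
    unfolding Z_def lam_def by (rule expectation_exp_far_count_le[OF assms(1-4)])+
  have indZ: "indep_vars (\<lambda>_. borel) Z B"
    unfolding Z_def using indep_far_count by (rule indep_vars_compose2) simp
  have prodZ: "(\<Prod>b\<in>B. Z b \<omega>) = exp (lam * (\<Sum>b\<in>B. far_count (sample \<omega>) n L A w W b))" for \<omega>
    using assms(5) by (simp add: Z_def exp_sum sum_distrib_left)
  have "prob {\<omega> \<in> space M. y \<le> (\<Sum>b\<in>B. far_count (sample \<omega>) n L A w W b)}
    = prob {\<omega> \<in> space M. exp (lam * y) \<le> (\<Prod>b\<in>B. Z b \<omega>)}"
    unfolding prodZ using lam0 by simp
  also have "\<dots> \<le> expectation (\<lambda>\<omega>. \<Prod>b\<in>B. Z b \<omega>) / exp (lam * y)"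
    using indep_vars_integrable[OF assms(5) indZ iZ]
    by (intro integral_Markov_inequality_measure[where A="{}"]) (auto simp: Z_def intro!: prod_nonneg AE_I2)
  also have "expectation (\<lambda>\<omega>. \<Prod>b\<in>B. Z b \<omega>) = (\<Prod>b\<in>B. expectation (Z b))"
    by (rule indep_vars_lebesgue_integral[OF assms(5) indZ iZ])
  also have "(\<Prod>b\<in>B. expectation (Z b)) / exp (lam * y) \<le> (\<Prod>b\<in>B. exp (far_rate L A w)) / exp (lam * y)"
    using eZ by (intro divide_right_mono prod_mono) (auto simp: Z_def intro!: Bochner_Integration.integral_nonneg)
  also have "\<dots> = exp (ln decay / 2 * y + far_rate L A w * real (card B))"
  proof -
    have "(\<Prod>b\<in>B. exp (far_rate L A w)) = exp (far_rate L A w * real (card B))"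
      by (simp add: exp_of_nat2_mult)
    moreover have "exp (far_rate L A w * real (card B)) / exp (lam * y) = exp (far_rate L A w * real (card B) - lam * y)"
      by (rule exp_diff[symmetric])
    moreover have "far_rate L A w * real (card B) - lam * y = ln decay / 2 * y + far_rate L A w * real (card B)"
      by (simp add: lam_def)
    ultimately show ?thesis by simp
  qed
  finally show ?thesis .
qed

text \<open>
  Windows at distance at least \<open>2 A\<close> use disjoint sets of coefficients.
\<close>
lemma indep_near_changes:
  assumes "\<And>k k'. k \<in> I \<Longrightarrow> k' \<in> I \<Longrightarrow> k \<noteq> k' \<Longrightarrow> 2 * A \<le> gap k k'"
  shows "indep_vars (\<lambda>_. borel) (\<lambda>k \<omega>. near_changes (sample \<omega>) n L A \<delta> k) I"
proof -
  define K where "K = (\<lambda>k. {i. i \<le> n \<and> gap k (index_scale i) < A})"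
  have "K k \<inter> K k' = {}" if "k \<in> I" "k' \<in> I" "k \<noteq> k'" for k k'
  proof -
    have False if i: "i \<in> K k" "i \<in> K k'" for i
    proof -
      have "gap k k' \<le> gap k (index_scale i) + gap k' (index_scale i)" by (simp add: gap_def)
      then show False using assms[OF \<open>k \<in> I\<close> \<open>k' \<in> I\<close> \<open>k \<noteq> k'\<close>] i by (simp add: K_def)
    qed
    then show ?thesis by auto
  qed
  then have "indep_vars (\<lambda>k. PiM (K k) (\<lambda>_. borel)) (\<lambda>k \<omega>. restrict (sample \<omega>) (K k)) I"
    by (intro indep_vars_restrict[OF indep]) (auto simp: disjoint_family_on_def)
  then have "indep_vars (\<lambda>_. borel) (\<lambda>k \<omega>. near_changes (restrict (sample \<omega>) (K k)) n L A \<delta> k) I"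
    by (rule indep_vars_compose2) (auto intro!: near_changes_measurable measurable_component_singleton simp: K_def)
  moreover have "near_changes (restrict (sample \<omega>) (K k)) n L A \<delta> k = near_changes (sample \<omega>) n L A \<delta> k" for k \<omega>
    by (rule near_changes_cong) (auto simp: K_def)
  ultimately show ?thesis by simp
qed

lemma prob_near_changes_class_le:
  assumes "finite I" "\<And>k k'. k \<in> I \<Longrightarrow> k' \<in> I \<Longrightarrow> k \<noteq> k' \<Longrightarrow> 2 * A \<le> gap k k'"
    and "L > 0" "t > 0" "real (card I) \<le> m" "m > 0"
  shows "prob {\<omega> \<in> space M. (\<Sum>k\<in>I. near_changes (sample \<omega>) n L A \<delta> k)
     \<le> (\<Sum>k\<in>I. expectation (\<lambda>\<omega>. near_changes (sample \<omega>) n L A \<delta> k)) - t}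
    \<le> exp (- 2 * t\<^sup>2 / (m * (real L)\<^sup>2))"
proof (cases "I = {}")
  case True
  then show ?thesis using assms by simp
next
  case False
  define X where "X = (\<lambda>k \<omega>. near_changes (sample \<omega>) n L A \<delta> k)"
  interpret H: Hoeffding_ineq M I X "\<lambda>_. 0" "\<lambda>_. real L" "\<Sum>k\<in>I. expectation (X k)"
  proof unfold_locales
    show "indep_vars (\<lambda>_. borel) X I" unfolding X_def by (rule indep_near_changes[OF assms(2)])
  qed (use assms near_changes_bounds in \<open>auto simp: X_def intro!: AE_I2\<close>)
  have card: "real (card I) > 0" using False assms(1) by (simp add: card_gt_0_iff)
  have "prob {\<omega> \<in> space M. (\<Sum>k\<in>I. X k \<omega>) \<le> (\<Sum>k\<in>I. expectation (X k)) - t}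
    \<le> exp (- 2 * t\<^sup>2 / (\<Sum>k\<in>I. (real L - 0)\<^sup>2))"
    by (rule H.Hoeffding_ineq_le) (use assms card in auto)
  also have "\<dots> \<le> exp (- 2 * t\<^sup>2 / (m * (real L)\<^sup>2))"
  proof -
    have "2 * t\<^sup>2 / (m * (real L)\<^sup>2) \<le> 2 * t\<^sup>2 / (real (card I) * (real L)\<^sup>2)"
      using assms card by (intro divide_left_mono mult_right_mono mult_pos_pos) auto
    then show ?thesis by simp
  qed
  finally show ?thesis by (simp add: X_def)
qed

lemma prob_near_changes_small_le:
  assumes "finite W" "A \<ge> 1" "L > 0" "t > 0" "real (card W) \<le> m" "m > 0"
  shows "prob {\<omega> \<in> space M. (\<Sum>k\<in>W. near_changes (sample \<omega>) n L A \<delta> k)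
     \<le> (\<Sum>k\<in>W. expectation (\<lambda>\<omega>. near_changes (sample \<omega>) n L A \<delta> k)) - t}
    \<le> 2 * real A * exp (- 2 * (t / (2 * real A))\<^sup>2 / (m * (real L)\<^sup>2))"
proof -
  define X where "X = (\<lambda>k \<omega>. near_changes (sample \<omega>) n L A \<delta> k)"
  have [measurable]: "X k \<in> borel_measurable M" for k unfolding X_def by measurable
  \<comment> \<open>If the total is low by \<open>t\<close>, one of the \<open>2 A\<close> residue classes is low by \<open>t / (2 A)\<close>.\<close>
  define I where "I = (\<lambda>c. {k \<in> W. k mod (2 * A) = c})"
  define E where "E = (\<lambda>c. {\<omega> \<in> space M. (\<Sum>k\<in>I c. X k \<omega>) \<le> (\<Sum>k\<in>I c. expectation (X k)) - t / (2 * real A)})"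
  have A: "real A > 0" using assms by simp
  have [measurable]: "E c \<in> events" for c unfolding E_def by measurable
  have group: "(\<Sum>k\<in>W. g k) = (\<Sum>c<2 * A. \<Sum>k\<in>I c. g k)" for g :: "nat \<Rightarrow> real"
    unfolding I_def by (rule sum.group[symmetric]) (use assms in auto)
  have "{\<omega> \<in> space M. (\<Sum>k\<in>W. X k \<omega>) \<le> (\<Sum>k\<in>W. expectation (X k)) - t} \<subseteq> (\<Union>c\<in>{..<2 * A}. E c)"
  proof
    fix \<omega> assume \<omega>: "\<omega> \<in> {\<omega> \<in> space M. (\<Sum>k\<in>W. X k \<omega>) \<le> (\<Sum>k\<in>W. expectation (X k)) - t}"
    show "\<omega> \<in> (\<Union>c\<in>{..<2 * A}. E c)"
    proof (rule ccontr)
      assume "\<not> ?thesis"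
      then have "(\<Sum>k\<in>I c. expectation (X k)) - t / (2 * real A) < (\<Sum>k\<in>I c. X k \<omega>)" if "c \<in> {..<2 * A}" for c
        using \<omega> that by (auto simp: E_def not_le)
      then have "(\<Sum>c<2 * A. (\<Sum>k\<in>I c. expectation (X k)) - t / (2 * real A)) < (\<Sum>c<2 * A. \<Sum>k\<in>I c. X k \<omega>)"
        using assms by (intro sum_strict_mono) (auto simp: lessThan_empty_iff)
      then have "(\<Sum>k\<in>W. expectation (X k)) - t < (\<Sum>k\<in>W. X k \<omega>)"
        unfolding sum_subtractf group using A by simp
      then show False using \<omega> by simp
    qed
  qed
  then have "prob {\<omega> \<in> space M. (\<Sum>k\<in>W. X k \<omega>) \<le> (\<Sum>k\<in>W. expectation (X k)) - t} \<le> prob (\<Union>c\<in>{..<2 * A}. E c)"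
    by (rule finite_measure_mono) auto
  also have "\<dots> \<le> (\<Sum>c\<in>{..<2 * A}. prob (E c))"
    by (rule finite_measure_subadditive_finite) auto
  also have "\<dots> \<le> (\<Sum>c\<in>{..<2 * A}. exp (- 2 * (t / (2 * real A))\<^sup>2 / (m * (real L)\<^sup>2)))"
  proof (rule sum_mono)
    fix c
    show "prob (E c) \<le> exp (- 2 * (t / (2 * real A))\<^sup>2 / (m * (real L)\<^sup>2))"
      unfolding E_def X_def
    proof (rule prob_near_changes_class_le)
      have "card (I c) \<le> card W" using assms(1) by (intro card_mono) (auto simp: I_def)
      then show "real (card (I c)) \<le> m" using assms(5) by linarith
      fix k k' assume k: "k \<in> I c" "k' \<in> I c" "k \<noteq> k'"
      have "k mod (2 * A) = k' mod (2 * A)" using k by (simp add: I_def)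
      have "2 * A dvd gap k k'"
      proof (cases "k \<le> k'")
        case True
        then show ?thesis using mod_eq_dvd_iff_nat[OF True, of "2 * A"] \<open>k mod (2 * A) = k' mod (2 * A)\<close>
          unfolding gap_def by simp
      next
        case False
        then have "k' \<le> k" by simp
        then show ?thesis using mod_eq_dvd_iff_nat[OF \<open>k' \<le> k\<close>, of "2 * A"] \<open>k mod (2 * A) = k' mod (2 * A)\<close>
          unfolding gap_def by simp
      qed
      then show "2 * A \<le> gap k k'" using k by (intro dvd_imp_le) (auto simp: gap_def)
    qed (use assms in \<open>auto simp: I_def\<close>)
  qed
  finally show ?thesis by (simp add: X_def)
qed

end

section \<open>Roots and sign changes\<close>

definition coeff_sum :: "(nat \<Rightarrow> real) \<Rightarrow> nat \<Rightarrow> real \<Rightarrow> real" where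
  "coeff_sum a n x = (\<Sum>i\<le>n. a i * x ^ i)"

abbreviation root_count :: "(nat \<Rightarrow> real) \<Rightarrow> nat \<Rightarrow> real set \<Rightarrow> nat" where
  "root_count a n S \<equiv> card {x \<in> S. coeff_sum a n x = 0}"

lemma poly_local_poly_coeff_sum: "poly (local_poly a n x h) y = sqrt h * coeff_sum a n (x + h * y)"
  by (simp add: poly_local_poly coeff_sum_def)

lemma local_poly_eq_0_iff:
  assumes "h > 0"
  shows "local_poly a n x h = 0 \<longleftrightarrow> (\<forall>t. coeff_sum a n t = 0)"
proof
  assume "local_poly a n x h = 0"
  then have "sqrt h * coeff_sum a n (x + h * ((t - x) / h)) = 0" for t
    using poly_local_poly_coeff_sum[of a n x h "(t - x) / h"] by simp
  then show "\<forall>t. coeff_sum a n t = 0" using assms by simp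
next
  assume "\<forall>t. coeff_sum a n t = 0"
  then have "poly (local_poly a n x h) y = 0" for y by (simp add: poly_local_poly_coeff_sum)
  then show "local_poly a n x h = 0" by (simp add: poly_all_0_iff_0[symmetric])
qed

lemma finite_roots_coeff_sum:
  assumes "coeff_sum a n t \<noteq> 0"
  shows "finite {x. coeff_sum a n x = 0}"
proof -
  have "local_poly a n 0 1 \<noteq> 0" using assms by (auto simp: local_poly_eq_0_iff)
  then have "finite {x. poly (local_poly a n 0 1) x = 0}" by (rule poly_roots_finite)
  then show ?thesis by (simp add: poly_local_poly_coeff_sum)
qed

definition cell_count :: "(nat \<Rightarrow> real) \<Rightarrow> nat \<Rightarrow> real \<Rightarrow> real \<Rightarrow> nat" where
  "cell_count a n x h = card {y \<in> {0..1/8}. poly (local_poly a n x h) y = 0}"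

abbreviation window_count :: "(nat \<Rightarrow> real) \<Rightarrow> nat \<Rightarrow> nat \<Rightarrow> nat" where
  "window_count a n k \<equiv> cell_count a n (1 - (7/8) ^ k) ((7/8) ^ k)"

lemma cell_count_le_degree:
  assumes "local_poly a n x h \<noteq> 0"
  shows "finite {y \<in> {0..1/8}. poly (local_poly a n x h) y = 0}" "cell_count a n x h \<le> n"
proof -
  have fin: "finite {y. poly (local_poly a n x h) y = 0}" by (rule poly_roots_finite[OF assms])
  then show "finite {y \<in> {0..1/8}. poly (local_poly a n x h) y = 0}" by (rule rev_finite_subset) auto
  have "cell_count a n x h \<le> card {y. poly (local_poly a n x h) y = 0}"
    unfolding cell_count_def using fin by (intro card_mono) auto
  also have "\<dots> \<le> degree (local_poly a n x h)" by (rule card_poly_roots_bound[OF assms])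
  also have "\<dots> \<le> n" by (rule degree_local_poly)
  finally show "cell_count a n x h \<le> n" .
qed

lemma coeff_small_of_cell_count:
  assumes "r \<le> cell_count a n x h" "local_poly a n x h \<noteq> 0"
  shows "\<bar>coeff (local_poly a n x h) j\<bar> \<le> 8 ^ j * (2/3) ^ r * coeff_norm (1/2) (local_poly a n x h)"
proof -
  obtain Z where Z: "Z \<subseteq> {y \<in> {0..1/8}. poly (local_poly a n x h) y = 0}" "card Z = r" "finite Z"
    using obtain_subset_with_card_n[OF assms(1)[unfolded cell_count_def]] by blast
  have "\<And>z. z \<in> Z \<Longrightarrow> poly (local_poly a n x h) z = 0" "Z \<subseteq> {0..1/8}" using Z(1) by auto
  from abs_coeff_le_of_roots[OF Z(3) this] show ?thesis by (simp add: Z(2))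
qed

text \<open>
  The windows up to the last one of length at least \<open>1 / (8 n)\<close> leave an interval shorter than \<open>1 / n\<close> at the endpoint,
  which eight cells of scale \<open>1 / n\<close> cover. If the polynomial vanishes identically, the left-hand side is 0
  because \<open>S\<close> is infinite.
\<close>
lemma card_roots_le_sum_cells:
  assumes "n \<ge> 1" "infinite S" "S \<subseteq> {0..1}" "1 / real n \<le> (7/8) ^ K" "(7/8) ^ Suc K < 1 / real n"
  shows "root_count a n S \<le> (\<Sum>k\<le>K. window_count a n k)
    + (\<Sum>e<8. cell_count a n (min 1 (1 - (7/8) ^ Suc K + real e / (8 * real n))) (1 / real n))"
proof (cases "\<forall>t. coeff_sum a n t = 0")
  case True
  then have "{x \<in> S. coeff_sum a n x = 0} = S" by auto
  then show ?thesis using assms(2) by simp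
next
  case False
  define Z where "Z = (\<lambda>x h. {y \<in> {0..1/8}. poly (local_poly a n x h) y = 0})"
  have n: "real n > 0" using assms by simp
  have fin: "finite (Z x h)" if "h > 0" for x h
    unfolding Z_def by (rule cell_count_le_degree) (use False that local_poly_eq_0_iff in blast)
  define U where "U = (\<lambda>k. (\<lambda>y. (1 - (7/8) ^ k) + (7/8) ^ k * y) ` Z (1 - (7/8) ^ k) ((7/8) ^ k))"
  define b where "b = (\<lambda>e::nat. min 1 (1 - (7/8) ^ Suc K + real e / (8 * real n)))"
  define V where "V = (\<lambda>e. (\<lambda>y. b e + 1 / real n * y) ` Z (b e) (1 / real n))"
  have finU: "finite (U k)" for k unfolding U_def by (intro finite_imageI fin) simp
  have finV: "finite (V e)" for e unfolding V_def using n by (intro finite_imageI fin) simp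
  have ZZ: "cell_count a n x h = card (Z x h)" for x h by (simp add: cell_count_def Z_def)
  have cU: "card (U k) \<le> window_count a n k" for k
    unfolding U_def ZZ by (intro card_image_le fin) simp
  have cV: "card (V e) \<le> cell_count a n (b e) (1 / real n)" for e
    unfolding V_def ZZ using n by (intro card_image_le fin) simp
  have "{x \<in> S. coeff_sum a n x = 0} \<subseteq> (\<Union>k\<in>{..K}. U k) \<union> (\<Union>e\<in>{..<8}. V e)"
  proof
    fix t assume "t \<in> {x \<in> S. coeff_sum a n x = 0}"
    then have t: "0 \<le> t" "t \<le> 1" "coeff_sum a n t = 0" using assms(3) by auto
    show "t \<in> (\<Union>k\<in>{..K}. U k) \<union> (\<Union>e\<in>{..<8}. V e)"
    proof (cases "t \<le> 1 - (7/8) ^ Suc K")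
      case True
      define k where "k = (LEAST k. t \<le> 1 - (7/8) ^ Suc k)"
      have k1: "t \<le> 1 - (7/8) ^ Suc k" unfolding k_def using True by (rule LeastI)
      have kK: "k \<le> K" unfolding k_def using True by (rule Least_le)
      have k0: "1 - (7/8) ^ k \<le> t"
      proof (cases k)
        case (Suc j)
        then have "j < (LEAST k. t \<le> 1 - (7/8) ^ Suc k)" by (simp add: k_def)
        then have "\<not> t \<le> 1 - (7/8) ^ Suc j" by (rule not_less_Least)
        then show ?thesis by (simp add: Suc)
      qed (use t in simp)
      define y where "y = (t - (1 - (7/8) ^ k)) / (7/8) ^ k"
      have ty: "t = (1 - (7/8) ^ k) + (7/8) ^ k * y" by (simp add: y_def)
      have "y \<in> {0..1/8}"
      proof -
        define q where "q = (7/8 :: real) ^ k"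
        have q: "q > 0" "1 - q \<le> t" "t \<le> 1 - 7/8 * q" using k0 k1 by (auto simp: q_def)
        have "0 \<le> (t - (1 - q)) / q" "(t - (1 - q)) / q \<le> 1/8"
          using q by (auto simp: pos_divide_le_eq)
        then show ?thesis by (simp add: y_def q_def)
      qed
      then have "y \<in> Z (1 - (7/8) ^ k) ((7/8) ^ k)"
        unfolding Z_def mem_Collect_eq poly_local_poly_coeff_sum ty[symmetric] using t by simp
      then have "t \<in> U k" unfolding U_def using ty by blast
      then show ?thesis using kK by auto
    next
      case False
      define s where "s = (t - (1 - (7/8) ^ Suc K)) * (8 * real n)"
      have s0: "0 \<le> s" using False n by (simp add: s_def)
      have "t - (1 - (7/8) ^ Suc K) < 1 / real n" using t assms(5) by linarith
      then have s8: "s < 8" using n by (simp add: s_def field_simps)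
      define e where "e = nat \<lfloor>s\<rfloor>"
      have e: "real e \<le> s" "s < real e + 1" using s0 by (auto simp: e_def)
      have e8: "e < 8" using s8 e by linarith
      have ts: "t = 1 - (7/8) ^ Suc K + s / (8 * real n)" using n by (simp add: s_def)
      have "real e / (8 * real n) \<le> s / (8 * real n)" using e n by (intro divide_right_mono) auto
      then have be: "b e = 1 - (7/8) ^ Suc K + real e / (8 * real n)" using t ts by (simp add: b_def)
      define y where "y = (s - real e) / 8"
      have ty: "t = b e + 1 / real n * y" unfolding be using ts by (simp add: y_def diff_divide_distrib)
      have "y \<in> {0..1/8}" using e by (simp add: y_def)
      then have "y \<in> Z (b e) (1 / real n)"
        unfolding Z_def mem_Collect_eq poly_local_poly_coeff_sum ty[symmetric] using t by simp
      then have "t \<in> V e" unfolding V_def using ty by blast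
      then show ?thesis using e8 by auto
    qed
  qed
  then have "root_count a n S \<le> card ((\<Union>k\<in>{..K}. U k) \<union> (\<Union>e\<in>{..<8}. V e))"
    using finU finV by (intro card_mono) auto
  also have "\<dots> \<le> card (\<Union>k\<in>{..K}. U k) + card (\<Union>e\<in>{..<8}. V e)" by (rule card_Un_le)
  also have "\<dots> \<le> (\<Sum>k\<in>{..K}. card (U k)) + (\<Sum>e\<in>{..<8}. card (V e))"
    by (intro add_mono card_UN_le) auto
  also have "\<dots> \<le> (\<Sum>k\<in>{..K}. window_count a n k) + (\<Sum>e\<in>{..<8}. cell_count a n (b e) (1 / real n))"
    by (intro add_mono sum_mono cU cV)
  finally show ?thesis by (simp add: b_def)
qed

text \<open>
  The spacing of the grid is \<open>1 / (8 L)\<close> in the local variable and the norm is below \<open>sqrt L\<close>. Hence two roots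
  between neighbouring grid points would make a value of size at most \<open>\<delta> / 8\<close>.
\<close>
lemma cell_count_le_near_changes:
  assumes L: "L > 0" and d: "\<delta> = 1 / (real L * sqrt (real L))"
    and big: "\<And>l. l \<le> L \<Longrightarrow> 2 * \<delta> < \<bar>poly (window_poly a n k) (real l / (8 * real L))\<bar>"
    and M: "coeff_norm (1/2) (window_poly a n k) < sqrt (real L)"
    and close: "\<And>l. l \<le> L \<Longrightarrow> \<bar>poly (window_poly a n k) (real l / (8 * real L)) - near_part a n L A k l\<bar> \<le> \<delta> / 2"
  shows "real (window_count a n k) \<le> near_changes a n L A \<delta> k"
proof -
  define p where "p = window_poly a n k"
  define y where "y = (\<lambda>l::nat. real l / (8 * real L))"
  have Lr: "real L > 0" using L by simp
  have d0: "\<delta> > 0" using Lr by (simp add: d)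
  have pL: "2 * \<delta> < \<bar>poly p (y l)\<bar>" if "l \<le> L" for l using big[OF that] by (simp add: p_def y_def)
  have p0: "p \<noteq> 0" using pL[of 0] d0 by auto
  have cov: "{t \<in> {0..1/8}. poly p t = 0} \<subseteq> (\<Union>l\<in>{..<L}. {t \<in> {y l..y (Suc l)}. poly p t = 0})"
  proof
    fix t assume t: "t \<in> {t \<in> {0..1/8}. poly p t = 0}"
    have "poly p (y L) \<noteq> 0" using pL[of L] d0 by auto
    moreover have "y L = 1/8" using Lr by (simp add: y_def)
    ultimately have t8: "t < 1/8" using t by (cases "t = 1/8") auto
    define l where "l = nat \<lfloor>t * (8 * real L)\<rfloor>"
    have l: "real l \<le> t * (8 * real L)" "t * (8 * real L) < real l + 1" using t Lr by (auto simp: l_def)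
    have "t * (8 * real L) < real L" using t8 Lr by simp
    then have "l < L" using l by linarith
    moreover have "y l \<le> t" "t \<le> y (Suc l)" using l Lr by (auto simp: y_def field_simps)
    ultimately show "t \<in> (\<Union>l\<in>{..<L}. {t \<in> {y l..y (Suc l)}. poly p t = 0})" using t by auto
  qed
  have finp: "finite {t \<in> X. poly p t = 0}" for X
    using poly_roots_finite[OF p0] by (rule rev_finite_subset) auto
  have "window_count a n k \<le> card (\<Union>l\<in>{..<L}. {t \<in> {y l..y (Suc l)}. poly p t = 0})"
    unfolding cell_count_def p_def[symmetric] by (intro card_mono finite_UN_I finp cov) auto
  also have "\<dots> \<le> (\<Sum>l\<in>{..<L}. card {t \<in> {y l..y (Suc l)}. poly p t = 0})"
    by (rule card_UN_le) simp
  finally have "real (window_count a n k) \<le> (\<Sum>l<L. real (card {t \<in> {y l..y (Suc l)}. poly p t = 0}))"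
    by (simp only: of_nat_sum[symmetric] of_nat_le_iff)
  also have "\<dots> \<le> near_changes a n L A \<delta> k"
    unfolding near_changes_def
  proof (rule sum_mono)
    fix l assume "l \<in> {..<L}"
    then have l: "l \<le> L" "Suc l \<le> L" by auto
    have step: "y (Suc l) - y l = 1 / (8 * real L)" by (simp add: y_def add_divide_distrib)
    have ylL: "y (Suc l) \<le> 1/8"
    proof -
      have "real (Suc l) \<le> real L" using l by linarith
      then show ?thesis using Lr by (simp add: y_def field_simps)
    qed
    have "8 * (y (Suc l) - y l)\<^sup>2 * coeff_norm (1/2) p \<le> 8 * (1 / (8 * real L))\<^sup>2 * sqrt (real L)"
      unfolding step using M by (intro mult_left_mono) (auto simp: p_def)
    also have "\<dots> = \<delta> / 8"
    proof -
      have "sqrt (real L) / (real L)\<^sup>2 = 1 / (real L * sqrt (real L))"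
        using Lr by (simp add: field_simps power2_eq_square)
      moreover have "8 * (1 / (8 * real L))\<^sup>2 * sqrt (real L) = sqrt (real L) / (real L)\<^sup>2 / 8"
        using Lr by (simp add: power2_eq_square field_simps)
      ultimately show ?thesis by (simp add: d)
    qed
    also have "\<dots> < \<bar>poly p (y l)\<bar>" using pL[OF l(1)] d0 by linarith
    finally have "card {t \<in> {y l..y (Suc l)}. poly p t = 0} \<le> (if poly p (y l) * poly p (y (Suc l)) < 0 then 1 else 0)"
      using pL[OF l(2)] d0 Lr ylL by (intro at_most_one_root_of_large_value) (auto simp: y_def divide_strict_right_mono)
    moreover have "\<delta> \<le> \<bar>near_part a n L A k l\<bar> \<and> \<delta> \<le> \<bar>near_part a n L A k (Suc l)\<bar> \<and> near_part a n L A k l * near_part a n L A k (Suc l) < 0"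
      if sc: "poly p (y l) * poly p (y (Suc l)) < 0"
    proof -
      have c: "\<bar>poly p (y l) - near_part a n L A k l\<bar> \<le> \<delta> / 2" "\<bar>poly p (y (Suc l)) - near_part a n L A k (Suc l)\<bar> \<le> \<delta> / 2"
        using close[OF l(1)] close[OF l(2)] by (simp_all add: p_def y_def)
      have b: "2 * \<delta> < \<bar>poly p (y l)\<bar>" "2 * \<delta> < \<bar>poly p (y (Suc l))\<bar>" using pL l by auto
      from sc consider "poly p (y l) < 0" "0 < poly p (y (Suc l))" | "0 < poly p (y l)" "poly p (y (Suc l)) < 0"
        by (auto simp: mult_less_0_iff)
      then show ?thesis
      proof cases
        case 1
        then have "near_part a n L A k l \<le> - \<delta>" "\<delta> \<le> near_part a n L A k (Suc l)" using b c d0 by linarith+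
        then show ?thesis using d0 by (auto simp: mult_less_0_iff)
      next
        case 2
        then have "\<delta> \<le> near_part a n L A k l" "near_part a n L A k (Suc l) \<le> - \<delta>" using b c d0 by linarith+
        then show ?thesis using d0 by (auto simp: mult_less_0_iff)
      qed
    qed
    ultimately show "real (card {t \<in> {y l..y (Suc l)}. poly p t = 0})
      \<le> (if \<delta> \<le> \<bar>near_part a n L A k l\<bar> \<and> \<delta> \<le> \<bar>near_part a n L A k (Suc l)\<bar>
          \<and> near_part a n L A k l * near_part a n L A k (Suc l) < 0 then 1 else 0)"
      by (auto split: if_splits)
  qed
  finally show ?thesis .
qed

text \<open>
  In a window without distant disturbance every counted sign change gives a root, and roots from different pairs of
  grid points are different. A disturbed window loses at most \<open>L\<close> counts.
\<close>
lemma near_changes_le_card_roots: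
  assumes L: "L > 0" and d: "\<delta> > 0" and w: "w > 0" "2 * w / (1 - decay) < \<delta>" and W: "finite W"
    and S: "{0<..<1} \<subseteq> S"
  shows "(\<Sum>k\<in>W. near_changes a n L A \<delta> k) - real L * (\<Sum>b\<le>index_scale n. far_count a n L A w W b)
    \<le> real (root_count a n S)"
proof -
  define F where "F = (\<lambda>k. \<exists>b\<le>index_scale n. A \<le> gap k b \<and> far_large a n L w k b)"
  define c where "c = (\<lambda>k l. \<delta> \<le> \<bar>near_part a n L A k l\<bar> \<and> \<delta> \<le> \<bar>near_part a n L A k (Suc l)\<bar>
     \<and> near_part a n L A k l * near_part a n L A k (Suc l) < 0)"
  \<comment> \<open>The counted sign changes in undisturbed windows.\<close>
  define P where "P = (SIGMA k:{k \<in> W. \<not> F k}. {l. l < L \<and> c k l})"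
  have finP: "finite P" unfolding P_def using W by (intro finite_SigmaI) auto
  have nc: "near_changes a n L A \<delta> k = real (card {l. l < L \<and> c k l})" for k
  proof -
    have "near_changes a n L A \<delta> k = (\<Sum>l\<in>{l \<in> {..<L}. c k l}. 1)"
      unfolding near_changes_def c_def by (rule sum.inter_filter[symmetric]) simp
    also have "{l \<in> {..<L}. c k l} = {l. l < L \<and> c k l}" by auto
    finally show ?thesis by simp
  qed
  have "\<exists>r. grid_pt L k l < r \<and> r < grid_pt L k (Suc l) \<and> coeff_sum a n r = 0" if kl: "(k, l) \<in> P" for k l
  proof -
    have k: "\<not> F k" and l: "l \<le> L" "Suc l \<le> L" and ckl: "c k l" using kl by (auto simp: P_def)
    have q: "(7/8 :: real) ^ k > 0" by simp
    have g: "poly (window_poly a n k) (real j / (8 * real L)) = sqrt ((7/8) ^ k) * coeff_sum a n (grid_pt L k j)" for j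
      by (simp add: poly_local_poly_coeff_sum grid_pt_def)
    have cl: "\<bar>poly (window_poly a n k) (real j / (8 * real L)) - near_part a n L A k j\<bar> < \<delta>" if "j \<le> L" for j
      using near_part_close[OF w(1) that, of n A k a] k w(2) by (force simp: F_def)
    define u v where "u = coeff_sum a n (grid_pt L k l)" and "v = coeff_sum a n (grid_pt L k (Suc l))"
    have uv: "\<bar>sqrt ((7/8) ^ k) * u - near_part a n L A k l\<bar> < \<delta>" "\<bar>sqrt ((7/8) ^ k) * v - near_part a n L A k (Suc l)\<bar> < \<delta>"
      using cl[OF l(1)] cl[OF l(2)] by (simp_all only: g u_def v_def)
    have s: "sqrt ((7/8) ^ k) > 0" using q by simp
    have uv0: "u < 0 \<and> 0 < v \<or> 0 < u \<and> v < 0"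
    proof (cases "near_part a n L A k l < 0")
      case True
      then have "0 < near_part a n L A k (Suc l)" using ckl by (auto simp: c_def mult_less_0_iff)
      then have "sqrt ((7/8) ^ k) * u < 0" "0 < sqrt ((7/8) ^ k) * v" using True uv ckl unfolding c_def by linarith+
      then show ?thesis using s by (simp add: mult_less_0_iff zero_less_mult_iff)
    next
      case False
      then have n0: "near_part a n L A k (Suc l) < 0" using ckl by (auto simp: c_def mult_less_0_iff)
      then have "0 < sqrt ((7/8) ^ k) * u" "sqrt ((7/8) ^ k) * v < 0" using False uv ckl unfolding c_def by linarith+
      then show ?thesis using s by (simp add: mult_less_0_iff zero_less_mult_iff)
    qed
    have lt: "grid_pt L k l < grid_pt L k (Suc l)" by (rule grid_pt_strict_mono[OF L]) simp
    have pl: "poly (local_poly a n 0 1) t = coeff_sum a n t" for t by (simp add: poly_local_poly_coeff_sum)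
    from uv0 show ?thesis
    proof
      assume "u < 0 \<and> 0 < v"
      then show ?thesis using poly_IVT_pos[OF lt, of "local_poly a n 0 1"] by (auto simp: pl u_def v_def)
    next
      assume "0 < u \<and> v < 0"
      then show ?thesis using poly_IVT_neg[OF lt, of "local_poly a n 0 1"] by (auto simp: pl u_def v_def)
    qed
  qed
  then have ex: "\<exists>r. grid_pt L (fst z) (snd z) < r \<and> r < grid_pt L (fst z) (Suc (snd z)) \<and> coeff_sum a n r = 0"
    if "z \<in> P" for z using that by (cases z) auto
  define root where "root = (\<lambda>z. SOME r. grid_pt L (fst z) (snd z) < r \<and> r < grid_pt L (fst z) (Suc (snd z)) \<and> coeff_sum a n r = 0)"
  have root: "grid_pt L k l < root (k, l) \<and> root (k, l) < grid_pt L k (Suc l) \<and> coeff_sum a n (root (k, l)) = 0"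
    if "(k, l) \<in> P" for k l
    using someI_ex[OF ex[OF that]] by (simp add: root_def)
  have gmono: "grid_pt L k (Suc l) \<le> grid_pt L k' l'" if "(k, l) \<in> P" "(k', l') \<in> P" "k < k' \<or> k = k' \<and> l < l'" for k l k' l'
  proof (cases "k < k'")
    case True
    have "grid_pt L k (Suc l) \<le> 1 - (7/8) ^ Suc k" using that L by (intro grid_pt_bounds) (auto simp: P_def)
    also have "\<dots> \<le> 1 - (7/8) ^ k'" using True power_decreasing[of "Suc k" k' "7/8 :: real"] by simp
    also have "\<dots> \<le> grid_pt L k' l'" using that L by (intro grid_pt_bounds) (auto simp: P_def)
    finally show ?thesis .
  next
    case False
    then have "k' = k" "Suc l \<le> l'" using that by auto
    then show ?thesis using grid_pt_strict_mono[OF L, of "Suc l" l' k] by (cases "Suc l = l'") auto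
  qed
  have neq: "root (k, l) \<noteq> root (k', l')" if "(k, l) \<in> P" "(k', l') \<in> P" "k < k' \<or> k = k' \<and> l < l'" for k l k' l'
    using gmono[OF that] root[OF that(1)] root[OF that(2)] by linarith
  have inj: "inj_on root P"
  proof (rule inj_onI)
    fix x y assume xy: "x \<in> P" "y \<in> P" "root x = root y"
    obtain k l k' l' where e: "x = (k, l)" "y = (k', l')" by (cases x; cases y) auto
    show "x = y"
      using neq[of k l k' l'] neq[of k' l' k l] xy unfolding e by (metis linorder_neqE_nat)
  qed
  have img: "root ` P \<subseteq> {x \<in> S. coeff_sum a n x = 0}"
  proof
    fix t assume "t \<in> root ` P"
    then obtain k l where kl: "(k, l) \<in> P" "t = root (k, l)" by auto
    have "0 \<le> grid_pt L k l" "grid_pt L k (Suc l) \<le> 1"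
      using kl L by (auto simp: P_def intro!: grid_pt_bounds)
    then show "t \<in> {x \<in> S. coeff_sum a n x = 0}" using root[OF kl(1)] S kl(2) by force
  qed
  have cardP: "card P \<le> root_count a n S"
  proof (cases "P = {}")
    case False
    then obtain k l where kl: "(k, l) \<in> P" by auto
    have "\<exists>t. coeff_sum a n t \<noteq> 0"
    proof (rule ccontr)
      assume "\<not> ?thesis"
      then have z: "coeff_sum a n t = 0" for t by simp
      have k: "\<not> F k" and l: "l \<le> L" and ckl: "c k l" using kl by (auto simp: P_def)
      have "\<bar>poly (window_poly a n k) (real l / (8 * real L)) - near_part a n L A k l\<bar> < \<delta>"
        using near_part_close[OF w(1) l, of n A k a] k w(2) by (force simp: F_def)
      then show False using ckl by (simp add: poly_local_poly_coeff_sum z c_def)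
    qed
    then obtain t where "coeff_sum a n t \<noteq> 0" by blast
    then have "finite {x \<in> S. coeff_sum a n x = 0}" using finite_roots_coeff_sum by (auto intro: rev_finite_subset)
    then show ?thesis using inj img by (intro card_inj_on_le)
  qed simp
  have "(\<Sum>k\<in>W. near_changes a n L A \<delta> k) \<le> (\<Sum>k\<in>W. (if F k then 0 else real (card {l. l < L \<and> c k l})) + real L * (if F k then 1 else 0))"
    using near_changes_bounds(2)[of a n L A \<delta>] by (intro sum_mono) (auto simp: nc)
  also have "\<dots> = (\<Sum>k\<in>W. if F k then 0 else real (card {l. l < L \<and> c k l})) + real L * (\<Sum>k\<in>W. if F k then 1 else 0)"
    by (simp add: sum.distrib sum_distrib_left)
  also have "(\<Sum>k\<in>W. if F k then 0 else real (card {l. l < L \<and> c k l})) = real (card P)"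
  proof -
    have "card P = (\<Sum>k\<in>{k \<in> W. \<not> F k}. card {l. l < L \<and> c k l})"
      unfolding P_def using W by (intro card_SigmaI) auto
    then have "real (card P) = (\<Sum>k\<in>{k \<in> W. \<not> F k}. real (card {l. l < L \<and> c k l}))" by simp
    also have "\<dots> = (\<Sum>k\<in>W. if \<not> F k then real (card {l. l < L \<and> c k l}) else 0)"
      by (rule sum.inter_filter) (rule W)
    finally show ?thesis by (simp add: if_not_P cong: if_cong) (metis (full_types))
  qed
  also have "(\<Sum>k\<in>W. if F k then 1 else 0) \<le> (\<Sum>k\<in>W. \<Sum>b\<in>{b \<in> {..index_scale n}. A \<le> gap k b}. if far_large a n L w k b then 1 else (0::real))"
  proof (rule sum_mono)
    fix k
    show "(if F k then 1 else 0) \<le> (\<Sum>b\<in>{b \<in> {..index_scale n}. A \<le> gap k b}. if far_large a n L w k b then 1 else (0::real))"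
    proof (cases "F k")
      case True
      then obtain b where b: "b \<le> index_scale n" "A \<le> gap k b" "far_large a n L w k b" by (auto simp: F_def)
      have "(if far_large a n L w k b then 1 else (0::real)) \<le> (\<Sum>b\<in>{b \<in> {..index_scale n}. A \<le> gap k b}. if far_large a n L w k b then 1 else (0::real))"
        using b by (intro member_le_sum) auto
      then show ?thesis using True b by simp
    qed (auto intro!: sum_nonneg)
  qed
  also have "\<dots> = (\<Sum>b\<in>{..index_scale n}. \<Sum>k\<in>{k \<in> W. A \<le> gap k b}. if far_large a n L w k b then 1 else (0::real))"
    using W by (intro sum.swap_restrict) auto
  also have "\<dots> = (\<Sum>b\<le>index_scale n. far_count a n L A w W b)" by (simp add: far_count_def)
  finally have "(\<Sum>k\<in>W. near_changes a n L A \<delta> k) \<le> real (card P) + real L * (\<Sum>b\<le>index_scale n. far_count a n L A w W b)"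
    by (simp add: mult_left_mono)
  then show ?thesis using cardP by linarith
qed

section \<open>The mean number of roots\<close>

text \<open>
  The lower deviation bound in certificate form, with an integrable majorant \<open>G\<close> in place of the mean of \<open>N\<close> and an
  event \<open>E\<close> in place of the deviation set. In this form it is stable under sums and bounded perturbations, and it
  makes sense without measurability of \<open>N\<close>.
\<close>
definition lower_conc :: "'a measure \<Rightarrow> ('a \<Rightarrow> real) \<Rightarrow> real \<Rightarrow> real \<Rightarrow> bool" where
  "lower_conc M N t p \<longleftrightarrow> (\<exists>\<mu> G E. integrable M G \<and> integral\<^sup>L M G \<le> \<mu> \<and> (\<forall>\<omega>\<in>space M. N \<omega> \<le> G \<omega>)
     \<and> E \<in> sets M \<and> {\<omega> \<in> space M. N \<omega> \<le> \<mu> - t} \<subseteq> E \<and> measure M E \<le> p)"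

lemma sum_inverse_squares_le:
  assumes "R \<ge> 1"
  shows "(\<Sum>r\<in>{R<..n}. 1 / (real r)\<^sup>2) \<le> 1 / real R"
proof (cases "R \<le> n")
  case True
  then have "(\<Sum>r\<in>{R<..n}. 1 / (real r)\<^sup>2) \<le> 1 / real R - 1 / real n"
  proof (induction n rule: dec_induct)
    case base
    then show ?case by simp
  next
    case (step n)
    have n: "real n > 0" using step assms by simp
    have "{R<..Suc n} = insert (Suc n) {R<..n}" using step by auto
    then have "(\<Sum>r\<in>{R<..Suc n}. 1 / (real r)\<^sup>2) = 1 / (real (Suc n))\<^sup>2 + (\<Sum>r\<in>{R<..n}. 1 / (real r)\<^sup>2)" by simp
    also have "1 / (real (Suc n))\<^sup>2 \<le> 1 / (real n * real (Suc n))"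
      unfolding power2_eq_square using n by (intro divide_left_mono mult_right_mono mult_pos_pos) auto
    also have "\<dots> = 1 / real n - 1 / real (Suc n)" using n by (simp add: field_simps)
    finally show ?case using step by simp
  qed
  then show ?thesis by (smt (verit) divide_nonneg_nonneg of_nat_0_le_iff)
next
  case False
  then show ?thesis using assms by simp
qed

lemma sum_inverse_squares_le_2: "(\<Sum>r\<in>{0<..n}. 1 / (real r)\<^sup>2) \<le> 2"
proof (cases n)
  case (Suc m)
  have "{0<..n} = insert 1 {1<..n}" using Suc by auto
  then have "(\<Sum>r\<in>{0<..n}. 1 / (real r)\<^sup>2) = 1 + (\<Sum>r\<in>{1<..n}. 1 / (real r)\<^sup>2)" by simp
  then show ?thesis using sum_inverse_squares_le[of 1 n] by simp
qed simp

lemma nat_eq_sum_thresholds: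
  assumes "N \<le> n"
  shows "real N = (\<Sum>r\<in>{0<..n}. if r \<le> N then 1 else 0)"
    and "real N \<le> real R + (\<Sum>r\<in>{R<..n}. if r \<le> N then 1 else 0)"
proof -
  have a: "(\<Sum>r\<in>{R<..n}. if r \<le> N then 1 else (0::real)) = real (N - R)" for R
  proof -
    have "(\<Sum>r\<in>{R<..n}. if r \<le> N then 1 else (0::real)) = (\<Sum>r\<in>{r \<in> {R<..n}. r \<le> N}. 1)"
      by (rule sum.inter_filter[symmetric]) simp
    also have "{r \<in> {R<..n}. r \<le> N} = {R<..N}" using assms by auto
    finally show ?thesis by simp
  qed
  show "real N = (\<Sum>r\<in>{0<..n}. if r \<le> N then 1 else 0)" by (simp add: a)
  show "real N \<le> real R + (\<Sum>r\<in>{R<..n}. if r \<le> N then 1 else 0)" unfolding a by linarith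
qed

context random_coeffs
begin

lemma cell_count_le_root_events:
  assumes "\<omega> \<in> space M" "local_rpoly n x h \<omega> \<noteq> 0"
  shows "real (cell_count (sample \<omega>) n x h) \<le> (\<Sum>r\<in>{0<..n}. indicat_real (root_event M \<xi> n x h r) \<omega>)"
    and "real (cell_count (sample \<omega>) n x h) \<le> real R + (\<Sum>r\<in>{R<..n}. indicat_real (root_event M \<xi> n x h r) \<omega>)"
proof -
  define N where "N = cell_count (sample \<omega>) n x h"
  have N: "N \<le> n" unfolding N_def by (rule cell_count_le_degree[OF assms(2)])
  have le: "(if r \<le> N then 1 else 0) \<le> indicat_real (root_event M \<xi> n x h r) \<omega>" for r
    using coeff_small_of_cell_count[OF _ assms(2), of r] assms(1)
    by (auto simp: N_def root_event_def indicator_def)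
  have "real N \<le> (\<Sum>r\<in>{0<..n}. indicat_real (root_event M \<xi> n x h r) \<omega>)"
    unfolding nat_eq_sum_thresholds(1)[OF N] by (intro sum_mono le)
  moreover have "real N \<le> real R + (\<Sum>r\<in>{R<..n}. indicat_real (root_event M \<xi> n x h r) \<omega>)"
    by (rule order_trans[OF nat_eq_sum_thresholds(2)[OF N, of R]]) (intro add_left_mono sum_mono le)
  ultimately show "real (cell_count (sample \<omega>) n x h) \<le> (\<Sum>r\<in>{0<..n}. indicat_real (root_event M \<xi> n x h r) \<omega>)"
    "real (cell_count (sample \<omega>) n x h) \<le> real R + (\<Sum>r\<in>{R<..n}. indicat_real (root_event M \<xi> n x h r) \<omega>)"
    by (simp_all add: N_def)
qed

abbreviation window_event :: "nat \<Rightarrow> nat \<Rightarrow> nat \<Rightarrow> 'a set" where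
  "window_event n k r \<equiv> root_event M \<xi> n (1 - (7/8) ^ k) ((7/8) ^ k) r"

text \<open>
  Outside this event the hypotheses of \<open>cell_count_le_near_changes\<close> hold.
\<close>
definition bad_event :: "nat \<Rightarrow> nat \<Rightarrow> nat \<Rightarrow> real \<Rightarrow> real \<Rightarrow> nat \<Rightarrow> 'a set" where
  "bad_event n L A \<delta> w k = {\<omega> \<in> space M.
     (\<exists>l\<le>L. \<bar>poly (window_poly (sample \<omega>) n k) (real l / (8 * real L))\<bar> \<le> 2 * \<delta>)
     \<or> sqrt (real L) \<le> coeff_norm (1/2) (window_poly (sample \<omega>) n k)
     \<or> (\<exists>b\<le>index_scale n. A \<le> gap k b \<and> far_large (sample \<omega>) n L w k b)}"

lemma bad_event_measurable [measurable]: "bad_event n L A \<delta> w k \<in> events"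
  unfolding bad_event_def by measurable

lemma window_admissible:
  assumes "n \<ge> 1" "1 / real n \<le> (7/8) ^ k"
  shows "admissible n (1 - (7/8) ^ k) ((7/8) ^ k)"
  using assms by (auto simp: admissible_def power_le_one)

lemma prob_bad_event_le:
  assumes "n \<ge> 1" "1 / real n \<le> (7/8) ^ k" "L > 0" "\<delta> = 1 / (real L * sqrt (real L))" "w > 0"
  defines "C1 \<equiv> exp (1/2) * (4 + 1 / u\<^sub>0\<^sup>2)"
  shows "prob (bad_event n L A \<delta> w k) \<le> (4 * C1 + 3) / sqrt (real L) + (real L + 1) * C1 * decay ^ k + far_rate L A w"
proof -
  note adm = window_admissible[OF assms(1,2)]
  have Lr: "real L \<ge> 1" using assms by simp
  have d0: "\<delta> > 0" using Lr by (simp add: assms(4))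
  have C1: "C1 > 0" unfolding C1_def by (intro mult_pos_pos add_pos_nonneg) auto
  define S where "S = (\<lambda>l. {\<omega> \<in> space M. \<bar>poly (window_poly (sample \<omega>) n k) (real l / (8 * real L))\<bar> \<le> 2 * \<delta>})"
  define T where "T = {\<omega> \<in> space M. sqrt (real L) \<le> coeff_norm (1/2) (window_poly (sample \<omega>) n k)}"
  define U where "U = (\<lambda>b. (far_event n L w k b))"
  define B where "B = {b \<in> {..index_scale n}. A \<le> gap k b}"
  have [measurable]: "S l \<in> events" "T \<in> events" "U b \<in> events" for l b
    unfolding S_def T_def U_def by measurable
  have "bad_event n L A \<delta> w k \<subseteq> (\<Union>l\<in>{..L}. S l) \<union> T \<union> (\<Union>b\<in>B. U b)"
    by (auto simp: bad_event_def S_def T_def U_def B_def)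
  then have "prob (bad_event n L A \<delta> w k) \<le> prob ((\<Union>l\<in>{..L}. S l) \<union> T \<union> (\<Union>b\<in>B. U b))"
    by (rule finite_measure_mono) (auto simp: B_def)
  also have "\<dots> \<le> prob (\<Union>l\<in>{..L}. S l) + prob T + prob (\<Union>b\<in>B. U b)"
    by (intro order_trans[OF measure_Un_le] add_right_mono measure_Un_le) (auto simp: B_def)
  also have "\<dots> \<le> (\<Sum>l\<in>{..L}. prob (S l)) + prob T + (\<Sum>b\<in>B. prob (U b))"
    by (intro add_mono order_refl finite_measure_subadditive_finite) (auto simp: B_def)
  also have "\<dots> \<le> (\<Sum>l\<in>{..L}. C1 * (2 * \<delta> + decay ^ k)) + 3 / sqrt (real L) + far_rate L A w"
  proof (intro add_mono sum_mono)
    fix l assume "l \<in> {..L}"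
    then have l: "real l \<le> real L" by simp
    have f: "real l / (8 * real L) \<le> 1/8" using l Lr by (simp add: field_simps)
    have "(7/8 :: real) ^ k * (real l / (8 * real L)) \<le> (7/8) ^ k * 1"
      using f by (intro mult_left_mono) auto
    then have "prob (S l) \<le> C1 * (2 * \<delta> + ((7/8) ^ k) powr (1/4))"
      unfolding S_def C1_def using d0 by (intro small_ball_local adm) auto
    also have "((7/8 :: real) ^ k) powr (1/4) = decay ^ k"
      by (simp add: decay_def powr_powr mult.commute flip: powr_realpow)
    finally show "prob (S l) \<le> C1 * (2 * \<delta> + decay ^ k)" .
  next
    show "prob T \<le> 3 / sqrt (real L)" unfolding T_def using Lr by (intro local_norm_markov adm) auto
    show "(\<Sum>b\<in>B. prob (U b)) \<le> far_rate L A w"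
      unfolding B_def U_def using assms by (intro sum_prob_far_large_le) auto
  qed
  also have "(\<Sum>l\<in>{..L}. C1 * (2 * \<delta> + decay ^ k)) = C1 * ((real L + 1) * (2 * \<delta>)) + (real L + 1) * C1 * decay ^ k"
    by (simp add: algebra_simps)
  also have "C1 * ((real L + 1) * (2 * \<delta>)) \<le> C1 * (4 / sqrt (real L))"
  proof (rule mult_left_mono)
    have "(real L + 1) * (2 * \<delta>) \<le> (2 * real L) * (2 * \<delta>)"
      using Lr d0 by (intro mult_right_mono) auto
    also have "\<dots> = 4 / sqrt (real L)" using Lr by (simp add: assms(4))
    finally show "(real L + 1) * (2 * \<delta>) \<le> 4 / sqrt (real L)" .
  qed (use C1 in simp)
  finally show ?thesis by (simp add: add_divide_distrib algebra_simps)
qed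

lemma cell_count_le_of_window:
  assumes "\<omega> \<in> space M" "window_poly (sample \<omega>) n k \<noteq> 0"
    and "L > 0" "\<delta> = 1 / (real L * sqrt (real L))" "w > 0" "2 * w / (1 - decay) \<le> \<delta> / 2"
  shows "real (window_count (sample \<omega>) n k)
    \<le> near_changes (sample \<omega>) n L A \<delta> k + real R * indicat_real (bad_event n L A \<delta> w k) \<omega>
      + (\<Sum>r\<in>{R<..n}. indicat_real (window_event n k r) \<omega>)"
proof (cases "\<omega> \<in> bad_event n L A \<delta> w k")
  case True
  then show ?thesis
    using cell_count_le_root_events(2)[OF assms(1,2), of R] near_changes_bounds(1)[of "\<lambda>i. \<xi> i \<omega>" n L A \<delta> k] by simp
next
  case False
  have "real (window_count (sample \<omega>) n k) \<le> near_changes (sample \<omega>) n L A \<delta> k"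
  proof (rule cell_count_le_near_changes[OF assms(3,4)])
    fix l assume l: "l \<le> L"
    show "2 * \<delta> < \<bar>poly (window_poly (sample \<omega>) n k) (real l / (8 * real L))\<bar>"
    proof (rule ccontr)
      assume "\<not> ?thesis"
      then have "\<omega> \<in> bad_event n L A \<delta> w k"
        using l assms(1) by (auto simp: bad_event_def not_less)
      with False show False ..
    qed
    show "\<bar>poly (window_poly (sample \<omega>) n k) (real l / (8 * real L)) - near_part (sample \<omega>) n L A k l\<bar> \<le> \<delta> / 2"
      by (rule order_trans[OF near_part_close[OF assms(5) l] assms(6)])
        (use False assms(1) in \<open>auto simp: bad_event_def\<close>)
  next
    show "coeff_norm (1/2) (window_poly (sample \<omega>) n k) < sqrt (real L)"
      using False assms(1) by (auto simp: bad_event_def not_le)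
  qed
  moreover have "0 \<le> (\<Sum>r\<in>{R<..n}. indicat_real (window_event n k r) \<omega>)"
    by (intro sum_nonneg) auto
  ultimately show ?thesis using False by simp
qed

text \<open>
  The windows before the \<open>k0\<close>-th and the last eight cells contribute a bounded amount by the tail bound. In the other
  windows the truncated sign changes suffice, except on the bad event, where up to \<open>R\<close> roots are paid by the
  probability of that event and the remaining ones by the tail bound.
\<close>
lemma num_roots_dominated:
  fixes n L A k0 R :: nat and \<delta> w Ct P :: real and S :: "real set"
  assumes n: "n \<ge> 2" and L: "L > 0" and d: "\<delta> = 1 / (real L * sqrt (real L))"
    and w: "w > 0" "2 * w / (1 - decay) \<le> \<delta> / 2" and R: "R \<ge> 1"
    and Ct: "Ct > 0" "\<And>x h r. admissible n x h \<Longrightarrow> 1 \<le> r \<Longrightarrow> r \<le> n \<Longrightarrow> prob (root_event M \<xi> n x h r) \<le> Ct / (real r)\<^sup>2"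
    and P: "\<And>k. k0 \<le> k \<Longrightarrow> 1 / real n \<le> (7/8) ^ k \<Longrightarrow> prob (bad_event n L A \<delta> w k) \<le> P" and P0: "P \<ge> 0"
    and S: "infinite S" "S \<subseteq> {0..1}"
  defines "W \<equiv> {k0..index_scale (n - 1)}"
  shows "\<exists>G. integrable M G \<and> expectation G \<le> (\<Sum>k\<in>W. expectation (\<lambda>\<omega>. near_changes (sample \<omega>) n L A \<delta> k))
      + 18 * ln (real n) * (real R * P + Ct / real R) + 2 * Ct * (real k0 + 8)
    \<and> (\<forall>\<omega>\<in>space M. real (root_count (sample \<omega>) n S) \<le> G \<omega>)"
proof -
  define K where "K = index_scale (n - 1)"
  have K: "1 / real n \<le> (7/8) ^ K" "(7/8) ^ Suc K < 1 / real n"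
    using index_scale_bounds[of "n - 1"] n by (simp_all add: K_def of_nat_diff)
  have kK: "1 / real n \<le> (7/8) ^ k" if "k \<le> K" for k
    by (rule order_trans[OF K(1) power_decreasing]) (use that in auto)
  define V where "V = {k. k < k0 \<and> k \<le> K}"
  have VW: "{..K} = V \<union> W" "V \<inter> W = {}" "finite V" "finite W" by (auto simp: V_def W_def K_def)
  have cV: "real (card V) \<le> real k0"
    using card_mono[of "{..<k0}" V] by (auto simp: V_def)
  have cW: "real (card W) \<le> 18 * ln (real n)"
  proof -
    have "card W \<le> card {..K}" by (rule card_mono) (auto simp: W_def K_def)
    also have "\<dots> \<le> index_scale n + 1" by (simp add: K_def index_scale_mono)
    finally have "real (card W) \<le> real (index_scale n) + 1" by linarith
    then show ?thesis using index_scale_le_log[OF n] by linarith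
  qed
  define xe where "xe = (\<lambda>e::nat. min 1 (1 - (7/8) ^ Suc K + real e / (8 * real n)))"
  have nr: "real n > 0" using n by simp
  have adm_e: "admissible n (xe e) (1 / real n)" for e
  proof -
    have "0 \<le> real e / (8 * real n)" by simp
    then have "1 - 1 / real n \<le> 1 - (7/8) ^ Suc K + real e / (8 * real n)" using K(2) by linarith
    then have "1 - 1 / real n \<le> xe e" unfolding xe_def min.bounded_iff by simp
    then show ?thesis using n by (auto simp: admissible_def xe_def)
  qed
  have adm_k: "admissible n (1 - (7/8) ^ k) ((7/8) ^ k)" if "k \<le> K" for k
    using window_admissible[OF _ kK[OF that]] n by simp
  define I where "I = (\<lambda>x h r \<omega>. indicat_real (root_event M \<xi> n x h r) \<omega>)"
  have iI: "integrable M (I x h r)" and eI: "expectation (I x h r) = prob (root_event M \<xi> n x h r)" for x h r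
    unfolding I_def by (auto intro!: integrable_real_indicator simp: emeasure_eq_measure)
  define J where "J = (\<lambda>k \<omega>. indicat_real (bad_event n L A \<delta> w k) \<omega>)"
  have iJ: "integrable M (J k)" and eJ: "expectation (J k) = prob (bad_event n L A \<delta> w k)" for k
    unfolding J_def by (auto intro!: integrable_real_indicator simp: emeasure_eq_measure)
  define X where "X = (\<lambda>k \<omega>. near_changes (sample \<omega>) n L A \<delta> k)"
  have iX: "integrable M (X k)" for k
    unfolding X_def by (rule integrable_const_bound[where B="real L"]) (auto simp: near_changes_bounds)
  define G1 where "G1 = (\<lambda>k \<omega>. \<Sum>r\<in>{0<..n}. I (1 - (7/8) ^ k) ((7/8) ^ k) r \<omega>)"
  define G2 where "G2 = (\<lambda>k \<omega>. X k \<omega> + real R * J k \<omega> + (\<Sum>r\<in>{R<..n}. I (1 - (7/8) ^ k) ((7/8) ^ k) r \<omega>))"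
  define G3 where "G3 = (\<lambda>e \<omega>. \<Sum>r\<in>{0<..n}. I (xe e) (1 / real n) r \<omega>)"
  have i1: "integrable M (G1 k)" and i2: "integrable M (G2 k)" and i3: "integrable M (G3 e)" for k e
    unfolding G1_def G2_def G3_def using iI iJ iX by auto
  have total: "(\<Sum>r\<in>{0<..n}. expectation (I x h r)) \<le> 2 * Ct" if "admissible n x h" for x h
  proof -
    have "(\<Sum>r\<in>{0<..n}. expectation (I x h r)) \<le> (\<Sum>r\<in>{0<..n}. Ct * (1 / (real r)\<^sup>2))"
      using Ct(2)[OF that] by (intro sum_mono) (auto simp: eI)
    also have "\<dots> = Ct * (\<Sum>r\<in>{0<..n}. 1 / (real r)\<^sup>2)" by (rule sum_distrib_left[symmetric])
    also have "\<dots> \<le> Ct * 2" using Ct(1) by (intro mult_left_mono sum_inverse_squares_le_2) auto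
    finally show ?thesis by simp
  qed
  have tail: "(\<Sum>r\<in>{R<..n}. expectation (I x h r)) \<le> Ct / real R" if "admissible n x h" for x h
  proof -
    have "(\<Sum>r\<in>{R<..n}. expectation (I x h r)) \<le> (\<Sum>r\<in>{R<..n}. Ct * (1 / (real r)\<^sup>2))"
      using Ct(2)[OF that] by (intro sum_mono) (auto simp: eI)
    also have "\<dots> = Ct * (\<Sum>r\<in>{R<..n}. 1 / (real r)\<^sup>2)" by (rule sum_distrib_left[symmetric])
    also have "\<dots> \<le> Ct * (1 / real R)" using Ct(1) R by (intro mult_left_mono sum_inverse_squares_le) auto
    finally show ?thesis by simp
  qed
  have e1: "expectation (G1 k) \<le> 2 * Ct" if "k \<in> V" for k
    unfolding G1_def using total[OF adm_k, of k] that iI by (simp add: V_def)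
  have e3: "expectation (G3 e) \<le> 2 * Ct" for e
    unfolding G3_def using total[OF adm_e] iI by simp
  have e2: "expectation (G2 k) \<le> expectation (X k) + (real R * P + Ct / real R)" if "k \<in> W" for k
  proof -
    have k: "k0 \<le> k" "k \<le> K" using that by (auto simp: W_def K_def)
    have "expectation (G2 k) = expectation (X k) + real R * expectation (J k)
        + (\<Sum>r\<in>{R<..n}. expectation (I (1 - (7/8) ^ k) ((7/8) ^ k) r))"
      unfolding G2_def using iI iJ iX by simp
    also have "\<dots> \<le> expectation (X k) + real R * P + Ct / real R"
      unfolding eJ using tail[OF adm_k[OF k(2)]] P[OF k(1) kK[OF k(2)]]
      by (intro add_mono mult_left_mono) auto
    finally show ?thesis by simp
  qed
  define G where "G = (\<lambda>\<omega>. (\<Sum>k\<in>V. G1 k \<omega>) + (\<Sum>k\<in>W. G2 k \<omega>) + (\<Sum>e<8. G3 e \<omega>))"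
  have iG: "integrable M G" unfolding G_def using i1 i2 i3 by auto
  have "expectation G = (\<Sum>k\<in>V. expectation (G1 k)) + (\<Sum>k\<in>W. expectation (G2 k)) + (\<Sum>e<8. expectation (G3 e))"
    unfolding G_def using i1 i2 i3 by simp
  also have "\<dots> \<le> (\<Sum>k\<in>V. 2 * Ct) + (\<Sum>k\<in>W. expectation (X k) + (real R * P + Ct / real R)) + (\<Sum>e::nat<8. 2 * Ct)"
    using e1 e2 e3 by (intro add_mono sum_mono) auto
  also have "\<dots> = 2 * Ct * real (card V) + (\<Sum>k\<in>W. expectation (X k)) + real (card W) * (real R * P + Ct / real R) + 2 * Ct * 8"
    by (simp add: sum.distrib mult_ac)
  also have "\<dots> \<le> 2 * Ct * real k0 + (\<Sum>k\<in>W. expectation (X k)) + 18 * ln (real n) * (real R * P + Ct / real R) + 2 * Ct * 8"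
    using cV cW Ct(1) P0 by (intro add_mono mult_right_mono mult_left_mono) auto
  finally have eG: "expectation G \<le> (\<Sum>k\<in>W. expectation (X k)) + 18 * ln (real n) * (real R * P + Ct / real R) + 2 * Ct * (real k0 + 8)"
    by (simp add: algebra_simps)
  have dom: "real (root_count (sample \<omega>) n S) \<le> G \<omega>" if \<omega>: "\<omega> \<in> space M" for \<omega>
  proof (cases "\<forall>t. coeff_sum (sample \<omega>) n t = 0")
    case True
    then have "{x \<in> S. coeff_sum (sample \<omega>) n x = 0} = S" by auto
    then have "real (root_count (sample \<omega>) n S) = 0" using S(1) by simp
    also have "0 \<le> G \<omega>"
      unfolding G_def G1_def G2_def G3_def I_def J_def X_def
      by (intro add_nonneg_nonneg sum_nonneg mult_nonneg_nonneg near_changes_bounds) auto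
    finally show ?thesis .
  next
    case False
    then have nz: "local_rpoly n x h \<omega> \<noteq> 0" if "h > 0" for x h using local_poly_eq_0_iff[OF that] by blast
    have nzk: "window_poly (sample \<omega>) n k \<noteq> 0" for k by (rule nz) simp
    define cc where "cc = cell_count (sample \<omega>) n"
    have "root_count (sample \<omega>) n S \<le> (\<Sum>k\<le>K. cc (1 - (7/8) ^ k) ((7/8) ^ k)) + (\<Sum>e<8. cc (xe e) (1 / real n))"
      unfolding cc_def xe_def using n S K by (intro card_roots_le_sum_cells) auto
    then have "real (root_count (sample \<omega>) n S)
        \<le> (\<Sum>k\<in>{..K}. real (cc (1 - (7/8) ^ k) ((7/8) ^ k))) + (\<Sum>e<8. real (cc (xe e) (1 / real n)))"
      by (simp only: of_nat_sum[symmetric] of_nat_add[symmetric] of_nat_le_iff)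
    also have "(\<Sum>k\<in>{..K}. real (cc (1 - (7/8) ^ k) ((7/8) ^ k))) = (\<Sum>k\<in>V. real (cc (1 - (7/8) ^ k) ((7/8) ^ k))) + (\<Sum>k\<in>W. real (cc (1 - (7/8) ^ k) ((7/8) ^ k)))"
      unfolding VW(1) using VW by (intro sum.union_disjoint) auto
    also have "\<dots> + (\<Sum>e<8. real (cc (xe e) (1 / real n))) \<le> G \<omega>"
      unfolding G_def
    proof (intro add_mono sum_mono)
      fix k
      show "real (cc (1 - (7/8) ^ k) ((7/8) ^ k)) \<le> G1 k \<omega>"
        unfolding cc_def G1_def I_def by (rule cell_count_le_root_events(1)[OF \<omega> nzk])
      show "real (cc (1 - (7/8) ^ k) ((7/8) ^ k)) \<le> G2 k \<omega>"
        unfolding cc_def G2_def I_def J_def X_def by (rule cell_count_le_of_window[OF \<omega> nzk L d w])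
    next
      fix e :: nat
      show "real (cc (xe e) (1 / real n)) \<le> G3 e \<omega>"
        unfolding cc_def G3_def I_def using nr by (intro cell_count_le_root_events(1)[OF \<omega> nz]) simp
    qed
    finally show ?thesis .
  qed
  show ?thesis
    using iG eG dom unfolding X_def by blast
qed

end

section \<open>Lower deviations on the unit interval\<close>

lemma exists_decay_power_less:
  assumes "0 < e"
  shows "\<exists>A0. \<forall>A\<ge>A0. K * decay ^ A < (e :: real)"
proof -
  have "(\<lambda>A. K * decay ^ A) \<longlonglongrightarrow> K * 0"
    using decay by (intro tendsto_intros LIMSEQ_power_zero) auto
  then have "eventually (\<lambda>A. K * decay ^ A < e) sequentially"
    using assms by (intro order_tendstoD(2)) auto
  then show ?thesis by (simp add: eventually_sequentially)
qed

text \<open>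
  The parameters are chosen in the order \<open>R\<close> (roots per window beyond which the tail bound is used), \<open>L\<close> (fineness of
  the grid), \<open>k0\<close> (first window where the small-ball error is negligible) and \<open>A\<close> (range of the truncation), each
  depending on the preceding ones. With them, all errors in the mean and in the count stay below fractions of
  \<open>e ln n\<close>, where \<open>\<epsilon> = 3 e\<close>: one \<open>e\<close> for the mean, one for Hoeffding's inequality and one for the disturbed
  windows.
\<close>
lemma interval_lower_conc:
  assumes u0: "u\<^sub>0 > 0" and eps: "\<epsilon> > 0"
  shows "\<exists>c>0. \<exists>C>0. \<exists>n0. \<forall>n\<ge>n0. \<forall>(M :: 'a measure) \<xi> S. random_coeffs M \<xi> u\<^sub>0 \<longrightarrow> {0<..<1} \<subseteq> S \<longrightarrow> S \<subseteq> {0..1} \<longrightarrow>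
    lower_conc M (\<lambda>\<omega>. real (root_count (\<lambda>i. \<xi> i \<omega>) n S)) (\<epsilon> * ln (real n)) (C * real n powr - c)"
proof -
  define e where "e = \<epsilon> / 3"
  have e: "e > 0" using eps by (simp add: e_def)
  obtain Ct where Ct: "Ct > 0" "\<And>(M :: 'a measure) \<xi> n x h r. random_coeffs M \<xi> u\<^sub>0 \<Longrightarrow> admissible n x h \<Longrightarrow> 1 \<le> r \<Longrightarrow> r \<le> n \<Longrightarrow>
    measure M (root_event M \<xi> n x h r) \<le> Ct / (real r)\<^sup>2"
    using root_event_tail[OF u0, where 'a='a] by metis
  define C1 where "C1 = exp (1/2) * (4 + 1 / u\<^sub>0\<^sup>2)"
  have C1: "C1 > 0" unfolding C1_def by (intro mult_pos_pos add_pos_nonneg) auto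
  obtain R where R: "72 * Ct / e < real R" using reals_Archimedean2 by blast
  have R0: "real R > 0" using R Ct e by (smt (verit) divide_pos_pos)
  have R1: "18 * (Ct / real R) \<le> e / 4" using R R0 e by (simp add: field_simps)
  obtain L where L: "(72 * real R * (4 * C1 + 3) / e)\<^sup>2 < real L" using reals_Archimedean2 by blast
  have L0: "real L > 0" using L by (smt (verit) zero_le_power2)
  have L1: "18 * real R * ((4 * C1 + 3) / sqrt (real L)) \<le> e / 4"
  proof -
    have "72 * real R * (4 * C1 + 3) / e \<le> sqrt (real L)" using L by (intro real_le_rsqrt) simp
    then show ?thesis using L0 e by (simp add: field_simps)
  qed
  define \<delta> where "\<delta> = 1 / (real L * sqrt (real L))"
  have d0: "\<delta> > 0" using L0 by (simp add: \<delta>_def)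
  \<comment> \<open>With this \<open>w\<close> the tolerated contributions of all distant blocks sum to less than \<open>\<delta> / 2\<close>.\<close>
  define w where "w = \<delta> * (1 - decay) / 5"
  have "2 * (\<delta> * z / 5) / z = 2 * \<delta> / 5" if "z \<noteq> 0" for z :: real using that by simp
  from this[of "1 - decay"] have w: "w > 0" "2 * w / (1 - decay) = 2 * \<delta> / 5"
    using d0 decay by (auto simp: w_def)
  obtain k0 where k0: "(18 * real R * ((real L + 1) * C1)) * decay ^ k0 < e / 8"
    using exists_decay_power_less[of "e / 8"] e by fastforce
  define lam where "lam = - ln decay / 2"
  have lam: "lam > 0" using decay by (simp add: lam_def)
  \<comment> \<open>The first bound keeps the bad event rare, the second makes the drift in the exponential Markov inequality harmless.\<close>
  define f where "f = min (e / (8 * (18 * real R))) (lam * e / (36 * real L))"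
  have f: "f > 0" using e R0 L0 lam by (simp add: f_def)
  have "\<exists>A\<ge>1. far_rate L A w < f"
  proof -
    obtain A0 where "\<forall>A\<ge>A0. (4 * (real L + 1) / w\<^sup>2 / (1 - decay)) * decay ^ A < f"
      using exists_decay_power_less[OF f] by blast
    then have "(4 * (real L + 1) / w\<^sup>2 / (1 - decay)) * decay ^ (max 1 A0) < f" by simp
    then show ?thesis by (intro exI[of _ "max 1 A0"]) (simp add: far_rate_def)
  qed
  then obtain A where A: "A \<ge> 1" "far_rate L A w < f" by blast
  have fr: "18 * real R * far_rate L A w \<le> e / 8" "18 * far_rate L A w \<le> lam * e / (2 * real L)"
  proof -
    have "far_rate L A w \<le> e / (8 * (18 * real R))" "far_rate L A w \<le> lam * e / (36 * real L)"
      using A(2) by (auto simp: f_def)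
    then show "18 * real R * far_rate L A w \<le> e / 8" "18 * far_rate L A w \<le> lam * e / (2 * real L)"
      using R0 L0 by (simp_all add: field_simps)
  qed
  define c1 where "c1 = 2 * (e / (2 * real A))\<^sup>2 / (18 * (real L)\<^sup>2)"
  define c2 where "c2 = lam * e / (2 * real L)"
  define c where "c = min c1 c2"
  have c: "c > 0" using e A(1) L0 lam by (auto simp: c_def c1_def c2_def)
  define C where "C = 2 * real A + 1"
  have C: "C > 0" by (simp add: C_def)
  obtain n1 where n1: "exp (4 * (2 * Ct * (real k0 + 8)) / e) < real n1" using reals_Archimedean2 by blast
  show ?thesis
  proof (rule exI[of _ c], rule conjI[OF c], rule exI[of _ C], rule conjI[OF C], rule exI[of _ "max 2 n1"], intro allI impI)
    fix n and M :: "'a measure" and \<xi> and S :: "real set"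
    assume n: "max 2 n1 \<le> n" and rc: "random_coeffs M \<xi> u\<^sub>0" and S: "{0<..<1} \<subseteq> S" "S \<subseteq> {0..1}"
    interpret random_coeffs M \<xi> u\<^sub>0 by (rule rc)
    have n2: "n \<ge> 2" and nn: "real n1 \<le> real n" using n by auto
    define l where "l = ln (real n)"
    have l0: "l > 0" using n2 by (simp add: l_def)
    have lbig: "2 * Ct * (real k0 + 8) \<le> e / 4 * l"
    proof -
      have "exp (4 * (2 * Ct * (real k0 + 8)) / e) < real n" using n1 nn by linarith
      then have "4 * (2 * Ct * (real k0 + 8)) / e < l"
        unfolding l_def using n2 by (subst ln_exp[symmetric], subst ln_less_cancel_iff) auto
      then show ?thesis using e by (simp add: field_simps)
    qed
    have infS: "infinite S"
      by (rule infinite_super[OF S(1)]) (rule infinite_Ioo, simp)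
    define W where "W = {k0..index_scale (n - 1)}"
    define P where "P = (4 * C1 + 3) / sqrt (real L) + (real L + 1) * C1 * decay ^ k0 + far_rate L A w"
    have fr0: "0 \<le> far_rate L A w" using decay by (simp add: far_rate_def)
    have P0: "P \<ge> 0" using C1 L0 decay fr0 by (simp add: P_def)
    have Pbad: "prob (bad_event n L A \<delta> w k) \<le> P" if "k0 \<le> k" "1 / real n \<le> (7/8) ^ k" for k
    proof -
      have "prob (bad_event n L A \<delta> w k) \<le> (4 * C1 + 3) / sqrt (real L) + (real L + 1) * C1 * decay ^ k + far_rate L A w"
        unfolding C1_def by (rule prob_bad_event_le) (use that n2 L0 w \<delta>_def in auto)
      also have "decay ^ k \<le> decay ^ k0" using that(1) decay by (intro power_decreasing) auto
      then have "(4 * C1 + 3) / sqrt (real L) + (real L + 1) * C1 * decay ^ k + far_rate L A w \<le> P"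
        unfolding P_def using C1 by (intro add_mono mult_left_mono) auto
      finally show ?thesis .
    qed
    define X where "X = (\<lambda>k \<omega>. near_changes (\<lambda>i. \<xi> i \<omega>) n L A \<delta> k)"
    define Y where "Y = (\<lambda>\<omega>. \<Sum>b\<le>index_scale n. far_count (\<lambda>i. \<xi> i \<omega>) n L A w W b)"
    define N where "N = (\<lambda>\<omega>. real (root_count (\<lambda>i. \<xi> i \<omega>) n S))"
    have [measurable]: "X k \<in> borel_measurable M" "Y \<in> borel_measurable M" for k
      unfolding X_def Y_def by measurable
    have "\<exists>G. integrable M G \<and> expectation G \<le> (\<Sum>k\<in>W. expectation (X k)) + 18 * l * (real R * P + Ct / real R) + 2 * Ct * (real k0 + 8)
      \<and> (\<forall>\<omega>\<in>space M. N \<omega> \<le> G \<omega>)"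
      unfolding W_def X_def N_def l_def
      by (rule num_roots_dominated[OF n2 _ \<delta>_def w(1)])
        (use Pbad P0 infS S L0 R0 w d0 Ct(1) Ct(2)[OF rc] in auto)
    then obtain G where G: "integrable M G" "\<forall>\<omega>\<in>space M. N \<omega> \<le> G \<omega>"
      "expectation G \<le> (\<Sum>k\<in>W. expectation (X k)) + 18 * l * (real R * P + Ct / real R) + 2 * Ct * (real k0 + 8)" by blast
    define \<mu> where "\<mu> = (\<Sum>k\<in>W. expectation (X k)) + e * l"
    have "18 * l * (real R * P + Ct / real R) \<le> 3 / 4 * e * l"
    proof -
      have "18 * (real R * P + Ct / real R) = 18 * real R * ((4 * C1 + 3) / sqrt (real L))
          + (18 * real R * ((real L + 1) * C1)) * decay ^ k0 + 18 * real R * far_rate L A w + 18 * (Ct / real R)"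
        by (simp add: P_def algebra_simps)
      also have "\<dots> \<le> e / 4 + e / 8 + e / 8 + e / 4"
        using L1 k0 fr(1) R1 by linarith
      finally have "18 * (real R * P + Ct / real R) \<le> 3 / 4 * e" by simp
      then have "l * (18 * (real R * P + Ct / real R)) \<le> l * (3 / 4 * e)" using l0 by (intro mult_left_mono) auto
      then show ?thesis by (simp add: mult_ac)
    qed
    then have G\<mu>: "expectation G \<le> \<mu>" using G(3) lbig unfolding \<mu>_def by linarith
    define E1 where "E1 = {\<omega> \<in> space M. (\<Sum>k\<in>W. X k \<omega>) \<le> (\<Sum>k\<in>W. expectation (X k)) - e * l}"
    define E2 where "E2 = {\<omega> \<in> space M. e * l / real L \<le> Y \<omega>}"
    have [measurable]: "E1 \<in> events" "E2 \<in> events" unfolding E1_def E2_def by measurable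
    have "{\<omega> \<in> space M. N \<omega> \<le> \<mu> - \<epsilon> * l} \<subseteq> E1 \<union> E2"
    proof
      fix \<omega> assume \<omega>: "\<omega> \<in> {\<omega> \<in> space M. N \<omega> \<le> \<mu> - \<epsilon> * l}"
      show "\<omega> \<in> E1 \<union> E2"
      proof (rule ccontr)
        assume "\<omega> \<notin> E1 \<union> E2"
        then have 1: "(\<Sum>k\<in>W. expectation (X k)) - e * l < (\<Sum>k\<in>W. X k \<omega>)" and 2: "Y \<omega> < e * l / real L"
          using \<omega> by (auto simp: E1_def E2_def)
        have 3: "real L * Y \<omega> < e * l" using 2 L0 by (simp add: field_simps)
        have "(\<Sum>k\<in>W. X k \<omega>) - real L * Y \<omega> \<le> N \<omega>"
          unfolding X_def Y_def N_def
          by (rule near_changes_le_card_roots) (use L0 d0 w S in \<open>auto simp: W_def\<close>)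
        moreover have "\<epsilon> * l = 3 * (e * l)" by (simp add: e_def)
        ultimately show False using \<omega> 1 3 unfolding \<mu>_def by auto
      qed
    qed
    moreover have "prob (E1 \<union> E2) \<le> C * real n powr - c"
    proof -
      have cardW: "real (card W) \<le> 18 * l"
      proof -
        have "card W \<le> card {..index_scale (n - 1)}" by (rule card_mono) (auto simp: W_def)
        also have "\<dots> \<le> index_scale n + 1" by (simp add: index_scale_mono)
        finally have "real (card W) \<le> real (index_scale n) + 1" by linarith
        then show ?thesis using index_scale_le_log[OF n2] by (simp add: l_def)
      qed
      have npow: "exp (- (x * l)) \<le> real n powr - c" if "c \<le> x" for x
      proof -
        have "c * l \<le> x * l" using that l0 by (intro mult_right_mono) auto
        moreover have "real n powr - c = exp (- (c * l))" using n2 by (simp add: powr_def l_def)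
        ultimately show ?thesis by simp
      qed
      have "prob E1 \<le> 2 * real A * exp (- 2 * (e * l / (2 * real A))\<^sup>2 / (18 * l * (real L)\<^sup>2))"
        unfolding E1_def X_def
        by (rule prob_near_changes_small_le) (use cardW A L0 e l0 in \<open>auto simp: W_def\<close>)
      also have "- 2 * (e * l / (2 * real A))\<^sup>2 / (18 * l * (real L)\<^sup>2) = - (c1 * l)"
        using l0 by (simp add: c1_def power2_eq_square field_simps)
      also have "2 * real A * exp (- (c1 * l)) \<le> 2 * real A * real n powr - c"
        by (intro mult_left_mono npow) (auto simp: c_def)
      finally have p1: "prob E1 \<le> 2 * real A * real n powr - c" .
      have "prob E2 \<le> exp (ln decay / 2 * (e * l / real L) + far_rate L A w * real (card {..index_scale n}))"
        unfolding E2_def Y_def by (rule prob_far_count_large_le) (use L0 w A in \<open>auto simp: W_def\<close>)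
      also have "\<dots> \<le> exp (- (c2 * l))"
      proof (subst exp_le_cancel_iff)
        have "far_rate L A w * real (card {..index_scale n}) \<le> far_rate L A w * (18 * l)"
          using fr0 index_scale_le_log[OF n2] by (intro mult_left_mono) (auto simp: l_def)
        also have "\<dots> = (18 * far_rate L A w) * l" by simp
        also have "\<dots> \<le> (lam * e / (2 * real L)) * l" using fr(2) l0 by (intro mult_right_mono) auto
        finally have "far_rate L A w * real (card {..index_scale n}) \<le> c2 * l" by (simp add: c2_def)
        moreover have "ln decay / 2 * (e * l / real L) = - 2 * (c2 * l)"
          using L0 by (simp add: lam_def c2_def field_simps)
        ultimately show "ln decay / 2 * (e * l / real L) + far_rate L A w * real (card {..index_scale n}) \<le> - (c2 * l)" by linarith
      qed
      also have "\<dots> \<le> real n powr - c" by (rule npow) (simp add: c_def)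
      finally have p2: "prob E2 \<le> real n powr - c" .
      have "prob (E1 \<union> E2) \<le> prob E1 + prob E2" by (rule measure_Un_le) measurable
      then show ?thesis using p1 p2 by (simp add: C_def algebra_simps)
    qed
    ultimately show "lower_conc M (\<lambda>\<omega>. real (root_count (\<lambda>i. \<xi> i \<omega>) n S)) (\<epsilon> * ln (real n)) (C * real n powr - c)"
      unfolding lower_conc_def N_def[symmetric] l_def[symmetric]
      using G(1,2) G\<mu> by (intro exI[of _ \<mu>] exI[of _ G] exI[of _ "E1 \<union> E2"]) auto
  qed
qed

section \<open>Reduction to the unit interval\<close>

lemma random_coeffs_signed_reindex:
  assumes "random_coeffs M \<xi> u\<^sub>0" "inj \<pi>" "\<And>i. \<bar>s i\<bar> = (1 :: real)"
  shows "random_coeffs M (\<lambda>i \<omega>. s i * \<xi> (\<pi> i) \<omega>) u\<^sub>0"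
proof -
  interpret random_coeffs M \<xi> u\<^sub>0 by fact
  have s2: "(s i)\<^sup>2 = 1" for i using assms(3)[of i] by (metis power2_abs power_one)
  show ?thesis
  proof unfold_locales
    have "indep_vars (\<lambda>i. PiM {\<pi> i} (\<lambda>_. borel)) (\<lambda>i \<omega>. restrict (\<lambda>j. \<xi> j \<omega>) {\<pi> i}) UNIV"
      by (rule indep_vars_restrict[OF indep]) (use assms(2) in \<open>auto simp: disjoint_family_on_def inj_def\<close>)
    then have "indep_vars (\<lambda>_. borel) (\<lambda>i \<omega>. s i * restrict (\<lambda>j. \<xi> j \<omega>) {\<pi> i} (\<pi> i)) UNIV"
      by (rule indep_vars_compose2) (auto intro!: borel_measurable_times measurable_component_singleton)
    then show "indep_vars (\<lambda>_. borel) (\<lambda>i \<omega>. s i * \<xi> (\<pi> i) \<omega>) UNIV" by simp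
    fix i
    show "integrable M (\<lambda>\<omega>. s i * \<xi> (\<pi> i) \<omega>)" using integrable_coeff by simp
    show "integrable M (\<lambda>\<omega>. (s i * \<xi> (\<pi> i) \<omega>)\<^sup>2)" using integrable_square by (simp add: power_mult_distrib)
    show "expectation (\<lambda>\<omega>. s i * \<xi> (\<pi> i) \<omega>) = 0" using mean_zero by simp
    show "expectation (\<lambda>\<omega>. (s i * \<xi> (\<pi> i) \<omega>)\<^sup>2) = 1" using second_moment by (simp add: power_mult_distrib s2)
    show "0 < u\<^sub>0" by (rule u\<^sub>0_pos)
    fix u :: real assume u: "\<bar>u\<bar> \<le> u\<^sub>0"
    have "char (distr M borel (\<lambda>\<omega>. s i * \<xi> (\<pi> i) \<omega>)) u = char (distr M borel (\<xi> (\<pi> i))) (s i * u)"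
      by (simp add: char_def integral_distr mult_ac)
    then show "norm (char (distr M borel (\<lambda>\<omega>. s i * \<xi> (\<pi> i) \<omega>)) u) \<le> exp (- (u\<^sup>2) / 4)"
      using char_bound[of "s i * u" "\<pi> i"] u assms(3)[of i] by (simp add: abs_mult power_mult_distrib s2)
  qed
qed

text \<open>
  In the second-order expansion of the characteristic function the error is controlled by
  \<open>min (6 x^2) (|u| |x|^3) \<le> 6 |u|^e |x|^(2 + e)\<close>, valid for \<open>0 < e \<le> 1\<close>.
\<close>
lemma char_le_of_bounded_moment:
  fixes p C\<^sub>0 :: real
  assumes "prob_space M" and X: "integrable M X" and X2: "integrable M (\<lambda>\<omega>. (X \<omega>)\<^sup>2)"
    and mean: "prob_space.expectation M X = 0" and var: "prob_space.variance M X = 1"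
    and e: "0 < e" "e \<le> 1" "e \<le> e0" and mom: "integrable M (\<lambda>\<omega>. \<bar>X \<omega>\<bar> powr (2 + e0))"
    "prob_space.expectation M (\<lambda>\<omega>. \<bar>X \<omega>\<bar> powr (2 + e0)) \<le> C0"
    and u: "\<bar>u\<bar> \<le> 1" "\<bar>u\<bar> powr e * (1 + C0) \<le> 1/4"
  shows "norm (char (distr M borel X) u) \<le> exp (- (u\<^sup>2) / 4)"
proof -
  interpret prob_space M by fact
  have [measurable]: "X \<in> borel_measurable M" using X by auto
  define m where "m = expectation (\<lambda>\<omega>. min (6 * (X \<omega>)\<^sup>2) (\<bar>u\<bar> * \<bar>X \<omega>\<bar> ^ 3))"
  have approx: "norm (char (distr M borel X) u - (1 - u\<^sup>2 * 1 / 2)) \<le> (u\<^sup>2 / 6) * m"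
    unfolding m_def by (rule char_approx3') (use X X2 mean var in auto)
  have "m \<le> expectation (\<lambda>\<omega>. 6 * \<bar>u\<bar> powr e * (1 + \<bar>X \<omega>\<bar> powr (2 + e0)))"
    unfolding m_def
  proof (rule integral_mono)
    show "integrable M (\<lambda>\<omega>. min (6 * (X \<omega>)\<^sup>2) (\<bar>u\<bar> * \<bar>X \<omega>\<bar> ^ 3))"
      by (rule Bochner_Integration.integrable_bound[of _ "\<lambda>\<omega>. 6 * (X \<omega>)\<^sup>2"]) (use X2 in auto)
    show "integrable M (\<lambda>\<omega>. 6 * \<bar>u\<bar> powr e * (1 + \<bar>X \<omega>\<bar> powr (2 + e0)))" using mom by simp
    fix \<omega>
    define x where "x = \<bar>X \<omega>\<bar>"
    show "min (6 * (X \<omega>)\<^sup>2) (\<bar>u\<bar> * \<bar>X \<omega>\<bar> ^ 3) \<le> 6 * \<bar>u\<bar> powr e * (1 + \<bar>X \<omega>\<bar> powr (2 + e0))"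
    proof (cases "x = 0 \<or> u = 0")
      case True
      then show ?thesis by (auto simp: x_def min_def)
    next
      case False
      then have x: "x > 0" and u0: "\<bar>u\<bar> > 0" by (auto simp: x_def)
      have "min (6 * x\<^sup>2) (\<bar>u\<bar> * x ^ 3) \<le> 6 * x\<^sup>2 * (\<bar>u\<bar> * x) powr e"
      proof (cases "\<bar>u\<bar> * x \<le> 1")
        case True
        have "\<bar>u\<bar> * x \<le> (\<bar>u\<bar> * x) powr e"
          using powr_mono'[of e 1 "\<bar>u\<bar> * x"] True x u0 e by simp
        also have "\<dots> \<le> 6 * (\<bar>u\<bar> * x) powr e" by simp
        finally have "x\<^sup>2 * (\<bar>u\<bar> * x) \<le> x\<^sup>2 * (6 * (\<bar>u\<bar> * x) powr e)" by (intro mult_left_mono) auto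
        then show ?thesis by (simp add: power2_eq_square power3_eq_cube min.coboundedI2 mult_ac)
      next
        case False
        then have "1 \<le> (\<bar>u\<bar> * x) powr e" using e by (intro ge_one_powr_ge_zero) auto
        then have "6 * x\<^sup>2 * 1 \<le> 6 * x\<^sup>2 * (\<bar>u\<bar> * x) powr e" by (intro mult_left_mono) auto
        then show ?thesis by (simp add: min.coboundedI1)
      qed
      also have "\<dots> = 6 * \<bar>u\<bar> powr e * x powr (2 + e)"
        using x u0 by (simp add: powr_mult powr_add powr_numeral)
      also have "\<dots> \<le> 6 * \<bar>u\<bar> powr e * (1 + x powr (2 + e0))"
      proof (intro mult_left_mono)
        show "x powr (2 + e) \<le> 1 + x powr (2 + e0)"
        proof (cases "x \<le> 1")
          case True
          then have "x powr (2 + e) \<le> 1" using x e by (intro powr_le1) auto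
          then show ?thesis by (simp add: add_increasing2)
        next
          case False
          then have "x powr (2 + e) \<le> x powr (2 + e0)" using e by (intro powr_mono) auto
          then show ?thesis by simp
        qed
      qed simp
      finally show ?thesis by (simp add: x_def)
    qed
  qed
  also have "\<dots> = 6 * \<bar>u\<bar> powr e * (1 + expectation (\<lambda>\<omega>. \<bar>X \<omega>\<bar> powr (2 + e0)))"
    using mom by (simp add: prob_space)
  also have "\<dots> \<le> 6 * (\<bar>u\<bar> powr e * (1 + C0))" using mom by (simp add: mult_left_mono)
  also have "\<dots> \<le> 6 * (1/4)" using u by (intro mult_left_mono) auto
  finally have "(u\<^sup>2 / 6) * m \<le> (u\<^sup>2 / 6) * (6 * (1/4))" by (intro mult_left_mono) auto
  then have "(u\<^sup>2 / 6) * m \<le> u\<^sup>2 / 4" by (simp add: field_simps)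
  with approx have "norm (char (distr M borel X) u - (1 - u\<^sup>2 * 1 / 2)) \<le> u\<^sup>2 / 4" by (rule order_trans)
  moreover have "norm (1 - u\<^sup>2 * 1 / 2 :: complex) = 1 - u\<^sup>2 / 2"
  proof -
    have "u\<^sup>2 \<le> 1" using u by (simp add: abs_square_le_1)
    moreover have "(1 - u\<^sup>2 * 1 / 2 :: complex) = of_real (1 - u\<^sup>2 / 2)" by simp
    ultimately show ?thesis by (simp only: norm_of_real)
  qed
  ultimately have "norm (char (distr M borel X) u) \<le> 1 + - (u\<^sup>2 / 4)"
    using norm_triangle_sub[of "char (distr M borel X) u" "1 - u\<^sup>2 * 1 / 2"] by simp
  also have "\<dots> \<le> exp (- (u\<^sup>2 / 4))" by (rule exp_ge_add_one_self)
  finally show ?thesis by simp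
qed

lemma random_coeffs_of_bounded_moments:
  assumes M: "prob_space M" and ind: "prob_space.indep_vars M (\<lambda>_. borel) \<xi> UNIV"
    and int: "\<And>i. integrable M (\<xi> i)"
    and mean: "\<And>i. prob_space.expectation M (\<xi> i) = 0"
    and var: "\<And>i. prob_space.variance M (\<xi> i) = 1"
    and e0: "\<epsilon>\<^sub>0 > 0"
    and mom: "uniformly_bounded_moments M \<xi> (2 + \<epsilon>\<^sub>0)"
  shows "\<exists>u\<^sub>0>0. random_coeffs M \<xi> u\<^sub>0"
proof -
  interpret prob_space M by fact
  obtain C0 where C0: "\<And>i. integrable M (\<lambda>\<omega>. \<bar>\<xi> i \<omega>\<bar> powr (2 + \<epsilon>\<^sub>0))"
    "\<And>i. expectation (\<lambda>\<omega>. \<bar>\<xi> i \<omega>\<bar> powr (2 + \<epsilon>\<^sub>0)) \<le> C0"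
    using mom by (auto simp: uniformly_bounded_moments_def)
  have "0 \<le> expectation (\<lambda>\<omega>. \<bar>\<xi> 0 \<omega>\<bar> powr (2 + \<epsilon>\<^sub>0))" by (rule Bochner_Integration.integral_nonneg) simp
  then have C0p: "C0 \<ge> 0" using C0(2)[of 0] by linarith
  define e where "e = min 1 \<epsilon>\<^sub>0"
  have e: "0 < e" "e \<le> 1" "e \<le> \<epsilon>\<^sub>0" using e0 by (auto simp: e_def)
  define t where "t = 1 / (4 * (1 + C0))"
  have t: "0 < t" "t * (1 + C0) = 1/4" using C0p by (auto simp: t_def)
  define u0 where "u0 = min 1 (t powr (1 / e))"
  have u0: "u0 > 0" using t by (simp add: u0_def)
  have sq: "expectation (\<lambda>\<omega>. (\<xi> i \<omega>)\<^sup>2) = 1" for i using var[of i] mean[of i] by simp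
  have sqi: "integrable M (\<lambda>\<omega>. (\<xi> i \<omega>)\<^sup>2)" for i
    using sq[of i] not_integrable_integral_eq by fastforce
  have "random_coeffs M \<xi> u0"
  proof unfold_locales
    fix i and u :: real assume u: "\<bar>u\<bar> \<le> u0"
    show "norm (char (distr M borel (\<xi> i)) u) \<le> exp (- (u\<^sup>2) / 4)"
    proof (rule char_le_of_bounded_moment[OF M int sqi mean var e C0])
      show "\<bar>u\<bar> \<le> 1" using u by (simp add: u0_def)
      have "\<bar>u\<bar> powr e \<le> (t powr (1 / e)) powr e" using u e by (intro powr_mono2) (auto simp: u0_def)
      also have "\<dots> = t" using t e by (simp add: powr_powr)
      finally have "\<bar>u\<bar> powr e * (1 + C0) \<le> t * (1 + C0)" using C0p by (intro mult_right_mono) auto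
      then show "\<bar>u\<bar> powr e * (1 + C0) \<le> 1/4" using t by simp
    qed
  qed (use ind int mean sq sqi u0 in auto)
  with u0 show ?thesis by blast
qed

lemma lower_conc_mono:
  assumes "lower_conc M N t p" "t \<le> t'" "p \<le> p'"
  shows "lower_conc M N t' p'"
proof -
  obtain \<mu> G E where H: "integrable M G" "integral\<^sup>L M G \<le> \<mu>" "\<forall>\<omega>\<in>space M. N \<omega> \<le> G \<omega>"
     "E \<in> sets M" "{\<omega> \<in> space M. N \<omega> \<le> \<mu> - t} \<subseteq> E" "measure M E \<le> p"
    using assms(1) unfolding lower_conc_def by blast
  have "{\<omega> \<in> space M. N \<omega> \<le> \<mu> - t'} \<subseteq> E" using H(5) assms(2) by force
  then show ?thesis unfolding lower_conc_def using H assms(3) by (meson order_trans)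
qed

text \<open>
  If a sum is below its threshold by \<open>t + t'\<close>, one of the summands is below its own by \<open>t\<close> or \<open>t'\<close>.
\<close>
lemma lower_conc_add:
  assumes "lower_conc M N t p" "lower_conc M N' t' p'"
  shows "lower_conc M (\<lambda>\<omega>. N \<omega> + N' \<omega>) (t + t') (p + p')"
proof -
  obtain \<mu> G E where H: "integrable M G" "integral\<^sup>L M G \<le> \<mu>" "\<forall>\<omega>\<in>space M. N \<omega> \<le> G \<omega>"
     "E \<in> sets M" "{\<omega> \<in> space M. N \<omega> \<le> \<mu> - t} \<subseteq> E" "measure M E \<le> p"
    using assms(1) unfolding lower_conc_def by blast
  obtain \<mu>' G' E' where H': "integrable M G'" "integral\<^sup>L M G' \<le> \<mu>'" "\<forall>\<omega>\<in>space M. N' \<omega> \<le> G' \<omega>"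
     "E' \<in> sets M" "{\<omega> \<in> space M. N' \<omega> \<le> \<mu>' - t'} \<subseteq> E'" "measure M E' \<le> p'"
    using assms(2) unfolding lower_conc_def by blast
  show ?thesis unfolding lower_conc_def
  proof (intro exI[of _ "\<mu> + \<mu>'"] exI[of _ "\<lambda>\<omega>. G \<omega> + G' \<omega>"] exI[of _ "E \<union> E'"] conjI)
    show "{\<omega> \<in> space M. N \<omega> + N' \<omega> \<le> \<mu> + \<mu>' - (t + t')} \<subseteq> E \<union> E'"
    proof
      fix \<omega> assume \<omega>: "\<omega> \<in> {\<omega> \<in> space M. N \<omega> + N' \<omega> \<le> \<mu> + \<mu>' - (t + t')}"
      then have "N \<omega> \<le> \<mu> - t \<or> N' \<omega> \<le> \<mu>' - t'" by auto
      then show "\<omega> \<in> E \<union> E'" using \<omega> H(5) H'(5) by auto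
    qed
    show "measure M (E \<union> E') \<le> p + p'"
      using measure_Un_le[OF H(4) H'(4)] H(6) H'(6) by linarith
  qed (use H H' in \<open>auto intro: add_mono\<close>)
qed

lemma lower_conc_perturb:
  assumes "lower_conc M N t p" "\<And>\<omega>. \<omega> \<in> space M \<Longrightarrow> N' \<omega> \<le> N \<omega>" "\<And>\<omega>. \<omega> \<in> space M \<Longrightarrow> N \<omega> \<le> N' \<omega> + b"
  shows "lower_conc M N' (t + b) p"
proof -
  obtain \<mu> G E where H: "integrable M G" "integral\<^sup>L M G \<le> \<mu>" "\<forall>\<omega>\<in>space M. N \<omega> \<le> G \<omega>"
     "E \<in> sets M" "{\<omega> \<in> space M. N \<omega> \<le> \<mu> - t} \<subseteq> E" "measure M E \<le> p"
    using assms(1) unfolding lower_conc_def by blast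
  have "\<forall>\<omega>\<in>space M. N' \<omega> \<le> G \<omega>" using H(3) assms(2) by (meson order_trans)
  moreover have "{\<omega> \<in> space M. N' \<omega> \<le> \<mu> - (t + b)} \<subseteq> E" using H(5) assms(3) by force
  ultimately show ?thesis unfolding lower_conc_def using H by blast
qed

text \<open>
  If \<open>N\<close> is not integrable, its Bochner integral is 0 and no nonnegative value is below \<open>- t\<close>.
\<close>
lemma (in prob_space) prob_le_of_lower_conc:
  assumes "lower_conc M N t p" "t > 0" "p \<ge> 0" "\<And>\<omega>. \<omega> \<in> space M \<Longrightarrow> 0 \<le> N \<omega>"
  shows "prob {\<omega> \<in> space M. N \<omega> \<le> expectation N - t} \<le> p"
proof -
  obtain \<mu> G E where H: "integrable M G" "integral\<^sup>L M G \<le> \<mu>" "\<forall>\<omega>\<in>space M. N \<omega> \<le> G \<omega>"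
     "E \<in> sets M" "{\<omega> \<in> space M. N \<omega> \<le> \<mu> - t} \<subseteq> E" "measure M E \<le> p"
    using assms(1) unfolding lower_conc_def by blast
  show ?thesis
  proof (cases "integrable M N")
    case True
    then have "expectation N \<le> expectation G" using H by (intro integral_mono) auto
    then have "{\<omega> \<in> space M. N \<omega> \<le> expectation N - t} \<subseteq> E" using H(2,5) by force
    then have "prob {\<omega> \<in> space M. N \<omega> \<le> expectation N - t} \<le> prob E" using H(4) by (rule finite_measure_mono)
    then show ?thesis using H(6) by linarith
  next
    case False
    then have "expectation N = 0" by (rule not_integrable_integral_eq)
    then have "{\<omega> \<in> space M. N \<omega> \<le> expectation N - t} = {}" using assms(2,4) by force
    then show ?thesis using assms(3) by (simp only: measure_empty)
  qed
qed

lemma coeff_sum_reverse: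
  assumes "x \<noteq> 0"
  shows "coeff_sum (\<lambda>i. a (n - i)) n (1 / x) * x ^ n = coeff_sum a n x"
proof -
  have "coeff_sum (\<lambda>i. a (n - i)) n (1 / x) * x ^ n = (\<Sum>i\<le>n. a (n - i) * x ^ (n - i))"
    unfolding coeff_sum_def sum_distrib_right
  proof (rule sum.cong[OF refl])
    fix i assume "i \<in> {..n}"
    then have "x ^ n = x ^ i * x ^ (n - i)" by (simp flip: power_add)
    then show "a (n - i) * (1 / x) ^ i * x ^ n = a (n - i) * x ^ (n - i)"
      using assms by (simp add: power_divide)
  qed
  also have "\<dots> = coeff_sum a n x"
    unfolding coeff_sum_def by (rule sum.reindex_bij_witness[of _ "\<lambda>i. n - i" "\<lambda>i. n - i"]) auto
  finally show ?thesis .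
qed

lemma coeff_sum_flip: "coeff_sum (\<lambda>i. (-1) ^ i * a i) n (- x) = coeff_sum a n x"
  unfolding coeff_sum_def
proof (rule sum.cong[OF refl])
  fix i
  have "(-1) ^ i * (- x) ^ i = x ^ i" by (simp only: power_mult_distrib[symmetric]) simp
  then show "(-1) ^ i * a i * (- x) ^ i = a i * x ^ i" by (metis mult.assoc mult.commute)
qed

lemma card_roots_reverse:
  "root_count a n {1..} = root_count (\<lambda>i. a (n - i)) n {0<..1}"
proof (rule bij_betw_same_card)
  have z: "coeff_sum (\<lambda>i. a (n - i)) n (1 / x) = 0 \<longleftrightarrow> coeff_sum a n x = 0" if "x \<noteq> 0" for x
    using coeff_sum_reverse[OF that, of a n] that by auto
  show "bij_betw (\<lambda>x. 1 / x) {x \<in> {1..}. coeff_sum a n x = 0} {x \<in> {0<..1}. coeff_sum (\<lambda>i. a (n - i)) n x = 0}"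
  proof (rule bij_betwI[where g="\<lambda>x. 1 / x"])
    show "(\<lambda>x. 1 / x) \<in> {x \<in> {1..}. coeff_sum a n x = 0} \<rightarrow> {x \<in> {0<..1}. coeff_sum (\<lambda>i. a (n - i)) n x = 0}"
      using z by (auto simp: field_simps)
    show "(\<lambda>x. 1 / x) \<in> {x \<in> {0<..1}. coeff_sum (\<lambda>i. a (n - i)) n x = 0} \<rightarrow> {x \<in> {1..}. coeff_sum a n x = 0}"
    proof
      fix y assume y: "y \<in> {x \<in> {0<..1}. coeff_sum (\<lambda>i. a (n - i)) n x = 0}"
      then have "coeff_sum a n (1 / y) = 0" using z[of "1 / y"] by simp
      then show "1 / y \<in> {x \<in> {1..}. coeff_sum a n x = 0}" using y by simp
    qed
  qed auto
qed

lemma card_roots_flip: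
  "root_count a n S = root_count (\<lambda>i. (-1) ^ i * a i) n (uminus ` S)"
proof (rule bij_betw_same_card)
  show "bij_betw uminus {x \<in> S. coeff_sum a n x = 0} {x \<in> uminus ` S. coeff_sum (\<lambda>i. (-1) ^ i * a i) n x = 0}"
    by (rule bij_betwI[where g=uminus]) (auto simp: coeff_sum_flip)
qed

text \<open>
  Only the points \<open>- 1\<close>, 0 and 1 are counted twice. For the zero polynomial all the counts are 0.
\<close>
lemma card_roots_real_line:
  fixes a :: "nat \<Rightarrow> real" and n :: nat
  defines "N \<equiv> \<lambda>S. root_count a n S"
  shows "N UNIV \<le> N {0..1} + N {1..} + N {-1..0} + N {..-1}"
    and "N {0..1} + N {1..} + N {-1..0} + N {..-1} \<le> N UNIV + 3"
proof -
  define Z where "Z = (\<lambda>S. {x \<in> S. coeff_sum a n x = 0})"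
  have N: "N S = card (Z S)" for S by (simp add: N_def Z_def)
  have "N UNIV \<le> N {0..1} + N {1..} + N {-1..0} + N {..-1} \<and> N {0..1} + N {1..} + N {-1..0} + N {..-1} \<le> N UNIV + 3"
  proof (cases "\<forall>t. coeff_sum a n t = 0")
    case True
    then have "Z S = S" for S by (auto simp: Z_def)
    then show ?thesis by (simp add: N infinite_Icc infinite_UNIV_char_0 infinite_Ici infinite_Iic)
  next
    case False
    then have fin: "finite (Z S)" for S
      using finite_roots_coeff_sum[of a n] unfolding Z_def by (auto intro: rev_finite_subset)
    have "Z UNIV = Z {0..1} \<union> Z {1..} \<union> Z {-1..0} \<union> Z {..-1}" by (auto simp: Z_def)
    then have "card (Z UNIV) = card (Z {0..1} \<union> Z {1..} \<union> Z {-1..0} \<union> Z {..-1})" by (simp only:)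
    then have "N UNIV \<le> N {0..1} + N {1..} + N {-1..0} + N {..-1}"
      using card_Un_le[of "Z {0..1}" "Z {1..}"] card_Un_le[of "Z {0..1} \<union> Z {1..}" "Z {-1..0}"]
        card_Un_le[of "Z {0..1} \<union> Z {1..} \<union> Z {-1..0}" "Z {..-1}"]
      unfolding N by linarith
    moreover have "N {1..} \<le> N {1<..} + 1" "N {-1..0} \<le> N {-1..<0} + 1" "N {..-1} \<le> N {..<-1} + 1"
    proof -
      have ins: "card A \<le> card B + 1" if "A \<subseteq> insert x B" "finite B" for A B and x :: real
        using card_mono[of "insert x B" A] that by (auto simp: card_insert_if split: if_splits)
      have "Z {1..} \<subseteq> insert 1 (Z {1<..})" "Z {-1..0} \<subseteq> insert 0 (Z {-1..<0})" "Z {..-1} \<subseteq> insert (-1) (Z {..<-1})"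
        by (auto simp: Z_def)
      then show "N {1..} \<le> N {1<..} + 1" "N {-1..0} \<le> N {-1..<0} + 1" "N {..-1} \<le> N {..<-1} + 1"
        unfolding N using ins fin by blast+
    qed
    moreover have "N {0..1} + N {1<..} + N {-1..<0} + N {..<-1} \<le> N UNIV"
    proof -
      have "N {0..1} + N {1<..} + N {-1..<0} + N {..<-1} = card (Z {0..1} \<union> Z {1<..} \<union> Z {-1..<0} \<union> Z {..<-1})"
      proof -
        have d: "Z {0..1} \<inter> Z {1<..} = {}" "(Z {0..1} \<union> Z {1<..}) \<inter> Z {-1..<0} = {}"
          "(Z {0..1} \<union> Z {1<..} \<union> Z {-1..<0}) \<inter> Z {..<-1} = {}" by (auto simp: Z_def)
        show ?thesis
          unfolding N
          using card_Un_disjoint[OF fin fin d(1)] card_Un_disjoint[OF finite_UnI[OF fin fin] fin d(2)]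
            card_Un_disjoint[OF finite_UnI[OF finite_UnI[OF fin fin] fin] fin d(3)] by linarith
      qed
      also have "\<dots> \<le> N UNIV" unfolding N by (rule card_mono[OF fin]) (auto simp: Z_def)
      finally show ?thesis .
    qed
    ultimately show ?thesis by linarith
  qed
  then show "N UNIV \<le> N {0..1} + N {1..} + N {-1..0} + N {..-1}"
    "N {0..1} + N {1..} + N {-1..0} + N {..-1} \<le> N UNIV + 3" by auto
qed

lemma quarter_lower_conc:
  fixes M :: "'a measure"
  assumes rc: "random_coeffs M \<xi> u\<^sub>0" and eps: "\<epsilon> > 0"
  shows "\<exists>c>0. \<exists>C>0. \<exists>n0. \<forall>n\<ge>n0. \<forall>S \<in> {{0..1}, {1..}, {-1..0}, {..-1}}.
    lower_conc M (\<lambda>\<omega>. real (root_count (\<lambda>i. \<xi> i \<omega>) n S)) (\<epsilon> * ln (real n)) (C * real n powr - c)"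
proof -
  have u0: "u\<^sub>0 > 0" using rc by (rule random_coeffs.u\<^sub>0_pos)
  obtain c C n0 where c: "c > 0" "C > 0" and core: "\<forall>n\<ge>n0. \<forall>(M :: 'a measure) \<xi> S. random_coeffs M \<xi> u\<^sub>0 \<longrightarrow> {0<..<1} \<subseteq> S \<longrightarrow> S \<subseteq> {0..1} \<longrightarrow>
    lower_conc M (\<lambda>\<omega>. real (root_count (\<lambda>i. \<xi> i \<omega>) n S)) (\<epsilon> * ln (real n)) (C * real n powr - c)"
    using interval_lower_conc[OF u0 eps, where 'a='a] by (elim exE conjE) (rule that)
  have "lower_conc M (\<lambda>\<omega>. real (root_count (\<lambda>i. \<xi> i \<omega>) n S)) (\<epsilon> * ln (real n)) (C * real n powr - c)"
    if n: "n \<ge> n0" and S: "S \<in> {{0..1}, {1..}, {-1..0}, {..-1}}" for n S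
  proof -
    define \<pi> where "\<pi> = (\<lambda>i. if i \<le> n then n - i else i)"
    have inj: "inj \<pi>" by (rule injI) (auto simp: \<pi>_def split: if_splits)
    have rev: "root_count a n {1..} = root_count (\<lambda>i. a (\<pi> i)) n {0<..1}" for a
    proof -
      have "coeff_sum (\<lambda>i. a (n - i)) n x = coeff_sum (\<lambda>i. a (\<pi> i)) n x" for x
        unfolding coeff_sum_def by (rule sum.cong) (auto simp: \<pi>_def)
      then show ?thesis unfolding card_roots_reverse[of a] by simp
    qed
    have sgn: "\<bar>(-1 :: real) ^ m\<bar> = 1" for m by simp
    have flip: "uminus ` {-1..0} = {0..1 :: real}" "uminus ` {..-1} = {1 :: real..}" by auto
    have r1: "random_coeffs M (\<lambda>i \<omega>. \<xi> (\<pi> i) \<omega>) u\<^sub>0"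
      using random_coeffs_signed_reindex[OF rc inj, of "\<lambda>_. 1"] by simp
    have r2: "random_coeffs M (\<lambda>i \<omega>. (-1) ^ i * \<xi> i \<omega>) u\<^sub>0"
      using random_coeffs_signed_reindex[OF rc inj_on_id2 sgn] by simp
    have r3: "random_coeffs M (\<lambda>i \<omega>. (-1) ^ \<pi> i * \<xi> (\<pi> i) \<omega>) u\<^sub>0"
      by (rule random_coeffs_signed_reindex[OF rc inj sgn])
    from S consider "S = {0..1}" | "S = {1..}" | "S = {-1..0}" | "S = {..-1}" by auto
    then show ?thesis
    proof cases
      case 1
      show ?thesis unfolding 1 by (rule core[rule_format, OF n rc]) auto
    next
      case 2
      show ?thesis unfolding 2 rev by (rule core[rule_format, OF n r1]) auto
    next
      case 3
      show ?thesis unfolding 3 card_roots_flip[of "{-1..0}"] flip by (rule core[rule_format, OF n r2]) auto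
    next
      case 4
      show ?thesis unfolding 4 card_roots_flip[of "{..-1}"] flip rev by (rule core[rule_format, OF n r3]) auto
    qed
  qed
  then show ?thesis using c by blast
qed

theorem theorem1p4:
  fixes M :: "'a measure" and \<xi> :: "nat \<Rightarrow> 'a \<Rightarrow> real" and \<epsilon>\<^sub>0 :: real
  assumes "prob_space M"
    and "prob_space.indep_vars M (\<lambda>_. borel) \<xi> UNIV"
    and "\<And>i. integrable M (\<xi> i)"
    and "\<And>i. prob_space.expectation M (\<xi> i) = 0"
    and "\<And>i. prob_space.variance M (\<xi> i) = 1"
    and "\<epsilon>\<^sub>0 > 0"
    and "uniformly_bounded_moments M \<xi> (2 + \<epsilon>\<^sub>0)"
  shows "\<forall>S \<in> {UNIV, {0..1}, {1..}, {-1..0}, {..-1}}. \<forall>\<epsilon>>0. \<exists>c>0. \<exists>C>0. \<forall>n\<ge>1.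
           prob_space.prob M {\<omega> \<in> space M. real (num_roots \<xi> n S \<omega>) \<le>
               prob_space.expectation M (\<lambda>\<omega>. real (num_roots \<xi> n S \<omega>)) - \<epsilon> * ln (real n)}
             \<le> C * real n powr (- c)"
proof (intro ballI allI impI)
  fix S :: "real set" and \<epsilon> :: real
  assume S: "S \<in> {UNIV, {0..1}, {1..}, {-1..0}, {..-1}}" and eps: "\<epsilon> > 0"
  interpret prob_space M by fact
  obtain u0 where rc: "random_coeffs M \<xi> u0"
    using random_coeffs_of_bounded_moments[OF assms] by blast
  define N where "N = (\<lambda>n S \<omega>. real (root_count (\<lambda>i. \<xi> i \<omega>) n S))"
  have nr: "real (num_roots \<xi> n S \<omega>) = N n S \<omega>" for n S \<omega>
    by (simp add: N_def num_roots_def random_poly_def coeff_sum_def)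
  have eps8: "\<epsilon> / 8 > 0" using eps by simp
  obtain c C n0 where c: "c > 0" "C > 0" and quarter: "\<forall>n\<ge>n0. \<forall>S \<in> {{0..1}, {1..}, {-1..0}, {..-1}}.
      lower_conc M (\<lambda>\<omega>. real (root_count (\<lambda>i. \<xi> i \<omega>) n S)) (\<epsilon> / 8 * ln (real n)) (C * real n powr - c)"
    using quarter_lower_conc[OF rc eps8] by (elim exE conjE) (rule that)
  have quarterN: "lower_conc M (N n S) (\<epsilon> / 8 * ln (real n)) (C * real n powr - c)"
    if "n \<ge> n0" "S \<in> {{0..1}, {1..}, {-1..0}, {..-1}}" for n S
    unfolding N_def by (rule quarter[rule_format, OF that])
  \<comment> \<open>From \<open>n1\<close> on, the three points that are counted twice matter less than \<open>\<epsilon> ln n / 2\<close>.\<close>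
  obtain n1 where n1: "exp (6 / \<epsilon>) < real n1" using reals_Archimedean2 by blast
  define n2 where "n2 = max 2 (max n0 n1)"
  have conc: "lower_conc M (N n S) (\<epsilon> * ln (real n)) (4 * C * real n powr - c)" if n: "n \<ge> n2" for n
  proof -
    define l where "l = ln (real n)"
    define p where "p = C * real n powr - c"
    have p: "p \<ge> 0" using c by (simp add: p_def)
    have n': "n \<ge> 2" "n \<ge> n0" "n \<ge> n1" using n by (auto simp: n2_def)
    have l0: "l > 0" using n' by (simp add: l_def)
    have "exp (6 / \<epsilon>) < real n" using n1 n'(3) by (meson less_le_trans of_nat_mono)
    then have "6 / \<epsilon> < l" unfolding l_def using n' by (subst ln_exp[symmetric], subst ln_less_cancel_iff) auto
    then have l6: "6 < \<epsilon> * l" using eps by (simp add: field_simps)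
    note Q = quarterN[OF n'(2), folded l_def p_def]
    have "lower_conc M (N n S) (\<epsilon> * l) (4 * p)"
    proof (cases "S = UNIV")
      case True
      have "lower_conc M (\<lambda>\<omega>. ((N n {0..1} \<omega> + N n {1..} \<omega>) + N n {-1..0} \<omega>) + N n {..-1} \<omega>)
          (((\<epsilon> / 8 * l + \<epsilon> / 8 * l) + \<epsilon> / 8 * l) + \<epsilon> / 8 * l) (((p + p) + p) + p)"
        by (intro lower_conc_add Q) auto
      then have "lower_conc M (N n UNIV) ((((\<epsilon> / 8 * l + \<epsilon> / 8 * l) + \<epsilon> / 8 * l) + \<epsilon> / 8 * l) + 3) (((p + p) + p) + p)"
      proof (rule lower_conc_perturb)
        fix \<omega>
        show "N n UNIV \<omega> \<le> N n {0..1} \<omega> + N n {1..} \<omega> + N n {-1..0} \<omega> + N n {..-1} \<omega>"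
          unfolding N_def using card_roots_real_line(1)[of "\<lambda>i. \<xi> i \<omega>" n] by linarith
        show "N n {0..1} \<omega> + N n {1..} \<omega> + N n {-1..0} \<omega> + N n {..-1} \<omega> \<le> N n UNIV \<omega> + 3"
          unfolding N_def using card_roots_real_line(2)[of "\<lambda>i. \<xi> i \<omega>" n] by linarith
      qed
      then show ?thesis unfolding True by (rule lower_conc_mono) (use l6 in auto)
    next
      case False
      then have "lower_conc M (N n S) (\<epsilon> / 8 * l) p" using S by (intro Q) auto
      then show ?thesis by (rule lower_conc_mono) (use l0 eps p in auto)
    qed
    then show ?thesis by (simp add: l_def p_def mult_ac)
  qed
  \<comment> \<open>For \<open>n < n2\<close> the second summand makes the bound exceed 1.\<close>
  define D where "D = 4 * C + real n2 powr c"
  show "\<exists>c>0. \<exists>C>0. \<forall>n\<ge>1. prob {\<omega> \<in> space M. real (num_roots \<xi> n S \<omega>) \<le>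
      expectation (\<lambda>\<omega>. real (num_roots \<xi> n S \<omega>)) - \<epsilon> * ln (real n)} \<le> C * real n powr (- c)"
    unfolding nr
  proof (rule exI[of _ c], rule conjI[OF c(1)], rule exI[of _ D], intro conjI allI impI)
    show "0 < D" using c by (simp add: D_def add_pos_nonneg)
    fix n :: nat assume n: "n \<ge> 1"
    show "prob {\<omega> \<in> space M. N n S \<omega> \<le> expectation (\<lambda>\<omega>. N n S \<omega>) - \<epsilon> * ln (real n)} \<le> D * real n powr - c"
    proof (cases "n \<ge> n2")
      case True
      have "prob {\<omega> \<in> space M. N n S \<omega> \<le> expectation (\<lambda>\<omega>. N n S \<omega>) - \<epsilon> * ln (real n)} \<le> 4 * C * real n powr - c"
        by (rule prob_le_of_lower_conc[OF conc[OF True]]) (use True eps c in \<open>auto simp: n2_def N_def\<close>)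
      also have "\<dots> \<le> D * real n powr - c" by (intro mult_right_mono) (auto simp: D_def)
      finally show ?thesis .
    next
      case False
      then have "real n powr c \<le> real n2 powr c" using c by (intro powr_mono2) auto
      also have "\<dots> \<le> D" using c by (simp add: D_def)
      finally have "real n powr c * real n powr - c \<le> D * real n powr - c" by (intro mult_right_mono) auto
      then have "1 \<le> D * real n powr - c" using n by (simp add: powr_minus)
      then show ?thesis by (meson prob_le_1 order_trans)
    qed
  qed
qed

end
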